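(* Let $\mathbf{k}$ be a commutative noetherian ring and let $\mathsf{T}$ be an essentially small, Hom-finite, $\mathbf{k}$-linear, Krull-Schmidt triangulated category with shift functor $\Sigma$. Let $\mathsf{S}$ be a presilting subcategory of $\mathsf{T}$ such that $\mathsf{mod}\,\mathsf{S}$ is noetherian, and set $\mathsf{C}=\mathsf{S} * \Sigma\mathsf{S}$. Then there is a bijection $$\{\text{complete cotorsion pairs in } \mathsf{C}\}\ \longleftrightarrow\ \{\text{functorially finite torsion pairs in } \mathsf{mod}\,\mathsf{S}\}.$$
   Context: Write $\mathsf{T}(a,b)=\mathrm{Hom}_{\mathsf{T}}(a,b)$. Hom-finite means that $\mathsf{T}(a,b)$ is a finitely generated $\mathbf{k}$-module for all $a,b\in\mathsf{T}$. A presilting subcategory is a full additive subcategory $\mathsf{S}$ of $\mathsf{T}$, closed under direct summands, such that $\mathsf{T}(s_1,\Sigma^i s_2)=0$ for all $s_1,s_2\in\mathsf{S}$ and $i>0$. $\mathsf{S} * \Sigma\mathsf{S}$ is the full subcategory of objects $t$ admitting a distinguished triangle $s_1\to t\to\Sigma s_2\to\Sigma s_1$ with $s_1,s_2\in\mathsf{S}$; it is closed under direct summands and extensions in $\mathsf{T}$. $\mathsf{C}$ is regarded as an extriangulated category with the structure induced from $\mathsf{T}$: $\mathbb{E}(c,a)=\mathsf{T}(c,\Sigma a)$, and the $\mathbb{E}$-triangles $a\to b\to c$ are given by distinguished triangles $a\to b\to c\to\Sigma a$ of $\mathsf{T}$ with $a,b,c\in\mathsf{C}$. A complete cotorsion pair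 in $\mathsf{C}$ is a pair $(\mathcal{X},\mathcal{Y})$ of full additive subcategories of $\mathsf{C}$ closed under direct summands such that: (1) $\mathbb{E}(x,y)=0$ for all $x\in\mathcal{X}$, $y\in\mathcal{Y}$; (2) for each $c\in\mathsf{C}$ there is an $\mathbb{E}$-triangle $c\to y\to x$ with $x\in\mathcal{X}$, $y\in\mathcal{Y}$; (3) for each $c\in\mathsf{C}$ there is an $\mathbb{E}$-triangle $y\to x\to c$ with $x\in\mathcal{X}$, $y\in\mathcal{Y}$. $\mathsf{mod}\,\mathsf{S}$ is the category of finitely presented contravariant additive functors from $\mathsf{S}$ to $\mathbf{k}$-modules; noetherian means that it is an abelian category in which every object is noetherian. For a subcategory $\mathcal{U}$ of an abelian category $\mathsf{H}$, $\mathcal{U}^{\perp}=\{h\in\mathsf{H}\mid\mathrm{Hom}(u,h)=0\ \forall u\in\mathcal{U}\}$ and ${}^{\perp}\mathcal{U}=\{h\in\mathsf{H}\mid\mathrm{Hom}(h,u)=0\ \forall u\in\mathcal{U}\}$. A torsion pair in $\mathsf{H}$ is a pair of full subcategories $(\mathcal{T},\mathcal{F})$ with $\mathcal{T}^{\perp}=\mathcal{F}$, ${}^{\perp}\mathcal{F}=\mathcal{T}$ such that each $h\in\mathsf{H}$ fits in a short exact sequence $0\to t\to h\to f\to 0$ with $t\in\mathcal{T}$, $f\in\mathcal{F}$. It is functorially finite if $\mathcal{T}$ is covariantly finite in $\mathsf{H}$, i.e. every $h\in\mathsf{H}$ admits a morphism $h\to t$ with $t\in\mathcal{T}$ through which every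 morphism from $h$ to an object of $\mathcal{T}$ factors. *)

theory Defs
  imports "HOL-Algebra.Module" "HOL-Algebra.Ring_Divisibility"
begin

section \<open>Linear categories\<close>

text \<open>
  The morphisms from a to b are the elements of the module \<open>Hom A a b\<close>; the Hom modules of
  different pairs of objects need not be disjoint, so composition takes the three objects
  as arguments: \<open>Cmp A a b c g f\<close> is \<open>g\<close> after \<open>f\<close>, for \<open>f\<close> from a to b and \<open>g\<close> from b to c.
  A record of type \<open>module\<close> also carries ring multiplication and unit fields; these are never used
  for Hom modules or for values of functors. Full subcategories are given by their sets of objects.
\<close>

record ('o, 'm, 'k) lincat =
  Obj :: "'o set"
  Hom :: "'o \<Rightarrow> 'o \<Rightarrow> ('k, 'm) module"
  Idm :: "'o \<Rightarrow> 'm"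
  Cmp :: "'o \<Rightarrow> 'o \<Rightarrow> 'o \<Rightarrow> 'm \<Rightarrow> 'm \<Rightarrow> 'm"

abbreviation arr :: "('o, 'm, 'k, 'z) lincat_scheme \<Rightarrow> 'o \<Rightarrow> 'o \<Rightarrow> 'm set"
  where "arr A a b \<equiv> carrier (Hom A a b)"

locale linear_category = cring k for k :: "'k ring" +
  fixes A :: "('o, 'm, 'k, 'z) lincat_scheme"
  assumes module_Hom: "\<lbrakk>a \<in> Obj A; b \<in> Obj A\<rbrakk> \<Longrightarrow> module k (Hom A a b)"
    and Idm_arr: "a \<in> Obj A \<Longrightarrow> Idm A a \<in> arr A a a"
    and Cmp_arr: "\<lbrakk>a \<in> Obj A; b \<in> Obj A; c \<in> Obj A; f \<in> arr A a b; g \<in> arr A b c\<rbrakk>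
      \<Longrightarrow> Cmp A a b c g f \<in> arr A a c"
    and Cmp_Idm_right: "\<lbrakk>a \<in> Obj A; b \<in> Obj A; f \<in> arr A a b\<rbrakk> \<Longrightarrow> Cmp A a a b f (Idm A a) = f"
    and Cmp_Idm_left: "\<lbrakk>a \<in> Obj A; b \<in> Obj A; f \<in> arr A a b\<rbrakk> \<Longrightarrow> Cmp A a b b (Idm A b) f = f"
    and Cmp_assoc: "\<lbrakk>a \<in> Obj A; b \<in> Obj A; c \<in> Obj A; d \<in> Obj A;
        f \<in> arr A a b; g \<in> arr A b c; h \<in> arr A c d\<rbrakk>
      \<Longrightarrow> Cmp A a b d (Cmp A b c d h g) f = Cmp A a c d h (Cmp A a b c g f)"
    and Cmp_add_left: "\<lbrakk>a \<in> Obj A; b \<in> Obj A; c \<in> Obj A;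
        f \<in> arr A a b; g \<in> arr A b c; g' \<in> arr A b c\<rbrakk>
      \<Longrightarrow> Cmp A a b c (g \<oplus>\<^bsub>Hom A b c\<^esub> g') f = Cmp A a b c g f \<oplus>\<^bsub>Hom A a c\<^esub> Cmp A a b c g' f"
    and Cmp_add_right: "\<lbrakk>a \<in> Obj A; b \<in> Obj A; c \<in> Obj A;
        f \<in> arr A a b; f' \<in> arr A a b; g \<in> arr A b c\<rbrakk>
      \<Longrightarrow> Cmp A a b c g (f \<oplus>\<^bsub>Hom A a b\<^esub> f') = Cmp A a b c g f \<oplus>\<^bsub>Hom A a c\<^esub> Cmp A a b c g f'"
    and Cmp_smult_left: "\<lbrakk>a \<in> Obj A; b \<in> Obj A; c \<in> Obj A;
        r \<in> carrier k; f \<in> arr A a b; g \<in> arr A b c\<rbrakk>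
      \<Longrightarrow> Cmp A a b c (r \<odot>\<^bsub>Hom A b c\<^esub> g) f = r \<odot>\<^bsub>Hom A a c\<^esub> Cmp A a b c g f"
    and Cmp_smult_right: "\<lbrakk>a \<in> Obj A; b \<in> Obj A; c \<in> Obj A;
        r \<in> carrier k; f \<in> arr A a b; g \<in> arr A b c\<rbrakk>
      \<Longrightarrow> Cmp A a b c g (r \<odot>\<^bsub>Hom A a b\<^esub> f) = r \<odot>\<^bsub>Hom A a c\<^esub> Cmp A a b c g f"

definition full_sub :: "('o, 'm, 'k, 'z) lincat_scheme \<Rightarrow> 'o set \<Rightarrow> ('o, 'm, 'k, 'z) lincat_scheme"
  where "full_sub A P = A\<lparr>Obj := P\<rparr>"

definition is_iso :: "('o, 'm, 'k, 'z) lincat_scheme \<Rightarrow> 'o \<Rightarrow> 'o \<Rightarrow> 'm \<Rightarrow> bool"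
  where "is_iso A a b f \<longleftrightarrow> f \<in> arr A a b \<and>
    (\<exists>g \<in> arr A b a. Cmp A a b a g f = Idm A a \<and> Cmp A b a b f g = Idm A b)"

definition zero_object :: "('o, 'm, 'k, 'z) lincat_scheme \<Rightarrow> 'o \<Rightarrow> bool"
  where "zero_object A z \<longleftrightarrow> z \<in> Obj A \<and>
    (\<forall>x \<in> Obj A. (\<exists>!f. f \<in> arr A z x) \<and> (\<exists>!f. f \<in> arr A x z))"

text \<open>\<open>direct_sum A x n xs\<close>: x is a direct sum (biproduct) of \<open>xs 0, \<dots>, xs (n - 1)\<close>. The case
  \<open>n = 0\<close> says that the identity of x vanishes, i.e. that x is a zero object.\<close>

definition direct_sum :: "('o, 'm, 'k, 'z) lincat_scheme \<Rightarrow> 'o \<Rightarrow> nat \<Rightarrow> (nat \<Rightarrow> 'o) \<Rightarrow> bool"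
  where "direct_sum A x n xs \<longleftrightarrow> x \<in> Obj A \<and> (\<forall>i<n. xs i \<in> Obj A) \<and>
    (\<exists>\<iota> \<pi>. (\<forall>i<n. \<iota> i \<in> arr A (xs i) x \<and> \<pi> i \<in> arr A x (xs i)) \<and>
      (\<forall>i<n. \<forall>j<n. Cmp A (xs i) x (xs j) (\<pi> j) (\<iota> i) =
        (if i = j then Idm A (xs i) else \<zero>\<^bsub>Hom A (xs i) (xs j)\<^esub>)) \<and>
      (\<Oplus>\<^bsub>Hom A x x\<^esub>i\<in>{..<n}. Cmp A x (xs i) x (\<iota> i) (\<pi> i)) = Idm A x)"

locale additive_category = linear_category +
  assumes direct_sum_exists: "(\<And>i. i < n \<Longrightarrow> xs i \<in> Obj A) \<Longrightarrow> \<exists>x. direct_sum A x n xs"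

text \<open>Full additive subcategories closed under direct summands; these are automatically closed
  under isomorphism, as isomorphic objects are direct summands of each other.\<close>

definition additive_summand_closed :: "('o, 'm, 'k, 'z) lincat_scheme \<Rightarrow> 'o set \<Rightarrow> bool"
  where "additive_summand_closed A P \<longleftrightarrow> P \<subseteq> Obj A \<and>
    (\<forall>x n xs. direct_sum A x n xs \<and> (\<forall>i<n. xs i \<in> P) \<longrightarrow> x \<in> P) \<and>
    (\<forall>x n xs. direct_sum A x n xs \<and> x \<in> P \<longrightarrow> (\<forall>i<n. xs i \<in> P))"

definition finitely_generated_module :: "'k ring \<Rightarrow> ('k, 'v) module \<Rightarrow> bool"
  where "finitely_generated_module k M \<longleftrightarrow>
    (\<exists>G. finite G \<and> G \<subseteq> carrier M \<and>
      (\<forall>x \<in> carrier M. \<exists>c \<in> G \<rightarrow> carrier k. x = (\<Oplus>\<^bsub>M\<^esub>g\<in>G. c g \<odot>\<^bsub>M\<^esub> g)))"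

definition Hom_finite :: "'k ring \<Rightarrow> ('o, 'm, 'k, 'z) lincat_scheme \<Rightarrow> bool"
  where "Hom_finite k A \<longleftrightarrow>
    (\<forall>a \<in> Obj A. \<forall>b \<in> Obj A. finitely_generated_module k (Hom A a b))"

definition End_ring :: "('o, 'm, 'k, 'z) lincat_scheme \<Rightarrow> 'o \<Rightarrow> 'm ring"
  where "End_ring A a = \<lparr>carrier = arr A a a, mult = Cmp A a a a, one = Idm A a,
    zero = \<zero>\<^bsub>Hom A a a\<^esub>, add = add (Hom A a a)\<rparr>"

text \<open>Local rings, not necessarily commutative.\<close>

definition local_ring :: "'r ring \<Rightarrow> bool"
  where "local_ring R \<longleftrightarrow> ring R \<and> \<one>\<^bsub>R\<^esub> \<noteq> \<zero>\<^bsub>R\<^esub> \<and>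
    (\<forall>x \<in> carrier R - Units R. \<forall>y \<in> carrier R - Units R. x \<oplus>\<^bsub>R\<^esub> y \<notin> Units R)"

definition Krull_Schmidt :: "('o, 'm, 'k, 'z) lincat_scheme \<Rightarrow> bool"
  where "Krull_Schmidt A \<longleftrightarrow>
    (\<forall>x \<in> Obj A. \<exists>n xs. direct_sum A x n xs \<and> (\<forall>i<n. local_ring (End_ring A (xs i))))"

definition module_hom :: "'k ring \<Rightarrow> ('k, 'v) module \<Rightarrow> ('k, 'w) module \<Rightarrow> ('v \<Rightarrow> 'w) set"
  where "module_hom k M N = {f \<in> carrier M \<rightarrow> carrier N.
    (\<forall>x \<in> carrier M. \<forall>y \<in> carrier M. f (x \<oplus>\<^bsub>M\<^esub> y) = f x \<oplus>\<^bsub>N\<^esub> f y) \<and>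
    (\<forall>r \<in> carrier k. \<forall>x \<in> carrier M. f (r \<odot>\<^bsub>M\<^esub> x) = r \<odot>\<^bsub>N\<^esub> f x)}"


section \<open>Triangulated categories\<close>

text \<open>\<open>Sh\<close> and \<open>ShM\<close> are the shift on objects and on morphisms, and \<open>(a, b, c, f, g, h) \<in> Tri\<close>
  says that a -f-> b -g-> c -h-> Sh a is a distinguished triangle.\<close>

record ('o, 'm, 'k) tricat = "('o, 'm, 'k) lincat" +
  Sh :: "'o \<Rightarrow> 'o"
  ShM :: "'o \<Rightarrow> 'o \<Rightarrow> 'm \<Rightarrow> 'm"
  Tri :: "('o \<times> 'o \<times> 'o \<times> 'm \<times> 'm \<times> 'm) set"

text \<open>The shift is a linear autoequivalence; strict automorphisms are a special case.\<close>

locale triangulated_category = additive_category k T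
  for k :: "'k ring" and T :: "('o, 'm, 'k, 'z) tricat_scheme" +
  assumes Sh_Obj: "a \<in> Obj T \<Longrightarrow> Sh T a \<in> Obj T"
    and ShM_linear: "\<lbrakk>a \<in> Obj T; b \<in> Obj T\<rbrakk>
      \<Longrightarrow> ShM T a b \<in> module_hom k (Hom T a b) (Hom T (Sh T a) (Sh T b))"
    and ShM_Idm: "a \<in> Obj T \<Longrightarrow> ShM T a a (Idm T a) = Idm T (Sh T a)"
    and ShM_Cmp: "\<lbrakk>a \<in> Obj T; b \<in> Obj T; c \<in> Obj T; f \<in> arr T a b; g \<in> arr T b c\<rbrakk>
      \<Longrightarrow> ShM T a c (Cmp T a b c g f) = Cmp T (Sh T a) (Sh T b) (Sh T c) (ShM T b c g) (ShM T a b f)"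
    and ShM_fully_faithful: "\<lbrakk>a \<in> Obj T; b \<in> Obj T\<rbrakk>
      \<Longrightarrow> bij_betw (ShM T a b) (arr T a b) (arr T (Sh T a) (Sh T b))"
    and Sh_essentially_surjective: "b \<in> Obj T \<Longrightarrow> \<exists>a \<in> Obj T. \<exists>f. is_iso T (Sh T a) b f"
    and Tri_arr: "(a, b, c, f, g, h) \<in> Tri T \<Longrightarrow> a \<in> Obj T \<and> b \<in> Obj T \<and> c \<in> Obj T \<and>
        f \<in> arr T a b \<and> g \<in> arr T b c \<and> h \<in> arr T c (Sh T a)"
    and Tri_iso: "\<lbrakk>(a, b, c, f, g, h) \<in> Tri T; a' \<in> Obj T; b' \<in> Obj T; c' \<in> Obj T;
        f' \<in> arr T a' b'; g' \<in> arr T b' c'; h' \<in> arr T c' (Sh T a');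
        is_iso T a a' u; is_iso T b b' v; is_iso T c c' w;
        Cmp T a b b' v f = Cmp T a a' b' f' u;
        Cmp T b c c' w g = Cmp T b b' c' g' v;
        Cmp T c (Sh T a) (Sh T a') (ShM T a a' u) h = Cmp T c c' (Sh T a') h' w\<rbrakk>
      \<Longrightarrow> (a', b', c', f', g', h') \<in> Tri T"
    and Tri_Idm: "\<lbrakk>a \<in> Obj T; zero_object T z\<rbrakk>
      \<Longrightarrow> (a, a, z, Idm T a, \<zero>\<^bsub>Hom T a z\<^esub>, \<zero>\<^bsub>Hom T z (Sh T a)\<^esub>) \<in> Tri T"
    and Tri_cone: "\<lbrakk>a \<in> Obj T; b \<in> Obj T; f \<in> arr T a b\<rbrakk> \<Longrightarrow> \<exists>c g h. (a, b, c, f, g, h) \<in> Tri T"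
    and Tri_rotate: "\<lbrakk>a \<in> Obj T; b \<in> Obj T; c \<in> Obj T;
        f \<in> arr T a b; g \<in> arr T b c; h \<in> arr T c (Sh T a)\<rbrakk>
      \<Longrightarrow> (a, b, c, f, g, h) \<in> Tri T \<longleftrightarrow>
          (b, c, Sh T a, g, h, \<ominus>\<^bsub>Hom T (Sh T a) (Sh T b)\<^esub> ShM T a b f) \<in> Tri T"
    and Tri_complete: "\<lbrakk>(a, b, c, f, g, h) \<in> Tri T; (a', b', c', f', g', h') \<in> Tri T;
        u \<in> arr T a a'; v \<in> arr T b b'; Cmp T a b b' v f = Cmp T a a' b' f' u\<rbrakk>
      \<Longrightarrow> \<exists>w \<in> arr T c c'. Cmp T b c c' w g = Cmp T b b' c' g' v \<and>
          Cmp T c (Sh T a) (Sh T a') (ShM T a a' u) h = Cmp T c c' (Sh T a') h' w"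
    and Tri_octahedral: "\<lbrakk>(x, y, z', f, i, i') \<in> Tri T; (y, z, x', g, j, j') \<in> Tri T;
        (x, z, y', Cmp T x y z g f, l, l') \<in> Tri T\<rbrakk>
      \<Longrightarrow> \<exists>u \<in> arr T z' y'. \<exists>v \<in> arr T y' x'.
          (z', y', x', u, v, Cmp T x' (Sh T y) (Sh T z') (ShM T y z' i) j') \<in> Tri T \<and>
          Cmp T y z' y' u i = Cmp T y z y' l g \<and>
          Cmp T z' y' (Sh T x) l' u = i' \<and>
          Cmp T z y' x' v l = j \<and>
          Cmp T y' x' (Sh T y) j' v = Cmp T y' (Sh T x) (Sh T y) (ShM T x y f) l'"

definition presilting :: "('o, 'm, 'k, 'z) tricat_scheme \<Rightarrow> 'o set \<Rightarrow> bool"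
  where "presilting T S \<longleftrightarrow> additive_summand_closed T S \<and>
    (\<forall>s \<in> S. \<forall>s' \<in> S. \<forall>i>0. arr T s ((Sh T ^^ i) s') = {\<zero>\<^bsub>Hom T s ((Sh T ^^ i) s')\<^esub>})"

text \<open>The objects of \<open>S * Sh S\<close>.\<close>

definition two_term :: "('o, 'm, 'k, 'z) tricat_scheme \<Rightarrow> 'o set \<Rightarrow> 'o set"
  where "two_term T S = {t \<in> Obj T. \<exists>s \<in> S. \<exists>s' \<in> S. \<exists>f g h. (s, t, Sh T s', f, g, h) \<in> Tri T}"

definition complete_cotorsion_pair ::
    "('o, 'm, 'k, 'z) tricat_scheme \<Rightarrow> 'o set \<Rightarrow> 'o set \<Rightarrow> 'o set \<Rightarrow> bool"
  where "complete_cotorsion_pair T C P Q \<longleftrightarrow>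
    additive_summand_closed (full_sub T C) P \<and> additive_summand_closed (full_sub T C) Q \<and>
    (\<forall>x \<in> P. \<forall>y \<in> Q. arr T x (Sh T y) = {\<zero>\<^bsub>Hom T x (Sh T y)\<^esub>}) \<and>
    (\<forall>c \<in> C. \<exists>y \<in> Q. \<exists>x \<in> P. \<exists>f g h. (c, y, x, f, g, h) \<in> Tri T) \<and>
    (\<forall>c \<in> C. \<exists>y \<in> Q. \<exists>x \<in> P. \<exists>f g h. (y, x, c, f, g, h) \<in> Tri T)"


section \<open>Abelian categories and torsion pairs\<close>

definition is_mono :: "('o, 'm, 'k, 'z) lincat_scheme \<Rightarrow> 'o \<Rightarrow> 'o \<Rightarrow> 'm \<Rightarrow> bool"
  where "is_mono A a b f \<longleftrightarrow> f \<in> arr A a b \<and>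
    (\<forall>x \<in> Obj A. \<forall>u \<in> arr A x a. \<forall>v \<in> arr A x a. Cmp A x a b f u = Cmp A x a b f v \<longrightarrow> u = v)"

definition is_epi :: "('o, 'm, 'k, 'z) lincat_scheme \<Rightarrow> 'o \<Rightarrow> 'o \<Rightarrow> 'm \<Rightarrow> bool"
  where "is_epi A a b f \<longleftrightarrow> f \<in> arr A a b \<and>
    (\<forall>x \<in> Obj A. \<forall>u \<in> arr A b x. \<forall>v \<in> arr A b x. Cmp A a b x u f = Cmp A a b x v f \<longrightarrow> u = v)"

text \<open>\<open>is_kernel A a b c f g\<close>: f from a to b is a kernel of g from b to c. Dually,
  \<open>is_cokernel A a b c f g\<close>: g is a cokernel of f.\<close>

definition is_kernel :: "('o, 'm, 'k, 'z) lincat_scheme \<Rightarrow> 'o \<Rightarrow> 'o \<Rightarrow> 'o \<Rightarrow> 'm \<Rightarrow> 'm \<Rightarrow> bool"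
  where "is_kernel A a b c f g \<longleftrightarrow> f \<in> arr A a b \<and> g \<in> arr A b c \<and>
    Cmp A a b c g f = \<zero>\<^bsub>Hom A a c\<^esub> \<and>
    (\<forall>x \<in> Obj A. \<forall>u \<in> arr A x b. Cmp A x b c g u = \<zero>\<^bsub>Hom A x c\<^esub> \<longrightarrow>
      (\<exists>!v. v \<in> arr A x a \<and> Cmp A x a b f v = u))"

definition is_cokernel :: "('o, 'm, 'k, 'z) lincat_scheme \<Rightarrow> 'o \<Rightarrow> 'o \<Rightarrow> 'o \<Rightarrow> 'm \<Rightarrow> 'm \<Rightarrow> bool"
  where "is_cokernel A a b c f g \<longleftrightarrow> f \<in> arr A a b \<and> g \<in> arr A b c \<and>
    Cmp A a b c g f = \<zero>\<^bsub>Hom A a c\<^esub> \<and>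
    (\<forall>x \<in> Obj A. \<forall>u \<in> arr A b x. Cmp A a b x u f = \<zero>\<^bsub>Hom A a x\<^esub> \<longrightarrow>
      (\<exists>!v. v \<in> arr A c x \<and> Cmp A b c x v g = u))"

locale abelian_category = additive_category +
  assumes kernel_exists: "\<lbrakk>b \<in> Obj A; c \<in> Obj A; g \<in> arr A b c\<rbrakk>
      \<Longrightarrow> \<exists>a \<in> Obj A. \<exists>f. is_kernel A a b c f g"
    and cokernel_exists: "\<lbrakk>a \<in> Obj A; b \<in> Obj A; f \<in> arr A a b\<rbrakk>
      \<Longrightarrow> \<exists>c \<in> Obj A. \<exists>g. is_cokernel A a b c f g"
    and mono_is_kernel: "\<lbrakk>a \<in> Obj A; b \<in> Obj A; is_mono A a b f\<rbrakk>
      \<Longrightarrow> \<exists>c \<in> Obj A. \<exists>g. is_kernel A a b c f g"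
    and epi_is_cokernel: "\<lbrakk>b \<in> Obj A; c \<in> Obj A; is_epi A b c g\<rbrakk>
      \<Longrightarrow> \<exists>a \<in> Obj A. \<exists>f. is_cokernel A a b c f g"

text \<open>Ascending chain condition on subobjects: the subobject represented by \<open>u i\<close> is contained in
  the one represented by \<open>u j\<close> iff \<open>u i\<close> factors through \<open>u j\<close>.\<close>

definition noetherian_object :: "('o, 'm, 'k, 'z) lincat_scheme \<Rightarrow> 'o \<Rightarrow> bool"
  where "noetherian_object A a \<longleftrightarrow>
    (\<forall>x u. (\<forall>i::nat. x i \<in> Obj A \<and> is_mono A (x i) a (u i) \<and>
          (\<exists>v \<in> arr A (x i) (x (Suc i)). u i = Cmp A (x i) (x (Suc i)) a (u (Suc i)) v)) \<longrightarrow>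
      (\<exists>N. \<forall>i\<ge>N. \<exists>v \<in> arr A (x (Suc i)) (x i). u (Suc i) = Cmp A (x (Suc i)) (x i) a (u i) v))"

definition noetherian_category :: "'k ring \<Rightarrow> ('o, 'm, 'k, 'z) lincat_scheme \<Rightarrow> bool"
  where "noetherian_category k A \<longleftrightarrow>
    abelian_category k A \<and> (\<forall>a \<in> Obj A. noetherian_object A a)"

definition right_perp :: "('o, 'm, 'k, 'z) lincat_scheme \<Rightarrow> 'o set \<Rightarrow> 'o set"
  where "right_perp A U = {h \<in> Obj A. \<forall>u \<in> U. arr A u h = {\<zero>\<^bsub>Hom A u h\<^esub>}}"

definition left_perp :: "('o, 'm, 'k, 'z) lincat_scheme \<Rightarrow> 'o set \<Rightarrow> 'o set"
  where "left_perp A U = {h \<in> Obj A. \<forall>u \<in> U. arr A h u = {\<zero>\<^bsub>Hom A h u\<^esub>}}"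

definition short_exact :: "('o, 'm, 'k, 'z) lincat_scheme \<Rightarrow> 'o \<Rightarrow> 'o \<Rightarrow> 'o \<Rightarrow> 'm \<Rightarrow> 'm \<Rightarrow> bool"
  where "short_exact A a b c f g \<longleftrightarrow> is_kernel A a b c f g \<and> is_cokernel A a b c f g"

definition torsion_pair :: "('o, 'm, 'k, 'z) lincat_scheme \<Rightarrow> 'o set \<Rightarrow> 'o set \<Rightarrow> bool"
  where "torsion_pair H U V \<longleftrightarrow> U \<subseteq> Obj H \<and> V \<subseteq> Obj H \<and>
    right_perp H U = V \<and> left_perp H V = U \<and>
    (\<forall>h \<in> Obj H. \<exists>u \<in> U. \<exists>v \<in> V. \<exists>f g. short_exact H u h v f g)"

definition covariantly_finite :: "('o, 'm, 'k, 'z) lincat_scheme \<Rightarrow> 'o set \<Rightarrow> bool"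
  where "covariantly_finite H U \<longleftrightarrow>
    (\<forall>h \<in> Obj H. \<exists>u \<in> U. \<exists>f \<in> arr H h u.
      \<forall>u' \<in> U. \<forall>g \<in> arr H h u'. \<exists>e \<in> arr H u u'. g = Cmp H h u u' e f)"

definition functorially_finite_torsion_pair ::
    "('o, 'm, 'k, 'z) lincat_scheme \<Rightarrow> 'o set \<Rightarrow> 'o set \<Rightarrow> bool"
  where "functorially_finite_torsion_pair H U V \<longleftrightarrow> torsion_pair H U V \<and> covariantly_finite H U"


section \<open>Finitely presented functors\<close>

text \<open>For \<open>f\<close> from a to b, the contravariant functor F sends f to the map \<open>FMor F a b f\<close>
  from \<open>FOb F b\<close> to \<open>FOb F a\<close>.\<close>

record ('o, 'm, 'k, 'v) modfunctor =
  FOb :: "'o \<Rightarrow> ('k, 'v) module"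
  FMor :: "'o \<Rightarrow> 'o \<Rightarrow> 'm \<Rightarrow> 'v \<Rightarrow> 'v"

definition contravariant_additive ::
    "'k ring \<Rightarrow> ('o, 'm, 'k, 'z) lincat_scheme \<Rightarrow> ('o, 'm, 'k, 'v) modfunctor \<Rightarrow> bool"
  where "contravariant_additive k A F \<longleftrightarrow>
    (\<forall>a \<in> Obj A. module k (FOb F a)) \<and>
    (\<forall>a \<in> Obj A. \<forall>b \<in> Obj A. \<forall>f \<in> arr A a b. FMor F a b f \<in> module_hom k (FOb F b) (FOb F a)) \<and>
    (\<forall>a \<in> Obj A. \<forall>x \<in> carrier (FOb F a). FMor F a a (Idm A a) x = x) \<and>
    (\<forall>a \<in> Obj A. \<forall>b \<in> Obj A. \<forall>c \<in> Obj A. \<forall>f \<in> arr A a b. \<forall>g \<in> arr A b c.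
      \<forall>x \<in> carrier (FOb F c). FMor F a c (Cmp A a b c g f) x = FMor F a b f (FMor F b c g x)) \<and>
    (\<forall>a \<in> Obj A. \<forall>b \<in> Obj A. \<forall>f \<in> arr A a b. \<forall>g \<in> arr A a b.
      \<forall>x \<in> carrier (FOb F b).
        FMor F a b (f \<oplus>\<^bsub>Hom A a b\<^esub> g) x = FMor F a b f x \<oplus>\<^bsub>FOb F a\<^esub> FMor F a b g x)"

definition natural :: "'k ring \<Rightarrow> ('o, 'm, 'k, 'z) lincat_scheme \<Rightarrow>
    ('o, 'm, 'k, 'v) modfunctor \<Rightarrow> ('o, 'm, 'k, 'w) modfunctor \<Rightarrow> ('o \<Rightarrow> 'v \<Rightarrow> 'w) \<Rightarrow> bool"
  where "natural k A F G \<eta> \<longleftrightarrow>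
    (\<forall>a \<in> Obj A. \<eta> a \<in> module_hom k (FOb F a) (FOb G a)) \<and>
    (\<forall>a \<in> Obj A. \<forall>b \<in> Obj A. \<forall>f \<in> arr A a b. \<forall>x \<in> carrier (FOb F b).
      \<eta> a (FMor F a b f x) = FMor G a b f (\<eta> b x))"

definition representable :: "('o, 'm, 'k, 'z) lincat_scheme \<Rightarrow> 'o \<Rightarrow> ('o, 'm, 'k, 'm) modfunctor"
  where "representable A s = \<lparr>FOb = (\<lambda>a. Hom A a s), FMor = (\<lambda>a b f g. Cmp A a b s g f)\<rparr>"

text \<open>There is an exact sequence \<open>A(-, s) \<longrightarrow> A(-, s') \<longrightarrow> F \<longrightarrow> 0\<close>.\<close>

definition finitely_presented ::
    "'k ring \<Rightarrow> ('o, 'm, 'k, 'z) lincat_scheme \<Rightarrow> ('o, 'm, 'k, 'v) modfunctor \<Rightarrow> bool"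
  where "finitely_presented k A F \<longleftrightarrow>
    (\<exists>s \<in> Obj A. \<exists>s' \<in> Obj A. \<exists>\<alpha> \<pi>.
      natural k A (representable A s) (representable A s') \<alpha> \<and>
      natural k A (representable A s') F \<pi> \<and>
      (\<forall>a \<in> Obj A. \<pi> a ` arr A a s' = carrier (FOb F a) \<and>
        \<alpha> a ` arr A a s = {x \<in> arr A a s'. \<pi> a x = \<zero>\<^bsub>FOb F a\<^esub>}))"

text \<open>
  The category of finitely presented functors. Its objects take values in modules whose elements are
  sets of morphisms of A. This loses nothing: \<open>F a\<close> is a quotient of \<open>A(a, s')\<close>, so every finitely
  presented functor with values in modules over any type is isomorphic to the one
  whose elements are the corresponding cosets. Natural transformations are made \<open>undefined\<close> outside
  their domain, so that equal morphisms are equal as HOL functions.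
\<close>

definition mod_cat :: "'k ring \<Rightarrow> ('o, 'm, 'k, 'z) lincat_scheme \<Rightarrow>
    (('o, 'm, 'k, 'm set) modfunctor, 'o \<Rightarrow> 'm set \<Rightarrow> 'm set, 'k) lincat"
  where "mod_cat k A =
    \<lparr>Obj = {F. contravariant_additive k A F \<and> finitely_presented k A F},
     Hom = (\<lambda>F G.
       \<lparr>carrier = {\<eta> \<in> (\<Pi>\<^sub>E a\<in>Obj A. extensional (carrier (FOb F a))). natural k A F G \<eta>},
        mult = undefined,
        one = undefined,
        zero = (\<lambda>a\<in>Obj A. \<lambda>x\<in>carrier (FOb F a). \<zero>\<^bsub>FOb G a\<^esub>),
        add = (\<lambda>\<eta> \<theta>. \<lambda>a\<in>Obj A. \<lambda>x\<in>carrier (FOb F a). \<eta> a x \<oplus>\<^bsub>FOb G a\<^esub> \<theta> a x),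
        smult = (\<lambda>r \<eta>. \<lambda>a\<in>Obj A. \<lambda>x\<in>carrier (FOb F a). r \<odot>\<^bsub>FOb G a\<^esub> \<eta> a x)\<rparr>),
     Idm = (\<lambda>F. \<lambda>a\<in>Obj A. \<lambda>x\<in>carrier (FOb F a). x),
     Cmp = (\<lambda>F G H \<theta> \<eta>. \<lambda>a\<in>Obj A. \<lambda>x\<in>carrier (FOb F a). \<theta> a (\<eta> a x))\<rparr>"

end

theory Submission
  imports Defs
begin

text \<open>
  Write C for \<open>S * \<Sigma>S\<close>. The functor sending c to \<open>T(-, c)\<close> restricted to S
  identifies the category of finitely presented functors with C modulo \<open>\<Sigma>S\<close>. If x is the cone of
  \<open>f : s\<^sub>1 \<rightarrow> s\<^sub>0\<close>, then \<open>T(x, \<Sigma>c) = 0\<close> iff every morphism from \<open>s\<^sub>1\<close> to c factors through f,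
  a condition on the functor of c alone which passes to quotients and extensions. Hence for a cotorsion pair
  \<open>(P, Q)\<close> the functors of the objects of Q form a class closed under quotients and extensions, which
  is a torsion class because all functors are noetherian, and the triangles \<open>c \<rightarrow> y \<rightarrow> x\<close> give
  left approximations.

  Conversely, let Q consist of the objects whose functor lies in a given functorially finite torsion class.
  A left approximation of functors becomes one of c by objects of Q after adding \<open>c \<rightarrow> \<Sigma>s\<^sub>1\<close>;
  by the Krull-Schmidt property it can be made minimal, and by Wakamatsu's lemma the cone x then satisfies
  \<open>T(x, \<Sigma>Q) = 0\<close>. The second kind of triangle for c is obtained by pushing out
  \<open>s\<^sub>1 \<rightarrow> y \<rightarrow> x\<close> along \<open>s\<^sub>1 \<rightarrow> s\<^sub>0\<close>.
\<close>

section \<open>Linear categories\<close>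

text \<open>A morphism of C is seen by functors only modulo morphisms vanishing on S, and these are
  the ones that factor through the connecting map \<open>c -> Sh a1\<close> of a presentation
  \<open>a1 -> a0 -> c\<close>. Hence C and the functor category are compared by lifting single
  morphisms (\<open>hom_lift\<close>, \<open>hom_of\<close>), and exactness is expressed by
  conditions on S-points.

  The two halves of a cotorsion pair are each other's Ext-orthogonals, so everything is about the
  second half. It occurs in two shapes: as an Ext-orthogonal (\<open>perpR\<close>), for which
  closure under quotients and extensions is visible, and as a Hom-orthogonal (\<open>torsY\<close>),
  which is what a torsion pair supplies.

  On the way back, the cone of an approximation a priori only lies in an extension of C by its
  shift. It is in C because \<open>T(x, Sh Sh S) = 0\<close> makes it a summand of an object of C;
  so closure of C under summands has to be proved beforehand. Minimality of an approximation f is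
  used as a fixed point property: \<open>\<phi> a = \<phi>\<close> and \<open>a f = 0\<close> imply
  \<open>\<phi> = 0\<close>. This is a Nakayama argument over local endomorphism rings.\<close>

context linear_category
begin

section \<open>Arithmetic in the Hom modules\<close>

abbreviation hom :: "'o \<Rightarrow> 'o \<Rightarrow> 'm set" where "hom a b \<equiv> carrier (Hom A a b)"
abbreviation idm :: "'o \<Rightarrow> 'm" where "idm a \<equiv> Idm A a"
abbreviation cmp :: "'m \<Rightarrow> 'o \<Rightarrow> 'o \<Rightarrow> 'o \<Rightarrow> 'm \<Rightarrow> 'm" (\<open>(_ \<cdot>[_,_,_] _)\<close> [71,0,0,0,70] 70)
  where "g \<cdot>[a,b,c] f \<equiv> Cmp A a b c g f"
abbreviation zer :: "'o \<Rightarrow> 'o \<Rightarrow> 'm" (\<open>\<zero>[_,_]\<close>) where "\<zero>[a,b] \<equiv> \<zero>\<^bsub>Hom A a b\<^esub>"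
abbreviation pls :: "'m \<Rightarrow> 'o \<Rightarrow> 'o \<Rightarrow> 'm \<Rightarrow> 'm" (\<open>(_ \<oplus>[_,_] _)\<close> [65,0,0,66] 65)
  where "f \<oplus>[a,b] g \<equiv> f \<oplus>\<^bsub>Hom A a b\<^esub> g"
abbreviation mns :: "'m \<Rightarrow> 'o \<Rightarrow> 'o \<Rightarrow> 'm \<Rightarrow> 'm" (\<open>(_ \<ominus>[_,_] _)\<close> [65,0,0,66] 65)
  where "f \<ominus>[a,b] g \<equiv> f \<ominus>\<^bsub>Hom A a b\<^esub> g"
abbreviation neg :: "'o \<Rightarrow> 'o \<Rightarrow> 'm \<Rightarrow> 'm" where "neg a b f \<equiv> \<ominus>\<^bsub>Hom A a b\<^esub> f"

lemma Hom_group: "a \<in> Obj A \<Longrightarrow> b \<in> Obj A \<Longrightarrow> abelian_group (Hom A a b)"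
  using module_Hom module_def by blast

lemma zer_arr [simp]: "a \<in> Obj A \<Longrightarrow> b \<in> Obj A \<Longrightarrow> \<zero>[a,b] \<in> hom a b"
  and pls_arr [simp]: "a \<in> Obj A \<Longrightarrow> b \<in> Obj A \<Longrightarrow> f \<in> hom a b \<Longrightarrow> g \<in> hom a b \<Longrightarrow> f \<oplus>[a,b] g \<in> hom a b"
  and mns_arr [simp]: "a \<in> Obj A \<Longrightarrow> b \<in> Obj A \<Longrightarrow> f \<in> hom a b \<Longrightarrow> g \<in> hom a b \<Longrightarrow> f \<ominus>[a,b] g \<in> hom a b"
  and neg_arr [simp]: "a \<in> Obj A \<Longrightarrow> b \<in> Obj A \<Longrightarrow> f \<in> hom a b \<Longrightarrow> neg a b f \<in> hom a b"
  and pls_zer [simp]: "a \<in> Obj A \<Longrightarrow> b \<in> Obj A \<Longrightarrow> f \<in> hom a b \<Longrightarrow> f \<oplus>[a,b] \<zero>[a,b] = f"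
  and zer_pls [simp]: "a \<in> Obj A \<Longrightarrow> b \<in> Obj A \<Longrightarrow> f \<in> hom a b \<Longrightarrow> \<zero>[a,b] \<oplus>[a,b] f = f"
  and pls_comm: "a \<in> Obj A \<Longrightarrow> b \<in> Obj A \<Longrightarrow> f \<in> hom a b \<Longrightarrow> g \<in> hom a b \<Longrightarrow> f \<oplus>[a,b] g = g \<oplus>[a,b] f"
  and pls_assoc: "a \<in> Obj A \<Longrightarrow> b \<in> Obj A \<Longrightarrow> f \<in> hom a b \<Longrightarrow> g \<in> hom a b \<Longrightarrow> h \<in> hom a b \<Longrightarrow>
    (f \<oplus>[a,b] g) \<oplus>[a,b] h = f \<oplus>[a,b] (g \<oplus>[a,b] h)"
  and pls_neg [simp]: "a \<in> Obj A \<Longrightarrow> b \<in> Obj A \<Longrightarrow> f \<in> hom a b \<Longrightarrow> f \<oplus>[a,b] neg a b f = \<zero>[a,b]"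
  and neg_neg [simp]: "a \<in> Obj A \<Longrightarrow> b \<in> Obj A \<Longrightarrow> f \<in> hom a b \<Longrightarrow> neg a b (neg a b f) = f"
  and neg_zer [simp]: "a \<in> Obj A \<Longrightarrow> b \<in> Obj A \<Longrightarrow> neg a b \<zero>[a,b] = \<zero>[a,b]"
proof -
  note G = Hom_group[of a b]
  { assume ab: "a \<in> Obj A" "b \<in> Obj A"
    interpret G: abelian_group "Hom A a b" by (rule G[OF ab])
    show "\<zero>[a,b] \<in> hom a b" by simp
    show "f \<in> hom a b \<Longrightarrow> g \<in> hom a b \<Longrightarrow> f \<oplus>[a,b] g \<in> hom a b" by simp
    show "f \<in> hom a b \<Longrightarrow> g \<in> hom a b \<Longrightarrow> f \<ominus>[a,b] g \<in> hom a b" by simp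
    show "f \<in> hom a b \<Longrightarrow> neg a b f \<in> hom a b" by simp
    show "f \<in> hom a b \<Longrightarrow> f \<oplus>[a,b] \<zero>[a,b] = f" by simp
    show "f \<in> hom a b \<Longrightarrow> \<zero>[a,b] \<oplus>[a,b] f = f" by simp
    show "f \<in> hom a b \<Longrightarrow> g \<in> hom a b \<Longrightarrow> f \<oplus>[a,b] g = g \<oplus>[a,b] f" by (rule G.a_comm)
    show "f \<in> hom a b \<Longrightarrow> g \<in> hom a b \<Longrightarrow> h \<in> hom a b \<Longrightarrow>
      (f \<oplus>[a,b] g) \<oplus>[a,b] h = f \<oplus>[a,b] (g \<oplus>[a,b] h)" by (rule G.a_assoc)
    show "f \<in> hom a b \<Longrightarrow> f \<oplus>[a,b] neg a b f = \<zero>[a,b]" by (rule G.r_neg)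
    show "f \<in> hom a b \<Longrightarrow> neg a b (neg a b f) = f" by simp
    show "neg a b \<zero>[a,b] = \<zero>[a,b]" by simp }
qed

lemma mns_eq: "f \<ominus>[a,b] g = f \<oplus>[a,b] neg a b g"
  by (simp add: a_minus_def)

lemma neg_pls [simp]: "a \<in> Obj A \<Longrightarrow> b \<in> Obj A \<Longrightarrow> f \<in> hom a b \<Longrightarrow> neg a b f \<oplus>[a,b] f = \<zero>[a,b]"
  by (metis pls_comm pls_neg neg_arr)

lemma mns_self [simp]: "a \<in> Obj A \<Longrightarrow> b \<in> Obj A \<Longrightarrow> f \<in> hom a b \<Longrightarrow> f \<ominus>[a,b] f = \<zero>[a,b]"
  by (simp add: mns_eq)

lemma mns_zer [simp]: "a \<in> Obj A \<Longrightarrow> b \<in> Obj A \<Longrightarrow> f \<in> hom a b \<Longrightarrow> f \<ominus>[a,b] \<zero>[a,b] = f"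
  by (simp add: mns_eq)

lemma pls_mns [simp]: "a \<in> Obj A \<Longrightarrow> b \<in> Obj A \<Longrightarrow> f \<in> hom a b \<Longrightarrow> g \<in> hom a b \<Longrightarrow>
  (f \<ominus>[a,b] g) \<oplus>[a,b] g = f"
  by (simp add: mns_eq pls_assoc)

lemma pls_mns' [simp]: "a \<in> Obj A \<Longrightarrow> b \<in> Obj A \<Longrightarrow> f \<in> hom a b \<Longrightarrow> g \<in> hom a b \<Longrightarrow>
  g \<oplus>[a,b] (f \<ominus>[a,b] g) = f"
  by (metis mns_arr pls_comm pls_mns)

lemma mns_zer_iff [simp]: "a \<in> Obj A \<Longrightarrow> b \<in> Obj A \<Longrightarrow> f \<in> hom a b \<Longrightarrow> g \<in> hom a b \<Longrightarrow>
  f \<ominus>[a,b] g = \<zero>[a,b] \<longleftrightarrow> f = g"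
  by (metis mns_self pls_mns zer_pls)

lemma pls_cancel: "a \<in> Obj A \<Longrightarrow> b \<in> Obj A \<Longrightarrow> f \<in> hom a b \<Longrightarrow> g \<in> hom a b \<Longrightarrow>
  f \<oplus>[a,b] g = f \<Longrightarrow> g = \<zero>[a,b]"
  by (metis neg_arr neg_pls pls_assoc zer_pls)

lemma eq_mnsI: "a \<in> Obj A \<Longrightarrow> b \<in> Obj A \<Longrightarrow> f \<in> hom a b \<Longrightarrow> g \<in> hom a b \<Longrightarrow> h \<in> hom a b \<Longrightarrow>
  f \<oplus>[a,b] g = h \<Longrightarrow> f = h \<ominus>[a,b] g"
  by (auto simp: mns_eq pls_assoc)

text \<open>Used with \<open>f = i p\<close>, \<open>g = idm b\<close>, \<open>h = i r\<close>, when
  the complement of a split monomorphism \<open>i\<close> is adapted from one retraction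
  \<open>r\<close> to another retraction \<open>p\<close>.\<close>

lemma pls_mns_mns: assumes "a \<in> Obj A" "b \<in> Obj A" "f \<in> hom a b" "g \<in> hom a b" "h \<in> hom a b"
  shows "f \<oplus>[a,b] ((g \<ominus>[a,b] h) \<ominus>[a,b] (f \<ominus>[a,b] h)) = g"
proof -
  let ?d = "f \<ominus>[a,b] h" and ?e = "g \<ominus>[a,b] h"
  have "f \<oplus>[a,b] (?e \<ominus>[a,b] ?d) = (h \<oplus>[a,b] ?d) \<oplus>[a,b] (?e \<ominus>[a,b] ?d)"
    using assms by simp
  also have "\<dots> = h \<oplus>[a,b] (?d \<oplus>[a,b] (?e \<ominus>[a,b] ?d))"
    using assms by (intro pls_assoc) auto
  also have "\<dots> = g" using assms by simp
  finally show ?thesis .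
qed

lemma neg_unique: "a \<in> Obj A \<Longrightarrow> b \<in> Obj A \<Longrightarrow> f \<in> hom a b \<Longrightarrow> g \<in> hom a b \<Longrightarrow>
  f \<oplus>[a,b] g = \<zero>[a,b] \<Longrightarrow> g = neg a b f"
  by (metis neg_arr neg_pls pls_assoc pls_zer zer_pls)

lemma neg_eq_zer_iff [simp]: "a \<in> Obj A \<Longrightarrow> b \<in> Obj A \<Longrightarrow> f \<in> hom a b \<Longrightarrow>
  neg a b f = \<zero>[a,b] \<longleftrightarrow> f = \<zero>[a,b]"
  by (metis neg_neg neg_zer)

declare Idm_arr [simp] Cmp_arr [simp] Cmp_Idm_right [simp] Cmp_Idm_left [simp]

lemma Cmp_zer_left [simp]: "\<lbrakk>a \<in> Obj A; b \<in> Obj A; c \<in> Obj A; f \<in> hom a b\<rbrakk>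
  \<Longrightarrow> \<zero>[b,c] \<cdot>[a,b,c] f = \<zero>[a,c]"
  by (rule pls_cancel[of _ _ "\<zero>[b,c] \<cdot>[a,b,c] f"]) (simp_all flip: Cmp_add_left)

lemma Cmp_zer_right [simp]: "\<lbrakk>a \<in> Obj A; b \<in> Obj A; c \<in> Obj A; g \<in> hom b c\<rbrakk>
  \<Longrightarrow> g \<cdot>[a,b,c] \<zero>[a,b] = \<zero>[a,c]"
  by (rule pls_cancel[of _ _ "g \<cdot>[a,b,c] \<zero>[a,b]"]) (simp_all flip: Cmp_add_right)

lemma Cmp_neg_left: "\<lbrakk>a \<in> Obj A; b \<in> Obj A; c \<in> Obj A; f \<in> hom a b; g \<in> hom b c\<rbrakk>
  \<Longrightarrow> neg b c g \<cdot>[a,b,c] f = neg a c (g \<cdot>[a,b,c] f)"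
  by (rule neg_unique) (simp_all flip: Cmp_add_left)

lemma Cmp_neg_right: "\<lbrakk>a \<in> Obj A; b \<in> Obj A; c \<in> Obj A; f \<in> hom a b; g \<in> hom b c\<rbrakk>
  \<Longrightarrow> g \<cdot>[a,b,c] neg a b f = neg a c (g \<cdot>[a,b,c] f)"
  by (rule neg_unique) (simp_all flip: Cmp_add_right)

lemma Cmp_mns_left: "\<lbrakk>a \<in> Obj A; b \<in> Obj A; c \<in> Obj A; f \<in> hom a b; g \<in> hom b c; h \<in> hom b c\<rbrakk>
  \<Longrightarrow> (g \<ominus>[b,c] h) \<cdot>[a,b,c] f = (g \<cdot>[a,b,c] f) \<ominus>[a,c] (h \<cdot>[a,b,c] f)"
  by (simp add: mns_eq Cmp_add_left Cmp_neg_left)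

lemma Cmp_mns_right: "\<lbrakk>a \<in> Obj A; b \<in> Obj A; c \<in> Obj A; f \<in> hom a b; f' \<in> hom a b; g \<in> hom b c\<rbrakk>
  \<Longrightarrow> g \<cdot>[a,b,c] (f \<ominus>[a,b] f') = (g \<cdot>[a,b,c] f) \<ominus>[a,c] (g \<cdot>[a,b,c] f')"
  by (simp add: mns_eq Cmp_add_right Cmp_neg_right)

text \<open>Composites are normalized to the right by \<open>Cmp_assoc\<close>, which hides a known
  product \<open>v u\<close> as soon as a further factor follows. This is the form of the equation
  that still applies.\<close>

lemma Cmp_reassoc: "\<lbrakk>v \<cdot>[b,c,d] u = w; a \<in> Obj A; b \<in> Obj A; c \<in> Obj A; d \<in> Obj A; f \<in> hom a b; u \<in> hom b c; v \<in> hom c d\<rbrakk>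
  \<Longrightarrow> v \<cdot>[a,c,d] (u \<cdot>[a,b,c] f) = w \<cdot>[a,b,d] f"
  by (metis Cmp_assoc)

lemmas bilin = Cmp_add_left Cmp_add_right Cmp_neg_left Cmp_neg_right Cmp_mns_left Cmp_mns_right

section \<open>Finite sums of morphisms\<close>

abbreviation hsum :: "'o \<Rightarrow> 'o \<Rightarrow> ('e \<Rightarrow> 'm) \<Rightarrow> 'e set \<Rightarrow> 'm"
  where "hsum a b F I \<equiv> finsum (Hom A a b) F I"

lemma hsum_arr [simp]: "\<lbrakk>a \<in> Obj A; b \<in> Obj A; \<And>i. i \<in> I \<Longrightarrow> F i \<in> hom a b\<rbrakk> \<Longrightarrow> hsum a b F I \<in> hom a b"
  using abelian_monoid.finsum_closed[of "Hom A a b" F I] Hom_group[of a b] abelian_group_def by blast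

lemma hsum_empty [simp]: "\<lbrakk>a \<in> Obj A; b \<in> Obj A\<rbrakk> \<Longrightarrow> hsum a b F {} = \<zero>[a,b]"
  using abelian_monoid.finsum_empty[of "Hom A a b" F] Hom_group[of a b] abelian_group_def by blast

lemma hsum_insert: "\<lbrakk>a \<in> Obj A; b \<in> Obj A; finite I; j \<notin> I; F j \<in> hom a b; \<And>i. i \<in> I \<Longrightarrow> F i \<in> hom a b\<rbrakk>
  \<Longrightarrow> hsum a b F (insert j I) = F j \<oplus>[a,b] hsum a b F I"
  using abelian_monoid.finsum_insert[of "Hom A a b" I j F] Hom_group[of a b] abelian_group_def
  by (metis Pi_I)

lemma hsum_remove: "\<lbrakk>a \<in> Obj A; b \<in> Obj A; finite I; j \<in> I; \<And>i. i \<in> I \<Longrightarrow> F i \<in> hom a b\<rbrakk>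
  \<Longrightarrow> hsum a b F I = F j \<oplus>[a,b] hsum a b F (I - {j})"
  using hsum_insert[of a b "I - {j}" j F] by (simp add: insert_absorb)

lemma hsum_cong: "\<lbrakk>a \<in> Obj A; b \<in> Obj A; I = J; \<And>i. i \<in> J \<Longrightarrow> F i = G i; \<And>i. i \<in> J \<Longrightarrow> G i \<in> hom a b\<rbrakk>
  \<Longrightarrow> hsum a b F I = hsum a b G J"
  using abelian_monoid.finsum_cong'[of "Hom A a b" I J G F] Hom_group[of a b] abelian_group_def
  by (metis Pi_I)

lemma Cmp_hsum_left: "\<lbrakk>a \<in> Obj A; b \<in> Obj A; c \<in> Obj A; f \<in> hom a b; finite I; \<And>i. i \<in> I \<Longrightarrow> F i \<in> hom b c\<rbrakk>
  \<Longrightarrow> hsum b c F I \<cdot>[a,b,c] f = hsum a c (\<lambda>i. F i \<cdot>[a,b,c] f) I"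
  by (induction I rule: infinite_finite_induct) (auto simp: hsum_insert bilin)

lemma Cmp_hsum_right: "\<lbrakk>a \<in> Obj A; b \<in> Obj A; c \<in> Obj A; g \<in> hom b c; finite I; \<And>i. i \<in> I \<Longrightarrow> F i \<in> hom a b\<rbrakk>
  \<Longrightarrow> g \<cdot>[a,b,c] hsum a b F I = hsum a c (\<lambda>i. g \<cdot>[a,b,c] F i) I"
  by (induction I rule: infinite_finite_induct) (auto simp: hsum_insert bilin)

lemma hsum_zer: "\<lbrakk>a \<in> Obj A; b \<in> Obj A; \<And>i. i \<in> I \<Longrightarrow> F i = \<zero>[a,b]\<rbrakk> \<Longrightarrow> hsum a b F I = \<zero>[a,b]"
  by (induction I rule: infinite_finite_induct) (auto simp: hsum_insert hsum_arr
      abelian_monoid.finsum_infinite[OF abelian_group.axioms(1)[OF Hom_group]])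

section \<open>Isomorphic objects and vanishing Hom modules\<close>

definition isos :: "'o \<Rightarrow> 'o \<Rightarrow> bool" where
  "isos a b \<longleftrightarrow> a \<in> Obj A \<and> b \<in> Obj A \<and> (\<exists>f. is_iso A a b f)"

lemma is_isoE:
  assumes "is_iso A a b f"
  obtains g where "f \<in> hom a b" "g \<in> hom b a" "g \<cdot>[a,b,a] f = idm a" "f \<cdot>[b,a,b] g = idm b"
    "is_iso A b a g"
  using assms unfolding is_iso_def by blast

lemma is_isoI: "\<lbrakk>f \<in> hom a b; g \<in> hom b a; g \<cdot>[a,b,a] f = idm a; f \<cdot>[b,a,b] g = idm b\<rbrakk> \<Longrightarrow> is_iso A a b f"
  unfolding is_iso_def by blast

lemma is_iso_Idm [simp]: "a \<in> Obj A \<Longrightarrow> is_iso A a a (idm a)"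
  by (rule is_isoI[of _ _ _ "idm a"]) auto

lemma is_iso_Cmp:
  assumes "a \<in> Obj A" "b \<in> Obj A" "c \<in> Obj A" "is_iso A a b f" "is_iso A b c g"
  shows "is_iso A a c (g \<cdot>[a,b,c] f)"
proof -
  obtain f' where f: "f \<in> hom a b" "f' \<in> hom b a" "f' \<cdot>[a,b,a] f = idm a" "f \<cdot>[b,a,b] f' = idm b"
    using assms(4) is_isoE by blast
  obtain g' where g: "g \<in> hom b c" "g' \<in> hom c b" "g' \<cdot>[b,c,b] g = idm b" "g \<cdot>[c,b,c] g' = idm c"
    using assms(5) is_isoE by blast
  note o = assms(1,2,3)
  show ?thesis
  proof (rule is_isoI[of _ _ _ "f' \<cdot>[c,b,a] g'"])
    show "(f' \<cdot>[c,b,a] g') \<cdot>[a,c,a] (g \<cdot>[a,b,c] f) = idm a"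
      using o f g by (simp add: Cmp_assoc Cmp_reassoc[OF g(3)])
    show "(g \<cdot>[a,b,c] f) \<cdot>[c,a,c] (f' \<cdot>[c,b,a] g') = idm c"
      using o f g by (simp add: Cmp_assoc Cmp_reassoc[OF f(4)])
  qed (use o f g in auto)
qed

lemma isos_refl [simp]: "a \<in> Obj A \<Longrightarrow> isos a a"
  unfolding isos_def using is_iso_Idm by blast

lemma isos_sym: "isos a b \<Longrightarrow> isos b a"
  unfolding isos_def by (meson is_isoE)

definition van :: "'o \<Rightarrow> 'o \<Rightarrow> bool" where "van a b \<longleftrightarrow> hom a b = {\<zero>[a,b]}"

lemma vanD: "van a b \<Longrightarrow> f \<in> hom a b \<Longrightarrow> f = \<zero>[a,b]"
  unfolding van_def by blast

lemma vanI: "\<lbrakk>a \<in> Obj A; b \<in> Obj A; \<And>f. f \<in> hom a b \<Longrightarrow> f = \<zero>[a,b]\<rbrakk> \<Longrightarrow> van a b"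
  unfolding van_def using zer_arr by blast

lemma van_retract_right:
  assumes "a \<in> Obj A" "b \<in> Obj A" "x \<in> Obj A" "van x b" "i \<in> hom a b" "p \<in> hom b a" "p \<cdot>[a,b,a] i = idm a"
  shows "van x a"
proof (rule vanI)
  fix f assume f: "f \<in> hom x a"
  have "f = p \<cdot>[x,b,a] (i \<cdot>[x,a,b] f)" using assms f by (simp flip: Cmp_assoc)
  moreover have "i \<cdot>[x,a,b] f = \<zero>[x,b]" using assms f by (intro vanD) auto
  ultimately show "f = \<zero>[x,a]" using assms by simp
qed (use assms in auto)

lemma van_retract_left:
  assumes "a \<in> Obj A" "b \<in> Obj A" "x \<in> Obj A" "van b x" "i \<in> hom a b" "p \<in> hom b a" "p \<cdot>[a,b,a] i = idm a"
  shows "van a x"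
proof (rule vanI)
  fix f assume f: "f \<in> hom a x"
  have "f = (f \<cdot>[b,a,x] p) \<cdot>[a,b,x] i" using assms f by (simp add: Cmp_assoc)
  moreover have "f \<cdot>[b,a,x] p = \<zero>[b,x]" using assms f by (intro vanD) auto
  ultimately show "f = \<zero>[a,x]" using assms by simp
qed (use assms in auto)

lemma isosE:
  assumes "isos a b"
  obtains f g where "a \<in> Obj A" "b \<in> Obj A" "f \<in> hom a b" "g \<in> hom b a"
    "g \<cdot>[a,b,a] f = idm a" "f \<cdot>[b,a,b] g = idm b" "is_iso A a b f" "is_iso A b a g"
  using assms unfolding isos_def by (metis is_isoE)

lemma van_isos_right: "van x b \<Longrightarrow> isos a b \<Longrightarrow> x \<in> Obj A \<Longrightarrow> van x a"
  by (erule isosE) (rule van_retract_right)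

section \<open>Biproducts of two objects\<close>

definition biprod :: "'o \<Rightarrow> 'o \<Rightarrow> 'o \<Rightarrow> 'm \<Rightarrow> 'm \<Rightarrow> 'm \<Rightarrow> 'm \<Rightarrow> bool" where
  "biprod x a b i j p q \<longleftrightarrow> x \<in> Obj A \<and> a \<in> Obj A \<and> b \<in> Obj A \<and>
     i \<in> hom a x \<and> j \<in> hom b x \<and> p \<in> hom x a \<and> q \<in> hom x b \<and>
     p \<cdot>[a,x,a] i = idm a \<and> q \<cdot>[b,x,b] j = idm b \<and> q \<cdot>[a,x,b] i = \<zero>[a,b] \<and> p \<cdot>[b,x,a] j = \<zero>[b,a] \<and>
     (i \<cdot>[x,a,x] p) \<oplus>[x,x] (j \<cdot>[x,b,x] q) = idm x"

lemma biprod_sym: "biprod x a b i j p q \<Longrightarrow> biprod x b a j i q p"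
  unfolding biprod_def by (auto simp: pls_comm)

lemma all_less_2: "(\<forall>i<(2::nat). P i) \<longleftrightarrow> P 0 \<and> P 1"
  by (metis One_nat_def less_2_cases zero_less_numeral one_less_numeral_iff semiring_norm(76))

lemma hsum_2: "\<lbrakk>a \<in> Obj A; b \<in> Obj A; F 0 \<in> hom a b; F 1 \<in> hom a b\<rbrakk> \<Longrightarrow>
  hsum a b F {..<2::nat} = F 0 \<oplus>[a,b] F 1"
proof -
  assume *: "a \<in> Obj A" "b \<in> Obj A" "F 0 \<in> hom a b" "F 1 \<in> hom a b"
  have "{..<2::nat} = insert 0 (insert 1 {})" by auto
  then show ?thesis
    using * hsum_insert[of a b "{1}" 0 F] hsum_insert[of a b "{}" 1 F] by auto
qed

text \<open>Makes the axioms and closure conditions on indexed families available for two summands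
  with explicit structure maps.\<close>

lemma direct_sum_2: "(\<exists>i j p q. biprod x a b i j p q) \<longleftrightarrow> direct_sum A x 2 (\<lambda>n. if n = 0 then a else b)"
proof
  assume "\<exists>i j p q. biprod x a b i j p q"
  then obtain i j p q where B: "biprod x a b i j p q" by blast
  show "direct_sum A x 2 (\<lambda>n. if n = 0 then a else b)"
    unfolding direct_sum_def all_less_2
    apply (rule conjI) using B apply (simp add: biprod_def)
    apply (rule conjI) using B apply (simp add: biprod_def)
    apply (rule exI[of _ "\<lambda>n. if n = 0 then i else j"], rule exI[of _ "\<lambda>n. if n = 0 then p else q"])
    using B apply (simp add: biprod_def hsum_2)
    done
next
  assume "direct_sum A x 2 (\<lambda>n. if n = 0 then a else b)"
  then obtain \<iota> \<pi> where x: "x \<in> Obj A" "a \<in> Obj A" "b \<in> Obj A" and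
    *: "\<iota> 0 \<in> hom a x" "\<iota> 1 \<in> hom b x" "\<pi> 0 \<in> hom x a" "\<pi> 1 \<in> hom x b"
    "\<pi> 0 \<cdot>[a,x,a] \<iota> 0 = idm a" "\<pi> 1 \<cdot>[b,x,b] \<iota> 1 = idm b" "\<pi> 1 \<cdot>[a,x,b] \<iota> 0 = \<zero>[a,b]" "\<pi> 0 \<cdot>[b,x,a] \<iota> 1 = \<zero>[b,a]"
    "hsum x x (\<lambda>i. \<iota> i \<cdot>[x,if i = 0 then a else b,x] \<pi> i) {..<2::nat} = idm x"
    unfolding direct_sum_def all_less_2 by auto
  have "(\<iota> 0 \<cdot>[x,a,x] \<pi> 0) \<oplus>[x,x] (\<iota> 1 \<cdot>[x,b,x] \<pi> 1) = idm x"
    using hsum_2[of x x "\<lambda>i. \<iota> i \<cdot>[x,if i = 0 then a else b,x] \<pi> i"] * x by simp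
  then show "\<exists>i j p q. biprod x a b i j p q" unfolding biprod_def using * x by blast
qed

lemma direct_sum_0: "direct_sum A x 0 xs \<longleftrightarrow> x \<in> Obj A \<and> idm x = \<zero>[x,x]"
  unfolding direct_sum_def by auto

lemma zero_van:
  assumes "z \<in> Obj A" "idm z = \<zero>[z,z]" "x \<in> Obj A"
  shows "van z x" "van x z"
proof -
  show "van z x"
    by (rule vanI) (use assms in \<open>metis Cmp_Idm_right Cmp_zer_right\<close>)+
  show "van x z"
    by (rule vanI) (use assms in \<open>metis Cmp_Idm_left Cmp_zer_left\<close>)+
qed

lemma zero_objectI:
  assumes "z \<in> Obj A" "idm z = \<zero>[z,z]" shows "zero_object A z"
  unfolding zero_object_def using zero_van[OF assms] assms unfolding van_def by auto

lemma direct_sum_full_sub: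
  assumes "C \<subseteq> Obj A"
  shows "direct_sum (full_sub A C) x n xs \<longleftrightarrow> x \<in> C \<and> (\<forall>i<n. xs i \<in> C) \<and> direct_sum A x n xs"
  using assms unfolding direct_sum_def full_sub_def by auto

lemma summand_closed_biprod:
  assumes "additive_summand_closed A P" "biprod x a b i j p q"
  shows "x \<in> P \<longleftrightarrow> a \<in> P \<and> b \<in> P"
proof -
  have D: "direct_sum A x 2 (\<lambda>n. if n = 0 then a else b)" using assms(2) direct_sum_2 by blast
  note P = assms(1)[unfolded additive_summand_closed_def]
  show ?thesis
  proof
    assume "x \<in> P"
    then have *: "\<forall>n<(2::nat). (if n = 0 then a else b) \<in> P" using P D by blast
    show "a \<in> P \<and> b \<in> P" using *[rule_format, of 0] *[rule_format, of 1] by simp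
  next
    assume "a \<in> P \<and> b \<in> P"
    then have "\<forall>n<(2::nat). (if n = 0 then a else b) \<in> P" by simp
    then show "x \<in> P" using P D by blast
  qed
qed

end

lemma linear_category_full_sub:
  assumes "linear_category k A" "P \<subseteq> Obj A"
  shows "linear_category k (full_sub A P)"
proof -
  interpret linear_category k A by fact
  have P: "\<And>x. x \<in> P \<Longrightarrow> x \<in> Obj A" using assms(2) by blast
  have E: "Obj (full_sub A P) = P" "Hom (full_sub A P) = Hom A" "Idm (full_sub A P) = Idm A"
    "Cmp (full_sub A P) = Cmp A" by (simp_all add: full_sub_def)
  show ?thesis
    apply (rule linear_category.intro[OF cring_axioms])
    apply (rule linear_category_axioms.intro)
    unfolding E
    apply (rule module_Hom; blast intro: P)
    apply (rule Idm_arr; blast intro: P)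
    apply (rule Cmp_arr; blast intro: P)
    apply (rule Cmp_Idm_right; blast intro: P)
    apply (rule Cmp_Idm_left; blast intro: P)
    apply (rule Cmp_assoc; blast intro: P)
    apply (rule Cmp_add_left; blast intro: P)
    apply (rule Cmp_add_right; blast intro: P)
    apply (rule Cmp_smult_left; blast intro: P)
    apply (rule Cmp_smult_right; blast intro: P)
    done
qed

section \<open>Triangulated categories\<close>

context triangulated_category
begin

notation cmp (\<open>(_ \<cdot>[_,_,_] _)\<close> [71,0,0,0,70] 70)
notation zer (\<open>\<zero>[_,_]\<close>)
notation pls (\<open>(_ \<oplus>[_,_] _)\<close> [65,0,0,66] 65)
notation mns (\<open>(_ \<ominus>[_,_] _)\<close> [65,0,0,66] 65)

section \<open>The shift\<close>

abbreviation sh :: "'o \<Rightarrow> 'o" where "sh a \<equiv> Sh T a"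
abbreviation shm :: "'o \<Rightarrow> 'o \<Rightarrow> 'm \<Rightarrow> 'm" where "shm a b f \<equiv> ShM T a b f"

declare Sh_Obj [simp] ShM_Idm [simp]

lemma shm_arr [simp]: "\<lbrakk>a \<in> Obj T; b \<in> Obj T; f \<in> hom a b\<rbrakk> \<Longrightarrow> shm a b f \<in> hom (sh a) (sh b)"
  using ShM_linear[of a b] unfolding module_hom_def by auto

lemma shm_pls: "\<lbrakk>a \<in> Obj T; b \<in> Obj T; f \<in> hom a b; g \<in> hom a b\<rbrakk> \<Longrightarrow>
  shm a b (f \<oplus>[a,b] g) = shm a b f \<oplus>[sh a,sh b] shm a b g"
  using ShM_linear[of a b] unfolding module_hom_def by auto

lemma shm_zer [simp]: "\<lbrakk>a \<in> Obj T; b \<in> Obj T\<rbrakk> \<Longrightarrow> shm a b \<zero>[a,b] = \<zero>[sh a,sh b]"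
  by (rule pls_cancel[of _ _ "shm a b \<zero>[a,b]"]) (simp_all flip: shm_pls)

lemma shm_neg: "\<lbrakk>a \<in> Obj T; b \<in> Obj T; f \<in> hom a b\<rbrakk> \<Longrightarrow> shm a b (neg a b f) = neg (sh a) (sh b) (shm a b f)"
  by (rule neg_unique) (simp_all flip: shm_pls)

lemma shm_inj: "\<lbrakk>a \<in> Obj T; b \<in> Obj T; f \<in> hom a b; g \<in> hom a b; shm a b f = shm a b g\<rbrakk> \<Longrightarrow> f = g"
  using ShM_fully_faithful[of a b] unfolding bij_betw_def inj_on_def by blast

lemma shm_eq_iff [simp]: "\<lbrakk>a \<in> Obj T; b \<in> Obj T; f \<in> hom a b; g \<in> hom a b\<rbrakk> \<Longrightarrow>
  shm a b f = shm a b g \<longleftrightarrow> f = g"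
  using shm_inj by blast

lemma shm_eq_zer_iff [simp]: "\<lbrakk>a \<in> Obj T; b \<in> Obj T; f \<in> hom a b\<rbrakk> \<Longrightarrow>
  shm a b f = \<zero>[sh a,sh b] \<longleftrightarrow> f = \<zero>[a,b]"
  using shm_eq_iff[of a b f "\<zero>[a,b]"] by simp

lemma shm_surj:
  assumes "a \<in> Obj T" "b \<in> Obj T" "F \<in> hom (sh a) (sh b)"
  obtains f where "f \<in> hom a b" "F = shm a b f"
  using ShM_fully_faithful[of a b] assms unfolding bij_betw_def by blast

lemma van_sh:
  assumes "a \<in> Obj T" "b \<in> Obj T"
  shows "van (sh a) (sh b) \<longleftrightarrow> van a b"
proof
  assume v: "van (sh a) (sh b)"
  show "van a b"
  proof (rule vanI)
    fix f assume f: "f \<in> hom a b"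
    then have "shm a b f = shm a b \<zero>[a,b]" using vanD[OF v] assms by simp
    then show "f = \<zero>[a,b]" using shm_inj assms f by simp
  qed (use assms in auto)
next
  assume v: "van a b"
  show "van (sh a) (sh b)"
  proof (rule vanI)
    fix F assume "F \<in> hom (sh a) (sh b)"
    then show "F = \<zero>[sh a,sh b]" using vanD[OF v] assms shm_surj shm_zer by metis
  qed (use assms in auto)
qed

lemma is_iso_shm:
  assumes "a \<in> Obj T" "b \<in> Obj T" "is_iso T a b f"
  shows "is_iso T (sh a) (sh b) (shm a b f)"
proof -
  obtain g where g: "f \<in> hom a b" "g \<in> hom b a" "g \<cdot>[a,b,a] f = idm a" "f \<cdot>[b,a,b] g = idm b"
    using assms is_isoE by metis
  show ?thesis
    by (rule is_isoI[of _ _ _ "shm b a g"]) (use assms g in \<open>simp_all flip: ShM_Cmp\<close>)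
qed

lemma isos_sh: "isos a b \<Longrightarrow> isos (sh a) (sh b)"
  unfolding isos_def using is_iso_shm by auto

lemma isos_sh_ex:
  assumes "b \<in> Obj T" obtains a where "a \<in> Obj T" "isos (sh a) b"
  using Sh_essentially_surjective[OF assms] assms unfolding isos_def by auto

lemma zero_ex: obtains z where "z \<in> Obj T" "idm z = \<zero>[z,z]"
  using direct_sum_exists[of 0 "\<lambda>_. undefined"] unfolding direct_sum_0 by auto

lemma sh_zero: "z \<in> Obj T \<Longrightarrow> idm z = \<zero>[z,z] \<Longrightarrow> idm (sh z) = \<zero>[sh z,sh z]"
  by (metis ShM_Idm shm_zer)

section \<open>Exactness of distinguished triangles\<close>

lemma Tri_rot:
  "(a, b, c, f, g, h) \<in> Tri T \<Longrightarrow> (b, c, sh a, g, h, neg (sh a) (sh b) (shm a b f)) \<in> Tri T"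
  using Tri_rotate Tri_arr by metis

text \<open>Completing the square of \<open>idm a\<close> and \<open>f\<close> to a morphism from
  the trivial triangle of \<open>a\<close> factors \<open>g f\<close> through a zero object.\<close>

lemma Tri_zero_1:
  assumes "(a, b, c, f, g, h) \<in> Tri T"
  shows "g \<cdot>[a,b,c] f = \<zero>[a,c]"
proof -
  note o = Tri_arr[OF assms]
  obtain z where z: "z \<in> Obj T" "idm z = \<zero>[z,z]" by (rule zero_ex)
  have "(a, a, z, idm a, \<zero>[a,z], \<zero>[z,sh a]) \<in> Tri T"
    using Tri_Idm o z zero_objectI by auto
  from Tri_complete[OF this assms, of "idm a" f]
  obtain w where "w \<in> hom z c" "w \<cdot>[a,z,c] \<zero>[a,z] = g \<cdot>[a,b,c] f"
    using o by auto
  then show ?thesis using o z by simp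
qed

lemma Tri_zero_2: "(a, b, c, f, g, h) \<in> Tri T \<Longrightarrow> h \<cdot>[b,c,sh a] g = \<zero>[b,sh a]"
  using Tri_zero_1 Tri_rot by metis

lemma Tri_zero_3: "(a, b, c, f, g, h) \<in> Tri T \<Longrightarrow> shm a b f \<cdot>[c,sh a,sh b] h = \<zero>[c,sh b]"
  using Tri_zero_1[OF Tri_rot[OF Tri_rot]] Tri_arr by (fastforce simp: bilin)

text \<open>Exactness of \<open>T(-, x)\<close> at \<open>b\<close>. The trivial triangle of
  \<open>x\<close> is rotated so that the identity becomes its middle map; it receives the square
  formed by \<open>u\<close> and a zero map, and the completing map is the factor.\<close>

lemma weak_cokernel:
  assumes t: "(a, b, c, f, g, h) \<in> Tri T" and x: "x \<in> Obj T" "u \<in> hom b x" "u \<cdot>[a,b,x] f = \<zero>[a,x]"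
  obtains w where "w \<in> hom c x" "u = w \<cdot>[b,c,x] g"
proof -
  note o = Tri_arr[OF t]
  obtain z where z: "z \<in> Obj T" "idm z = \<zero>[z,z]" by (rule zero_ex)
  have "(x, x, sh z, idm x, \<zero>[x,sh z], \<zero>[sh z,sh x]) \<in> Tri T"
    using Tri_Idm x z zero_objectI sh_zero by auto
  then have "(z, x, x, \<zero>[z,x], idm x, \<zero>[x,sh z]) \<in> Tri T"
    by (subst Tri_rotate) (use x z in auto)
  from Tri_complete[OF t this, of "\<zero>[a,z]" u]
  obtain w where "w \<in> hom c x" "w \<cdot>[b,c,x] g = idm x \<cdot>[b,x,x] u"
    using o x z by auto
  then show ?thesis using that x o by simp
qed

text \<open>\<open>Tri_complete\<close> only produces the third map of a morphism of triangles,
  whereas here a first map is sought. Both triangles are therefore rotated; the completing map goes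
  from \<open>sh x\<close> to \<open>sh a\<close> and is brought back by full faithfulness of the
  shift.\<close>

lemma weak_kernel:
  assumes t: "(a, b, c, f, g, h) \<in> Tri T" and x: "x \<in> Obj T" "u \<in> hom x b" "g \<cdot>[x,b,c] u = \<zero>[x,c]"
  obtains w where "w \<in> hom x a" "u = f \<cdot>[x,a,b] w"
proof -
  note o = Tri_arr[OF t]
  obtain z where z: "z \<in> Obj T" "idm z = \<zero>[z,z]" by (rule zero_ex)
  have "(x, x, z, idm x, \<zero>[x,z], \<zero>[z,sh x]) \<in> Tri T"
    using Tri_Idm x z zero_objectI by auto
  then have t0: "(x, z, sh x, \<zero>[x,z], \<zero>[z,sh x], neg (sh x) (sh x) (idm (sh x))) \<in> Tri T"
    using Tri_rot x by fastforce
  from Tri_complete[OF t0 Tri_rot[OF t], of u "\<zero>[z,c]"]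
  obtain W where W: "W \<in> hom (sh x) (sh a)"
    "shm x b u \<cdot>[sh x,sh x,sh b] neg (sh x) (sh x) (idm (sh x)) =
      neg (sh a) (sh b) (shm a b f) \<cdot>[sh x,sh a,sh b] W"
    using o x z by auto
  obtain w where w: "w \<in> hom x a" "W = shm x a w" using shm_surj W o x by blast
  have "neg (sh x) (sh b) (shm x b u) = neg (sh x) (sh b) (shm a b f \<cdot>[sh x,sh a,sh b] shm x a w)"
    using W w o x by (simp add: bilin)
  then have "shm x b u = shm a b f \<cdot>[sh x,sh a,sh b] shm x a w"
    using w o x by (metis neg_neg Cmp_arr shm_arr Sh_Obj)
  then have "shm x b u = shm x b (f \<cdot>[x,a,b] w)" using w o x by (simp add: ShM_Cmp)
  then have "u = f \<cdot>[x,a,b] w" using w(1) o x by simp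
  then show ?thesis using that w by blast
qed

text \<open>Exactness of \<open>T(-, x)\<close> at \<open>a\<close>: the obstruction to extending
  \<open>u\<close> along \<open>f\<close> lies in \<open>T(c, sh x)\<close>. The extension is
  \<open>neg b x w\<close>, because two rotations put a sign on the shift of
  \<open>f\<close>.\<close>

lemma extend_along:
  assumes t: "(a, b, c, f, g, h) \<in> Tri T" and x: "x \<in> Obj T" "u \<in> hom a x"
    "shm a x u \<cdot>[c,sh a,sh x] h = \<zero>[c,sh x]"
  obtains v where "v \<in> hom b x" "u = v \<cdot>[a,b,x] f"
proof -
  note o = Tri_arr[OF t]
  obtain W where W: "W \<in> hom (sh b) (sh x)"
    "shm a x u = W \<cdot>[sh a,sh b,sh x] neg (sh a) (sh b) (shm a b f)"
    using weak_cokernel[OF Tri_rot[OF Tri_rot[OF t]], of "sh x" "shm a x u"] x o by auto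
  obtain w where w: "w \<in> hom b x" "W = shm b x w" using shm_surj W o x by blast
  have "shm a x u = shm a x (neg b x w \<cdot>[a,b,x] f)"
    using W w o x by (simp add: ShM_Cmp bilin shm_neg)
  then have "u = neg b x w \<cdot>[a,b,x] f" using w(1) o x by simp
  then show ?thesis by (rule that[rotated]) (use w o x in simp)
qed

section \<open>Triangles with their maps forgotten\<close>

definition tri :: "'o \<Rightarrow> 'o \<Rightarrow> 'o \<Rightarrow> bool" where
  "tri a b c \<longleftrightarrow> (\<exists>f g h. (a, b, c, f, g, h) \<in> Tri T)"

lemma triI: "(a, b, c, f, g, h) \<in> Tri T \<Longrightarrow> tri a b c"
  unfolding tri_def by blast

lemma tri_Obj: "tri a b c \<Longrightarrow> a \<in> Obj T \<and> b \<in> Obj T \<and> c \<in> Obj T"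
  unfolding tri_def using Tri_arr by blast

text \<open>\<open>Tri_rotate\<close> can be read backwards once the last map is the negative of a
  shifted map. Fullness of the shift writes \<open>m\<close> as a shift, and the sign goes into
  \<open>f\<close>.\<close>

lemma Tri_unrot:
  assumes "a \<in> Obj T" "(b, c, sh a, g, h, m) \<in> Tri T"
  obtains f where "(a, b, c, f, g, h) \<in> Tri T"
proof -
  note o = Tri_arr[OF assms(2)]
  obtain m' where m: "m' \<in> hom a b" "m = shm a b m'" using shm_surj o assms by blast
  have "neg (sh a) (sh b) (shm a b (neg a b m') ) = m" using o assms m by (simp add: shm_neg)
  then have "(a, b, c, neg a b m', g, h) \<in> Tri T"
    by (subst Tri_rotate) (use o assms m in auto)
  then show ?thesis by (rule that)
qed

lemma tri_rot: "a \<in> Obj T \<Longrightarrow> tri a b c \<longleftrightarrow> tri b c (sh a)"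
  unfolding tri_def using Tri_rot Tri_unrot by meson

lemma tri_sh: "a \<in> Obj T \<Longrightarrow> b \<in> Obj T \<Longrightarrow> c \<in> Obj T \<Longrightarrow> tri (sh a) (sh b) (sh c) \<longleftrightarrow> tri a b c"
  using tri_rot[of a b c] tri_rot[of b c "sh a"] tri_rot[of c "sh a" "sh b"] by simp

lemma Tri_isos:
  assumes t: "(a, b, c, f, g, h) \<in> Tri T" and i: "a' \<in> Obj T" "b' \<in> Obj T" "c' \<in> Obj T"
    "is_iso T a a' u" "is_iso T b b' v" "is_iso T c c' w"
  shows "tri a' b' c'"
proof -
  note o = Tri_arr[OF t]
  obtain u' where u: "u \<in> hom a a'" "u' \<in> hom a' a" "u' \<cdot>[a,a',a] u = idm a" using i is_isoE by metis
  obtain v' where v: "v \<in> hom b b'" "v' \<in> hom b' b" "v' \<cdot>[b,b',b] v = idm b" using i is_isoE by metis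
  obtain w' where w: "w \<in> hom c c'" "w' \<in> hom c' c" "w' \<cdot>[c,c',c] w = idm c" using i is_isoE by metis
  have "(a', b', c', v \<cdot>[a',b,b'] (f \<cdot>[a',a,b] u'), w \<cdot>[b',c,c'] (g \<cdot>[b',b,c] v'),
      shm a a' u \<cdot>[c',sh a,sh a'] (h \<cdot>[c',c,sh a] w')) \<in> Tri T"
    by (rule Tri_iso[OF t _ _ _ _ _ _ i(4-6)]) (use o i u v w in \<open>simp_all add: Cmp_assoc\<close>)
  then show ?thesis by (rule triI)
qed

lemma tri_isos: "tri a b c \<Longrightarrow> isos a a' \<Longrightarrow> isos b b' \<Longrightarrow> isos c c' \<Longrightarrow> tri a' b' c'"
  unfolding tri_def[of a b c] isos_def by (elim exE conjE) (rule Tri_isos)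

lemma tri_van_right:
  assumes "tri a b c" "x \<in> Obj T" "van x a" "van x c" shows "van x b"
proof (rule vanI)
  obtain f g h where t: "(a, b, c, f, g, h) \<in> Tri T" using assms tri_def by blast
  note o = Tri_arr[OF t]
  fix u assume u: "u \<in> hom x b"
  have "g \<cdot>[x,b,c] u = \<zero>[x,c]" by (rule vanD) (use o assms u in auto)
  then obtain w where w: "w \<in> hom x a" "u = f \<cdot>[x,a,b] w" using weak_kernel[OF t] assms u by metis
  then show "u = \<zero>[x,b]" using vanD[OF assms(3) w(1)] o assms by simp
qed (use assms tri_Obj in auto)

lemma tri_van_left:
  assumes "tri a b c" "x \<in> Obj T" "van a x" "van c x" shows "van b x"
proof (rule vanI)
  obtain f g h where t: "(a, b, c, f, g, h) \<in> Tri T" using assms tri_def by blast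
  note o = Tri_arr[OF t]
  fix u assume u: "u \<in> hom b x"
  have "u \<cdot>[a,b,x] f = \<zero>[a,x]" by (rule vanD) (use o assms u in auto)
  then obtain w where w: "w \<in> hom c x" "u = w \<cdot>[b,c,x] g" using weak_cokernel[OF t] assms u by metis
  then show "u = \<zero>[b,x]" using vanD[OF assms(4) w(1)] o assms by simp
qed (use assms tri_Obj in auto)

text \<open>As the connecting map is zero, \<open>idm c\<close> lifts along \<open>g\<close> to a
  section \<open>s\<close>, and \<open>f\<close> is a monomorphism: a map killed by \<open>f\<close>
  factors, after a shift, through the connecting map. Then \<open>idm b - s g\<close> factors
  through \<open>f\<close>, which defines the retraction.\<close>

lemma tri_split:
  assumes t: "(a, b, c, f, g, \<zero>[c,sh a]) \<in> Tri T"
  obtains r s where "biprod b a c f s r g"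
proof -
  note o = Tri_arr[OF t]
  have z: "g \<cdot>[a,b,c] f = \<zero>[a,c]" by (rule Tri_zero_1[OF t])
  have mono: "w = \<zero>[x,a]" if x: "x \<in> Obj T" "w \<in> hom x a" "f \<cdot>[x,a,b] w = \<zero>[x,b]" for x w
  proof -
    have "neg (sh a) (sh b) (shm a b f) \<cdot>[sh x,sh a,sh b] shm x a w = \<zero>[sh x,sh b]"
      using x o by (simp add: bilin flip: ShM_Cmp)
    then obtain v where "v \<in> hom (sh x) c" "shm x a w = \<zero>[c,sh a] \<cdot>[sh x,c,sh a] v"
      using weak_kernel[OF Tri_rot[OF Tri_rot[OF t]], of "sh x" "shm x a w"] x o by auto
    then show ?thesis using x o by simp
  qed
  obtain s where s: "s \<in> hom c b" "idm c = g \<cdot>[c,b,c] s"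
    using weak_kernel[OF Tri_rot[OF t], of c "idm c"] o by auto
  have "g \<cdot>[b,b,c] (idm b \<ominus>[b,b] (s \<cdot>[b,c,b] g)) = \<zero>[b,c]"
    using o s(1) by (simp add: bilin Cmp_reassoc[OF s(2)[symmetric]])
  then obtain r where r: "r \<in> hom b a" "idm b \<ominus>[b,b] (s \<cdot>[b,c,b] g) = f \<cdot>[b,a,b] r"
    using weak_kernel[OF t, of b "idm b \<ominus>[b,b] (s \<cdot>[b,c,b] g)"] o s(1) by auto
  have "f \<cdot>[a,a,b] ((r \<cdot>[a,b,a] f) \<ominus>[a,a] idm a) = \<zero>[a,b]"
    using o s r(1) by (simp add: bilin Cmp_reassoc[OF r(2)[symmetric]] Cmp_assoc z)
  then have rf: "r \<cdot>[a,b,a] f = idm a" using mono[of a "(r \<cdot>[a,b,a] f) \<ominus>[a,a] idm a"] o r(1) by simp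
  have "f \<cdot>[c,a,b] (r \<cdot>[c,b,a] s) = \<zero>[c,b]"
    using o s(1) r(1) by (simp add: bilin Cmp_reassoc[OF r(2)[symmetric]] Cmp_assoc flip: s(2))
  then have rs: "r \<cdot>[c,b,a] s = \<zero>[c,a]" using mono[of c "r \<cdot>[c,b,a] s"] o r(1) s(1) by simp
  have "(f \<cdot>[b,a,b] r) \<oplus>[b,b] (s \<cdot>[b,c,b] g) = idm b"
    using o s(1) by (simp flip: r(2))
  then have "biprod b a c f s r g" unfolding biprod_def using o s r(1) rf rs z by simp
  then show ?thesis by (rule that)
qed

text \<open>The cone of \<open>i\<close> is the complement: \<open>shm p\<close> is a left inverse
  of \<open>shm i\<close>, which annihilates the connecting map, so that map is zero.\<close>

lemma split_mono_complement:
  assumes o: "a \<in> Obj T" "b \<in> Obj T" and i: "i \<in> hom a b" and p: "p \<in> hom b a" "p \<cdot>[a,b,a] i = idm a"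
  obtains e j q where "biprod b a e i j p q" "(a, b, e, i, q, \<zero>[e,sh a]) \<in> Tri T"
proof -
  obtain e g h where t: "(a, b, e, i, g, h) \<in> Tri T" using Tri_cone o i by blast
  note o' = Tri_arr[OF t]
  have pi: "shm b a p \<cdot>[sh a,sh b,sh a] shm a b i = idm (sh a)"
    using o i p by (simp flip: ShM_Cmp)
  have "h = shm b a p \<cdot>[e,sh b,sh a] (shm a b i \<cdot>[e,sh a,sh b] h)"
    using o' p by (simp add: Cmp_reassoc[OF pi])
  then have h: "h = \<zero>[e,sh a]" using o' p Tri_zero_3[OF t] by simp
  obtain r s where B: "biprod b a e i s r g" using tri_split t h by blast
  then have B': "s \<in> hom e b" "r \<in> hom b a" "r \<cdot>[a,b,a] i = idm a" "g \<cdot>[e,b,e] s = idm e"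
    "g \<cdot>[a,b,e] i = \<zero>[a,e]" "r \<cdot>[e,b,a] s = \<zero>[e,a]"
    "(i \<cdot>[b,a,b] r) \<oplus>[b,b] (s \<cdot>[b,e,b] g) = idm b"
    unfolding biprod_def by auto
  \<comment> \<open>The splitting comes with its own retraction \<open>r\<close>. Subtracting
    \<open>i p s\<close> from the section makes it orthogonal to the prescribed
    \<open>p\<close>.\<close>
  let ?j = "s \<ominus>[e,b] (i \<cdot>[e,a,b] (p \<cdot>[e,b,a] s))"
  have "s \<cdot>[b,e,b] g = idm b \<ominus>[b,b] (i \<cdot>[b,a,b] r)"
    by (rule eq_mnsI) (use B' o' in \<open>auto simp: pls_comm\<close>)
  then have sg: "?j \<cdot>[b,e,b] g = (idm b \<ominus>[b,b] (i \<cdot>[b,a,b] r)) \<ominus>[b,b] ((i \<cdot>[b,a,b] p) \<ominus>[b,b] (i \<cdot>[b,a,b] r))"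
    using B'(1,2) o' p i by (simp add: bilin Cmp_assoc Cmp_reassoc[OF p(2)])
  have "(i \<cdot>[b,a,b] p) \<oplus>[b,b] ((idm b \<ominus>[b,b] (i \<cdot>[b,a,b] r)) \<ominus>[b,b] ((i \<cdot>[b,a,b] p) \<ominus>[b,b] (i \<cdot>[b,a,b] r))) = idm b"
    by (rule pls_mns_mns) (use B'(1,2) o' p i in auto)
  then have "biprod b a e i ?j p g"
    unfolding biprod_def sg using B' o' p i
    by (simp add: bilin Cmp_reassoc[OF p(2)] Cmp_reassoc[OF B'(5)])
  then show ?thesis using that t h by blast
qed

text \<open>Both \<open>c\<close> and the cone \<open>e\<close> of \<open>i\<close> are complements
  of the same \<open>i\<close> and \<open>p\<close>, so projecting the inclusion of one to the other
  gives mutually inverse isomorphisms.\<close>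

lemma biprod_tri:
  assumes "biprod b a c i j p q" shows "tri a b c"
proof -
  note B = assms[unfolded biprod_def]
  have B0: "b \<in> Obj T" "c \<in> Obj T" "a \<in> Obj T" "i \<in> hom a b" "j \<in> hom c b" "p \<in> hom b a" "q \<in> hom b c"
    using B by auto
  obtain e j' q' where e: "biprod b a e i j' p q'" "(a, b, e, i, q', \<zero>[e,sh a]) \<in> Tri T"
    by (rule split_mono_complement[of a b i p]) (use B in auto)
  note B' = e(1)[unfolded biprod_def]
  have B0': "e \<in> Obj T" "j' \<in> hom e b" "q' \<in> hom b e" using B' by auto
  have z: "q \<cdot>[a,b,c] i = \<zero>[a,c]" "q' \<cdot>[a,b,e] i = \<zero>[a,e]" using B B' by auto
  have 1: "(q \<cdot>[e,b,c] j') \<cdot>[c,e,c] (q' \<cdot>[c,b,e] j) = idm c"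
  proof -
    have "idm c = q \<cdot>[c,b,c] (((i \<cdot>[b,a,b] p) \<oplus>[b,b] (j' \<cdot>[b,e,b] q')) \<cdot>[c,b,b] j)"
      using B B' by simp
    also have "\<dots> = (q \<cdot>[e,b,c] j') \<cdot>[c,e,c] (q' \<cdot>[c,b,e] j)"
      using B0 B0' by (simp add: bilin Cmp_assoc Cmp_reassoc[OF z(1)])
    finally show ?thesis by simp
  qed
  have 2: "(q' \<cdot>[c,b,e] j) \<cdot>[e,c,e] (q \<cdot>[e,b,c] j') = idm e"
  proof -
    have "idm e = q' \<cdot>[e,b,e] (((i \<cdot>[b,a,b] p) \<oplus>[b,b] (j \<cdot>[b,c,b] q)) \<cdot>[e,b,b] j')"
      using B B' by simp
    also have "\<dots> = (q' \<cdot>[c,b,e] j) \<cdot>[e,c,e] (q \<cdot>[e,b,c] j')"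
      using B0 B0' by (simp add: bilin Cmp_assoc Cmp_reassoc[OF z(2)])
    finally show ?thesis by simp
  qed
  have "is_iso T e c (q \<cdot>[e,b,c] j')"
    by (rule is_isoI[OF _ _ 2 1]) (use B B' in auto)
  then have "isos e c" unfolding isos_def using B B' by blast
  then show ?thesis using tri_isos[OF triI[OF e(2)]] B by simp
qed

lemma van_tri_biprod:
  assumes "tri a b c" "van c (sh a)"
  obtains i j p q where "biprod b a c i j p q"
proof -
  obtain f g h where t: "(a, b, c, f, g, h) \<in> Tri T" using assms tri_def by blast
  have "h = \<zero>[c,sh a]" using vanD[OF assms(2)] Tri_arr[OF t] by simp
  with t have "(a, b, c, f, g, \<zero>[c,sh a]) \<in> Tri T" by simp
  then show ?thesis by (rule tri_split) (rule that)
qed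

section \<open>The octahedral axiom and extension products\<close>

lemma octa:
  assumes "tri x y z'" "tri y z x'"
  obtains y' where "tri x z y'" "tri z' y' x'"
proof -
  obtain f i i' where 1: "(x, y, z', f, i, i') \<in> Tri T" using assms tri_def by blast
  obtain g j j' where 2: "(y, z, x', g, j, j') \<in> Tri T" using assms tri_def by blast
  note o = Tri_arr[OF 1] Tri_arr[OF 2]
  obtain y' l l' where 3: "(x, z, y', g \<cdot>[x,y,z] f, l, l') \<in> Tri T" using Tri_cone[of x z "g \<cdot>[x,y,z] f"] o by auto
  from Tri_octahedral[OF 1 2 3] have "tri z' y' x'" unfolding tri_def by (elim bexE conjE) (intro exI)
  then show ?thesis using that triI[OF 3] by blast
qed

text \<open>The octahedral axiom for the rotated composite \<open>t -> q -> c\<close>. Its new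
  vertex is a cone; the fibre \<open>p\<close> is found by writing that cone as a shift.\<close>

lemma octa_dual:
  assumes "tri a t q" "tri b q c"
  obtains p where "tri p t c" "tri a p b"
proof -
  have o: "a \<in> Obj T" "t \<in> Obj T" "q \<in> Obj T" "b \<in> Obj T" "c \<in> Obj T" using assms tri_Obj by auto
  have "tri t q (sh a)" "tri q c (sh b)" using assms o by (simp_all flip: tri_rot)
  then obtain y where y: "tri t c y" "tri (sh a) y (sh b)" by (rule octa)
  have "y \<in> Obj T" using y tri_Obj by blast
  then obtain p where p: "p \<in> Obj T" "isos (sh p) y" by (rule isos_sh_ex)
  have "tri t c (sh p)" "tri (sh a) (sh p) (sh b)"
    using y p o tri_isos isos_sym isos_refl Sh_Obj by meson+
  then have "tri p t c" "tri a p b" using tri_rot tri_sh p o by blast+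
  then show ?thesis by (rule that)
qed

definition star :: "'o set \<Rightarrow> 'o set \<Rightarrow> 'o set" where
  "star P Q = {t. \<exists>p\<in>P. \<exists>q\<in>Q. tri p t q}"

lemma star_mono: "P \<subseteq> P' \<Longrightarrow> Q \<subseteq> Q' \<Longrightarrow> star P Q \<subseteq> star P' Q'"
  unfolding star_def by blast

lemma star_assoc: "star (star P Q) R = star P (star Q R)"
proof
  show "star (star P Q) R \<subseteq> star P (star Q R)"
  proof
    fix t assume "t \<in> star (star P Q) R"
    then obtain a p b c where t: "a \<in> P" "b \<in> Q" "tri a p b" "c \<in> R" "tri p t c" unfolding star_def by blast
    obtain y where "tri a t y" "tri b y c" by (rule octa[OF t(3,5)])
    then show "t \<in> star P (star Q R)" using t unfolding star_def by blast
  qed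
  show "star P (star Q R) \<subseteq> star (star P Q) R"
  proof
    fix t assume "t \<in> star P (star Q R)"
    then obtain a q b c where t: "a \<in> P" "tri a t q" "b \<in> Q" "c \<in> R" "tri b q c" unfolding star_def by blast
    obtain p where "tri p t c" "tri a p b" by (rule octa_dual[OF t(2,5)])
    then show "t \<in> star (star P Q) R" using t unfolding star_def by blast
  qed
qed

end

section \<open>Presilting subcategories and closure properties of two-term objects\<close>

locale presilting_category = triangulated_category k T
  for k :: "'k ring" and T :: "('o, 'm, 'k, 'z) tricat_scheme" +
  fixes S :: "'o set"
  assumes presilting: "presilting T S"
begin

text \<open>\<open>two_term\<close> speaks about literal shifts \<open>Sh s'\<close>, but the
  constructions produce shifts only up to isomorphism; hence the closure under isomorphism.\<close>

definition S1 :: "'o set" where "S1 = {t. \<exists>s\<in>S. isos t (sh s)}"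
abbreviation C :: "'o set" where "C \<equiv> two_term T S"

lemma S_closed: "additive_summand_closed T S" using presilting presilting_def by blast

lemma S_Obj [simp]: "s \<in> S \<Longrightarrow> s \<in> Obj T"
  using S_closed unfolding additive_summand_closed_def by blast

lemma S1_Obj [simp]: "s \<in> S1 \<Longrightarrow> s \<in> Obj T"
  unfolding S1_def isos_def by auto

lemma C_Obj [simp]: "c \<in> C \<Longrightarrow> c \<in> Obj T"
  unfolding two_term_def by auto

lemma van_S: assumes "s \<in> S" "s' \<in> S" shows "van s (sh s')" "van s (sh (sh s'))"
proof -
  have "i > 0 \<Longrightarrow> van s ((Sh T ^^ i) s')" for i
    using presilting assms unfolding presilting_def van_def by blast
  from this[of 1] this[of 2] show "van s (sh s')" "van s (sh (sh s'))" by (simp_all add: numeral_2_eq_2)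
qed

lemma zero_S: "z \<in> Obj T \<Longrightarrow> idm z = \<zero>[z,z] \<Longrightarrow> z \<in> S"
proof -
  assume "z \<in> Obj T" "idm z = \<zero>[z,z]"
  then have "direct_sum T z 0 (\<lambda>_. undefined)" by (simp add: direct_sum_0)
  then show ?thesis using S_closed unfolding additive_summand_closed_def by blast
qed

lemma C_star: "C = star S S1"
proof
  show "C \<subseteq> star S S1" unfolding two_term_def star_def S1_def tri_def by force
  show "star S S1 \<subseteq> C"
  proof
    fix t assume "t \<in> star S S1"
    then obtain a b s where "a \<in> S" "s \<in> S" "isos b (sh s)" "tri a t b" unfolding star_def S1_def by blast
    then have "tri a t (sh s)" using tri_isos tri_Obj isos_refl by meson
    then show "t \<in> C" using \<open>a \<in> S\<close> \<open>s \<in> S\<close> tri_Obj unfolding two_term_def tri_def by blast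
  qed
qed

lemma C_triE:
  assumes "c \<in> C" obtains a b where "a \<in> S" "b \<in> S" "tri a b c"
proof -
  obtain a b where "a \<in> S" "b \<in> S" "tri b c (sh a)" using assms unfolding two_term_def tri_def by blast
  then show ?thesis using that[of a b] tri_rot by simp
qed

lemma C_triI: "tri a b c \<Longrightarrow> a \<in> S \<Longrightarrow> b \<in> S \<Longrightarrow> c \<in> C"
  unfolding two_term_def using tri_rot[of a b c] tri_Obj unfolding tri_def by blast

lemma tri_zero_right: "a \<in> Obj T \<Longrightarrow> z \<in> Obj T \<Longrightarrow> idm z = \<zero>[z,z] \<Longrightarrow> tri a a z"
  using Tri_Idm zero_objectI triI by blast

lemma tri_zero_left: "a \<in> Obj T \<Longrightarrow> z \<in> Obj T \<Longrightarrow> idm z = \<zero>[z,z] \<Longrightarrow> tri z a a"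
  using tri_zero_right[of a "sh z"] sh_zero tri_rot by simp

lemma S_C: "s \<in> S \<Longrightarrow> s \<in> C"
  by (rule zero_ex) (use C_triI tri_zero_left zero_S S_Obj in blast)

lemma S1_C: "t \<in> S1 \<Longrightarrow> t \<in> C"
  unfolding C_star star_def by (rule zero_ex) (use tri_zero_left zero_S S1_Obj in blast)

lemma sh_S1: "s \<in> S \<Longrightarrow> sh s \<in> S1" unfolding S1_def using isos_refl S_Obj Sh_Obj by blast

lemma S1_E: assumes "t \<in> S1" obtains s where "s \<in> S" "isos t (sh s)" using assms S1_def by blast

lemma van_S_S1: "s \<in> S \<Longrightarrow> t \<in> S1 \<Longrightarrow> van s t"
  by (erule S1_E) (use van_S van_isos_right S_Obj in blast)

lemma van_S_sh_S1: "s \<in> S \<Longrightarrow> t \<in> S1 \<Longrightarrow> van s (sh t)"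
  by (erule S1_E) (use van_S van_isos_right S_Obj isos_sh in blast)

lemma star_S_S: "star S S \<subseteq> S"
proof
  fix t assume "t \<in> star S S"
  then obtain a b where ab: "a \<in> S" "b \<in> S" "tri a t b" unfolding star_def by blast
  obtain i j p q where "biprod t a b i j p q" by (rule van_tri_biprod[OF ab(3) van_S(1)[OF ab(2,1)]])
  then show "t \<in> S" using summand_closed_biprod[OF S_closed] ab by blast
qed

lemma star_S1_S1: "star S1 S1 \<subseteq> S1"
proof
  fix t assume "t \<in> star S1 S1"
  then obtain a b s s' where ab: "s \<in> S" "isos a (sh s)" "s' \<in> S" "isos b (sh s')" "tri a t b"
    unfolding star_def S1_def by blast
  obtain u where u: "u \<in> Obj T" "isos (sh u) t" by (rule isos_sh_ex[of t]) (use tri_Obj ab in auto)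
  have "tri (sh s) (sh u) (sh s')" using tri_isos[OF ab(5) ab(2) isos_sym[OF u(2)] ab(4)] .
  then have "tri s u s'" using tri_sh u ab by simp
  then have "u \<in> S" using star_S_S ab unfolding star_def by blast
  then show "t \<in> S1" unfolding S1_def using u isos_sym by blast
qed

text \<open>The connecting map lies in \<open>T(S, Sh Sh S) = 0\<close>, so such an extension splits
  and its two ends can be exchanged.\<close>

lemma star_S1_S: "star S1 S \<subseteq> star S S1"
proof
  fix t assume "t \<in> star S1 S"
  then obtain a b where ab: "a \<in> S1" "b \<in> S" "tri a t b" unfolding star_def by blast
  obtain i j p q where "biprod t a b i j p q" by (rule van_tri_biprod[OF ab(3) van_S_sh_S1[OF ab(2,1)]])
  then show "t \<in> star S S1" unfolding star_def using biprod_sym biprod_tri ab by blast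
qed

text \<open>In the fourfold product \<open>S * S1 * S * S1\<close> the two middle factors are
  exchanged, after which equal neighbours merge.\<close>

lemma star_C_C: "star C C \<subseteq> C"
proof -
  have "star C C = star S (star (star S1 S) S1)" unfolding C_star star_assoc ..
  also have "\<dots> \<subseteq> star S (star (star S S1) S1)" by (intro star_mono star_S1_S order_refl)
  also have "\<dots> = star (star S S) (star S1 S1)" unfolding star_assoc ..
  also have "\<dots> \<subseteq> star S S1" by (intro star_mono star_S_S star_S1_S1)
  finally show ?thesis unfolding C_star .
qed

lemma C_ext: "tri a b c \<Longrightarrow> a \<in> C \<Longrightarrow> c \<in> C \<Longrightarrow> b \<in> C"
  using star_C_C unfolding star_def by blast

lemma van_S_sh_C: "s \<in> S \<Longrightarrow> c \<in> C \<Longrightarrow> van s (sh c)"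
proof -
  assume s: "s \<in> S" and "c \<in> C"
  then obtain a b where ab: "a \<in> S" "b \<in> S1" "tri a c b" unfolding C_star star_def by blast
  then have "tri (sh a) (sh c) (sh b)" using tri_sh tri_Obj by blast
  then show ?thesis using tri_van_right s ab van_S(1) van_S_sh_S1 S_Obj by meson
qed

lemma van_C_shsh_S: "s \<in> S \<Longrightarrow> c \<in> C \<Longrightarrow> van c (sh (sh s))"
proof -
  assume s: "s \<in> S" and "c \<in> C"
  then obtain a b where ab: "a \<in> S" "b \<in> S" "tri a c (sh b)" unfolding two_term_def tri_def by blast
  have "van a (sh (sh s))" "van (sh b) (sh (sh s))" using van_S van_sh s ab by auto
  then show ?thesis using tri_van_left ab s by auto
qed

text \<open>The fibres e and e' of the composites of \<open>s \<rightarrow> b\<close> with the two projections satisfy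
  \<open>T(e, \<Sigma>e') = 0\<close>, and the homotopy pullback of e and s over d is an extension of e by e' as well
  as one of s by s'. The latter lies in S, so e and e' do.\<close>

lemma C_biprod:
  assumes B: "biprod b c d i j p q" and b: "b \<in> C" shows "c \<in> C"
proof -
  have o: "b \<in> Obj T" "c \<in> Obj T" "d \<in> Obj T" using B biprod_def by auto
  obtain s s' where s: "s \<in> S" "s' \<in> S" "tri s' s b" by (rule C_triE[OF b])
  have tb: "tri d b c" "tri c b d" using biprod_tri biprod_sym B by blast+
  obtain e where e: "tri e s c" "tri s' e d" by (rule octa_dual[OF s(3) tb(1)])
  obtain e' where e': "tri e' s d" "tri s' e' c" by (rule octa_dual[OF s(3) tb(2)])
  have eo: "e \<in> Obj T" "e' \<in> Obj T" using e e' tri_Obj by blast+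
  have so: "s \<in> Obj T" "s' \<in> Obj T" using s by auto
  have B': "i \<in> hom c b" "p \<in> hom b c" "p \<cdot>[c,b,c] i = idm c"
    "j \<in> hom d b" "q \<in> hom b d" "q \<cdot>[d,b,d] j = idm d"
    using B unfolding biprod_def by auto
  have van_S_c: "van u (sh c)" "van u (sh d)" if u: "u \<in> S" for u
    using van_retract_right[of "sh c" "sh b" u "shm c b i" "shm b c p"]
      van_retract_right[of "sh d" "sh b" u "shm d b j" "shm b d q"]
      van_S_sh_C[OF u b] B' o u by (auto simp flip: ShM_Cmp)
  have van_S_e': "van u (sh e')" "van u (sh (sh e'))" if u: "u \<in> S" for u
  proof -
    have "tri (sh s') (sh e') (sh c)" using e' tri_sh so eo o by simp
    then show "van u (sh e')" using tri_van_right u s van_S_c van_S S_Obj by meson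
    have "tri d (sh e') (sh s)" using e'(1) so eo o tri_rot by simp
    then have "tri (sh d) (sh (sh e')) (sh (sh s))" using tri_sh so eo o by simp
    then show "van u (sh (sh e'))" using tri_van_right u s van_S_c van_S S_Obj by meson
  qed
  \<comment> \<open>Towards \<open>T(e, Sh e') = 0\<close>: the functor
    \<open>T(-, Sh Sh e')\<close> vanishes on \<open>u\<close> and \<open>Sh u'\<close>, hence on
    \<open>b\<close> and its retract \<open>c\<close>, and then on \<open>Sh e\<close>, which lies
    between \<open>c\<close> and \<open>Sh s\<close>.\<close>
  obtain u u' where u: "u \<in> S" "u' \<in> S" "tri u b (sh u')"
    using b unfolding two_term_def tri_def by blast
  have "van (sh u') (sh (sh e'))" using van_S_e' van_sh u eo by simp
  then have "van b (sh (sh e'))" using tri_van_left[OF u(3)] van_S_e' u eo by simp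
  then have "van c (sh (sh e'))" using van_retract_left[OF o(2,1) _ _ B'(1-3)] eo by simp
  moreover have "tri c (sh e) (sh s)" using e so eo o tri_rot by simp
  moreover have "van (sh s) (sh (sh e'))" using van_S_e' van_sh s eo by simp
  ultimately have "van (sh e) (sh (sh e'))" using tri_van_left eo by simp
  then have van_e: "van e (sh e')" using van_sh eo by simp
  have td: "tri s d (sh e')" using e'(1) eo tri_rot by blast
  \<comment> \<open>The homotopy pullback, obtained as the fibre of the composite
    \<open>e -> d -> Sh e'\<close>.\<close>
  obtain w where w: "tri w e (sh e')" "tri s' w s" by (rule octa_dual[OF e(2) td])
  have "w \<in> S" using star_S_S w s unfolding star_def by blast
  moreover have "tri e' w e" using w eo tri_rot by blast
  then obtain i j p q where "biprod w e' e i j p q" by (rule van_tri_biprod[OF _ van_e])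
  ultimately have "e \<in> S" using summand_closed_biprod[OF S_closed] by blast
  then show ?thesis using C_triI e s by blast
qed

end

section \<open>Two-term objects and their S-points\<close>

context presilting_category
begin

text \<open>For w from c to d, the induced natural transformation from \<open>T(-, c)\<close> to \<open>T(-, d)\<close>
  on S is zero, surjective or injective, respectively, and \<open>pexact\<close> is exactness at \<open>T(-, c)\<close>.\<close>

definition null :: "'o \<Rightarrow> 'o \<Rightarrow> 'm \<Rightarrow> bool" where
  "null c d w \<longleftrightarrow> (\<forall>s\<in>S. \<forall>x\<in>hom s c. w \<cdot>[s,c,d] x = \<zero>[s,d])"
definition onto :: "'o \<Rightarrow> 'o \<Rightarrow> 'm \<Rightarrow> bool" where
  "onto c d w \<longleftrightarrow> (\<forall>s\<in>S. \<forall>y\<in>hom s d. \<exists>x\<in>hom s c. y = w \<cdot>[s,c,d] x)"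
definition pinj :: "'o \<Rightarrow> 'o \<Rightarrow> 'm \<Rightarrow> bool" where
  "pinj c d w \<longleftrightarrow> (\<forall>s\<in>S. \<forall>x\<in>hom s c. w \<cdot>[s,c,d] x = \<zero>[s,d] \<longrightarrow> x = \<zero>[s,c])"
definition pexact :: "'o \<Rightarrow> 'o \<Rightarrow> 'o \<Rightarrow> 'm \<Rightarrow> 'm \<Rightarrow> bool" where
  "pexact e c d j w \<longleftrightarrow>
    (\<forall>s\<in>S. \<forall>x\<in>hom s c. w \<cdot>[s,c,d] x = \<zero>[s,d] \<longleftrightarrow> (\<exists>z\<in>hom s e. x = j \<cdot>[s,e,c] z))"

lemma nullD: "null c d w \<Longrightarrow> s \<in> S \<Longrightarrow> x \<in> hom s c \<Longrightarrow> w \<cdot>[s,c,d] x = \<zero>[s,d]"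
  unfolding null_def by blast
lemma ontoE:
  assumes "onto c d w" "s \<in> S" "y \<in> hom s d" obtains x where "x \<in> hom s c" "y = w \<cdot>[s,c,d] x"
  using assms unfolding onto_def by blast
lemma pinjD: "pinj c d w \<Longrightarrow> s \<in> S \<Longrightarrow> x \<in> hom s c \<Longrightarrow> w \<cdot>[s,c,d] x = \<zero>[s,d] \<Longrightarrow> x = \<zero>[s,c]"
  unfolding pinj_def by blast
lemma pexactE:
  assumes "pexact e c d j w" "s \<in> S" "x \<in> hom s c" "w \<cdot>[s,c,d] x = \<zero>[s,d]"
  obtains z where "z \<in> hom s e" "x = j \<cdot>[s,e,c] z"
  using assms unfolding pexact_def by blast
lemma pexactD:
  assumes "pexact e c d j w" "s \<in> S" "z \<in> hom s e" "e \<in> C" "c \<in> C" "j \<in> hom e c"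
  shows "w \<cdot>[s,c,d] (j \<cdot>[s,e,c] z) = \<zero>[s,d]"
  using assms unfolding pexact_def by auto

section \<open>Triangles and Ext-vanishing on S-points\<close>

lemma onto_Tri:
  assumes t: "(a, b, c, f, g, h) \<in> Tri T" and v: "\<And>s. s \<in> S \<Longrightarrow> van s (sh a)"
  shows "onto b c g"
  unfolding onto_def
proof (intro ballI)
  fix s y assume s: "s \<in> S" and y: "y \<in> hom s c"
  note o = Tri_arr[OF t]
  have "h \<cdot>[s,c,sh a] y = \<zero>[s,sh a]" by (rule vanD[OF v]) (use s y o in auto)
  then obtain w where "w \<in> hom s b" "y = g \<cdot>[s,b,c] w"
    using weak_kernel[OF Tri_rot[OF t], of s y] s y o by (metis S_Obj)
  then show "\<exists>x\<in>hom s b. y = g \<cdot>[s,b,c] x" by blast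
qed

lemma pexact_Tri:
  assumes t: "(a, b, c, f, g, h) \<in> Tri T"
  shows "pexact a b c f g"
  unfolding pexact_def
proof (intro ballI iffI)
  note o = Tri_arr[OF t]
  fix s x assume s: "s \<in> S" and x: "x \<in> hom s b"
  show "\<exists>z\<in>hom s a. x = f \<cdot>[s,a,b] z" if "g \<cdot>[s,b,c] x = \<zero>[s,c]"
    using weak_kernel[OF t S_Obj[OF s] x that] by blast
  assume "\<exists>z\<in>hom s a. x = f \<cdot>[s,a,b] z"
  then show "g \<cdot>[s,b,c] x = \<zero>[s,c]"
    using o s Cmp_reassoc[OF Tri_zero_1[OF t]] by auto
qed

lemma C_pres:
  assumes "c \<in> C"
  obtains a1 a0 f p h where "a1 \<in> S" "a0 \<in> S" "(a1, a0, c, f, p, h) \<in> Tri T" "onto a0 c p"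
    "f \<in> hom a1 a0" "p \<in> hom a0 c" "h \<in> hom c (sh a1)"
proof -
  obtain a1 a0 where a: "a1 \<in> S" "a0 \<in> S" "tri a1 a0 c" by (rule C_triE[OF assms])
  then obtain f p h where t: "(a1, a0, c, f, p, h) \<in> Tri T" unfolding tri_def by blast
  have "onto a0 c p" using onto_Tri[OF t] van_S a by blast
  then show ?thesis using that a t Tri_arr[OF t] by blast
qed

text \<open>A map \<open>x -> Sh c\<close> vanishes on \<open>a0\<close> since
  \<open>T(S, Sh C) = 0\<close>, so it factors through \<open>h\<close> as the shift of some
  \<open>m : a1 -> c\<close>. It is zero if \<open>m\<close> extends along \<open>f\<close>;
  conversely, vanishing of \<open>shm m h\<close> lets \<open>m\<close> extend.\<close>

lemma ext_van_iff:
  assumes t: "(a1, a0, x, f, p, h) \<in> Tri T" "a1 \<in> S" "a0 \<in> S" and c: "c \<in> C"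
  shows "van x (sh c) \<longleftrightarrow> (\<forall>m\<in>hom a1 c. \<exists>n\<in>hom a0 c. m = n \<cdot>[a1,a0,c] f)"
proof (intro iffI ballI)
  note o = Tri_arr[OF t(1)] C_Obj[OF c]
  show "\<exists>n\<in>hom a0 c. m = n \<cdot>[a1,a0,c] f" if v: "van x (sh c)" and m: "m \<in> hom a1 c" for m
  proof -
    have "shm a1 c m \<cdot>[x,sh a1,sh c] h = \<zero>[x,sh c]"
      by (rule vanD[OF v]) (use o m in auto)
    then obtain n where "n \<in> hom a0 c" "m = n \<cdot>[a1,a0,c] f" by (rule extend_along[OF t(1) C_Obj[OF c] m])
    then show ?thesis by blast
  qed
  assume ex: "\<forall>m\<in>hom a1 c. \<exists>n\<in>hom a0 c. m = n \<cdot>[a1,a0,c] f"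
  show "van x (sh c)"
  proof (rule vanI)
    fix g assume g: "g \<in> hom x (sh c)"
    have gp: "g \<cdot>[a0,x,sh c] p = \<zero>[a0,sh c]"
      by (rule vanD[OF van_S_sh_C]) (use t c g o in auto)
    obtain W where W: "W \<in> hom (sh a1) (sh c)" "g = W \<cdot>[x,sh a1,sh c] h"
      by (rule weak_cokernel[OF Tri_rot[OF t(1)] _ g gp]) (use o in auto)
    obtain m where m: "m \<in> hom a1 c" "W = shm a1 c m" by (rule shm_surj[OF _ _ W(1)]) (use o in auto)
    obtain n where n: "n \<in> hom a0 c" "m = n \<cdot>[a1,a0,c] f" using ex m by blast
    show "g = \<zero>[x,sh c]"
      using W m n o Tri_zero_3[OF t(1)] by (simp add: ShM_Cmp Cmp_assoc)
  qed (use o in auto)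
qed

section \<open>Orthogonality for the extension groups \<open>E(x, c) = T(x, Sh c)\<close> inside
  C\<close>

definition perpR :: "'o set \<Rightarrow> 'o set" where "perpR X = {c \<in> C. \<forall>x\<in>X. van x (sh c)}"
definition perpL :: "'o set \<Rightarrow> 'o set" where "perpL Y = {c \<in> C. \<forall>y\<in>Y. van c (sh y)}"

text \<open>By \<open>ext_van_iff\<close> only maps out of \<open>a1\<close> and \<open>a0\<close>
  matter. As \<open>a1\<close> is in S, a map \<open>a1 -> d\<close> lifts along \<open>w\<close>;
  the lift extends along \<open>f\<close>, and the extension is pushed to \<open>d\<close>.\<close>

lemma perpR_quotient:
  assumes X: "X \<subseteq> C" and c: "c \<in> perpR X" and d: "d \<in> C" and w: "w \<in> hom c d" "onto c d w"
  shows "d \<in> perpR X"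
  unfolding perpR_def
proof (intro CollectI conjI ballI d)
  fix x assume x: "x \<in> X"
  obtain a1 a0 f p h where a: "a1 \<in> S" "a0 \<in> S" "(a1, a0, x, f, p, h) \<in> Tri T" "f \<in> hom a1 a0"
    using X x by (meson C_pres subsetD)
  have cC: "c \<in> C" and v: "van x (sh c)" using c x unfolding perpR_def by auto
  show "van x (sh d)"
    unfolding ext_van_iff[OF a(3,1,2) d]
  proof
    fix m assume m: "m \<in> hom a1 d"
    obtain m' where m': "m' \<in> hom a1 c" "m = w \<cdot>[a1,c,d] m'" by (rule ontoE[OF w(2) a(1) m])
    obtain n' where n': "n' \<in> hom a0 c" "m' = n' \<cdot>[a1,a0,c] f"
      using v m' unfolding ext_van_iff[OF a(3,1,2) cC] by blast
    have "m = (w \<cdot>[a0,c,d] n') \<cdot>[a1,a0,d] f"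
      using m' n' a w cC d by (simp add: Cmp_assoc)
    moreover have "w \<cdot>[a0,c,d] n' \<in> hom a0 d" using n' a w cC d by simp
    ultimately show "\<exists>n\<in>hom a0 d. m = n \<cdot>[a1,a0,d] f" by blast
  qed
qed

text \<open>Extend the image of \<open>m\<close> in \<open>d\<close> and lift the extension to
  \<open>n' : a0 -> c\<close>. The error \<open>m - n' f\<close> dies in \<open>d\<close>, so it
  comes from \<open>e\<close>, where it extends too.\<close>

lemma perpR_extension:
  assumes X: "X \<subseteq> C" and ed: "e \<in> perpR X" "d \<in> perpR X" and c: "c \<in> C"
    and j: "j \<in> hom e c" and w: "w \<in> hom c d" "onto c d w" and ex: "pexact e c d j w"
  shows "c \<in> perpR X"
  unfolding perpR_def
proof (intro CollectI conjI ballI c)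
  fix x assume x: "x \<in> X"
  obtain a1 a0 f p h where a: "a1 \<in> S" "a0 \<in> S" "(a1, a0, x, f, p, h) \<in> Tri T" "f \<in> hom a1 a0"
    using X x by (meson C_pres subsetD)
  have C: "e \<in> C" "d \<in> C" and v: "van x (sh e)" "van x (sh d)" using ed x unfolding perpR_def by auto
  note o = S_Obj[OF a(1)] S_Obj[OF a(2)] C_Obj[OF C(1)] C_Obj[OF C(2)] C_Obj[OF c]
  show "van x (sh c)"
    unfolding ext_van_iff[OF a(3,1,2) c]
  proof
    fix m assume m: "m \<in> hom a1 c"
    have "w \<cdot>[a1,c,d] m \<in> hom a1 d" using m w o by simp
    then obtain n where n: "n \<in> hom a0 d" "w \<cdot>[a1,c,d] m = n \<cdot>[a1,a0,d] f"
      using v unfolding ext_van_iff[OF a(3,1,2) C(2)] by blast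
    obtain n' where n': "n' \<in> hom a0 c" "n = w \<cdot>[a0,c,d] n'" by (rule ontoE[OF w(2) a(2) n(1)])
    let ?m = "m \<ominus>[a1,c] (n' \<cdot>[a1,a0,c] f)"
    have m': "?m \<in> hom a1 c" using m n' a o by simp
    have "w \<cdot>[a1,c,d] ?m = \<zero>[a1,d]"
      using m n n' a w o by (simp add: bilin Cmp_assoc)
    then obtain l where l: "l \<in> hom a1 e" "?m = j \<cdot>[a1,e,c] l" by (rule pexactE[OF ex a(1) m'])
    obtain l' where l': "l' \<in> hom a0 e" "l = l' \<cdot>[a1,a0,e] f"
      using v l unfolding ext_van_iff[OF a(3,1,2) C(1)] by blast
    have "m = ?m \<oplus>[a1,c] (n' \<cdot>[a1,a0,c] f)" using m n' a o by simp
    also have "\<dots> = ((j \<cdot>[a0,e,c] l') \<oplus>[a0,c] n') \<cdot>[a1,a0,c] f"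
      unfolding l(2) using l' n' j a o by (simp add: bilin Cmp_assoc)
    finally have "m = ((j \<cdot>[a0,e,c] l') \<oplus>[a0,c] n') \<cdot>[a1,a0,c] f" .
    moreover have "(j \<cdot>[a0,e,c] l') \<oplus>[a0,c] n' \<in> hom a0 c" using l'(1) n'(1) j o by simp
    ultimately show "\<exists>n\<in>hom a0 c. m = n \<cdot>[a1,a0,c] f" by blast
  qed
qed

text \<open>The generator \<open>p : a0 -> z\<close> goes into the image of \<open>j\<close>. Its
  lift \<open>l\<close> kills the relation \<open>f\<close> because \<open>j\<close> is injective on
  S-points, so it descends to the cone \<open>z\<close>. The factorization holds on S-points only,
  since \<open>p\<close> is onto merely there.\<close>

lemma factor_pinj:
  assumes z: "z \<in> C" "I \<in> C" "c \<in> C" and b: "b \<in> hom z c" and j: "j \<in> hom I c" "pinj I c j"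
    and sub: "\<And>s x. s \<in> S \<Longrightarrow> x \<in> hom s z \<Longrightarrow> \<exists>y\<in>hom s I. b \<cdot>[s,z,c] x = j \<cdot>[s,I,c] y"
  obtains g where "g \<in> hom z I" "\<And>s x. s \<in> S \<Longrightarrow> x \<in> hom s z \<Longrightarrow> b \<cdot>[s,z,c] x = j \<cdot>[s,I,c] (g \<cdot>[s,z,I] x)"
proof -
  obtain a1 a0 f p h where a: "a1 \<in> S" "a0 \<in> S" "(a1, a0, z, f, p, h) \<in> Tri T" "f \<in> hom a1 a0"
    "p \<in> hom a0 z" "onto a0 z p" by (rule C_pres[OF z(1)])
  note o = S_Obj[OF a(1)] S_Obj[OF a(2)] C_Obj[OF z(1)] C_Obj[OF z(2)] C_Obj[OF z(3)]
  obtain l where l: "l \<in> hom a0 I" "b \<cdot>[a0,z,c] p = j \<cdot>[a0,I,c] l" using sub a by blast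
  have "j \<cdot>[a1,I,c] (l \<cdot>[a1,a0,I] f) = b \<cdot>[a1,z,c] (p \<cdot>[a1,a0,z] f)"
    using Cmp_reassoc[OF l(2), of a1 f] Cmp_reassoc[OF refl, of a1 a0 I c f l j] l(1) a o j b by simp
  also have "\<dots> = \<zero>[a1,c]" using Tri_zero_1[OF a(3)] o b by simp
  finally have "l \<cdot>[a1,a0,I] f = \<zero>[a1,I]" using pinjD[OF j(2) a(1)] l o a by simp
  then obtain g where g: "g \<in> hom z I" "l = g \<cdot>[a0,z,I] p"
    by (rule weak_cokernel[OF a(3) o(4) l(1)])
  have "b \<cdot>[s,z,c] x = j \<cdot>[s,I,c] (g \<cdot>[s,z,I] x)" if s: "s \<in> S" and x: "x \<in> hom s z" for s x
  proof -
    obtain x' where x': "x' \<in> hom s a0" "x = p \<cdot>[s,a0,z] x'" by (rule ontoE[OF a(6) s x])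
    show ?thesis using x' g l(1) a o j b S_Obj[OF s] Cmp_reassoc[OF l(2), of s x'] 
      by (simp add: Cmp_assoc)
  qed
  with g(1) show ?thesis by (rule that)
qed

text \<open>Lift the generator \<open>p : a0 -> d\<close> to \<open>l : a0 -> c\<close>. The
  relation \<open>l f\<close> comes from \<open>e\<close> and is killed by \<open>u\<close>, so
  \<open>u l\<close> descends to \<open>v\<close>. On S-points, any \<open>y\<close> differs from a
  value of \<open>l\<close> by an element coming from \<open>e\<close>.\<close>

lemma factor_coker:
  assumes C: "e \<in> C" "c \<in> C" "d \<in> C" "x \<in> C" and j: "j \<in> hom e c" and w: "w \<in> hom c d" "onto c d w"
    and ex: "pexact e c d j w" and u: "u \<in> hom c x" "\<And>s z. s \<in> S \<Longrightarrow> z \<in> hom s e \<Longrightarrow> u \<cdot>[s,c,x] (j \<cdot>[s,e,c] z) = \<zero>[s,x]"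
  obtains v where "v \<in> hom d x" "\<And>s y. s \<in> S \<Longrightarrow> y \<in> hom s c \<Longrightarrow> u \<cdot>[s,c,x] y = v \<cdot>[s,d,x] (w \<cdot>[s,c,d] y)"
proof -
  obtain a1 a0 f p h where a: "a1 \<in> S" "a0 \<in> S" "(a1, a0, d, f, p, h) \<in> Tri T" "f \<in> hom a1 a0"
    "p \<in> hom a0 d" "onto a0 d p" by (rule C_pres[OF C(3)])
  note o = S_Obj[OF a(1)] S_Obj[OF a(2)] C_Obj[OF C(1)] C_Obj[OF C(2)] C_Obj[OF C(3)] C_Obj[OF C(4)]
  obtain l where l: "l \<in> hom a0 c" "p = w \<cdot>[a0,c,d] l" by (rule ontoE[OF w(2) a(2,5)])
  have "w \<cdot>[a1,c,d] (l \<cdot>[a1,a0,c] f) = p \<cdot>[a1,a0,d] f"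
    using l a(4) o w by (simp add: Cmp_assoc)
  then have wlf: "w \<cdot>[a1,c,d] (l \<cdot>[a1,a0,c] f) = \<zero>[a1,d]" using Tri_zero_1[OF a(3)] by simp
  obtain n where n: "n \<in> hom a1 e" "l \<cdot>[a1,a0,c] f = j \<cdot>[a1,e,c] n"
    by (rule pexactE[OF ex a(1) _ wlf]) (use l(1) a(4) o in auto)
  have ul: "u \<cdot>[a0,c,x] l \<in> hom a0 x" using u(1) l(1) o by simp
  have "(u \<cdot>[a0,c,x] l) \<cdot>[a1,a0,x] f = \<zero>[a1,x]"
    using u(2)[OF a(1) n(1)] n(2) u(1) l(1) a(4) o by (simp add: Cmp_assoc)
  then obtain v where v: "v \<in> hom d x" "u \<cdot>[a0,c,x] l = v \<cdot>[a0,d,x] p"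
    by (rule weak_cokernel[OF a(3) o(6) ul])
  have "u \<cdot>[s,c,x] y = v \<cdot>[s,d,x] (w \<cdot>[s,c,d] y)" if s: "s \<in> S" and y: "y \<in> hom s c" for s y
  proof -
    note so = S_Obj[OF s]
    have wy: "w \<cdot>[s,c,d] y \<in> hom s d" using w y o so by simp
    obtain x' where x': "x' \<in> hom s a0" "w \<cdot>[s,c,d] y = p \<cdot>[s,a0,d] x'" by (rule ontoE[OF a(6) s wy])
    let ?y = "y \<ominus>[s,c] (l \<cdot>[s,a0,c] x')"
    have y': "?y \<in> hom s c" using y l(1) x'(1) o so by simp
    have "w \<cdot>[s,c,d] ?y = \<zero>[s,d]"
      using x' y l w o so a(5) Cmp_reassoc[OF l(2)[symmetric], of s x'] by (simp add: bilin)
    then obtain n' where n': "n' \<in> hom s e" "?y = j \<cdot>[s,e,c] n'" by (rule pexactE[OF ex s y'])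
    have "u \<cdot>[s,c,x] ?y = \<zero>[s,x]" using u(2)[OF s n'(1)] n'(2) by simp
    then have "u \<cdot>[s,c,x] y = u \<cdot>[s,c,x] (l \<cdot>[s,a0,c] x')"
      using y l(1) x'(1) u(1) o so by (simp add: bilin)
    also have "\<dots> = v \<cdot>[s,d,x] (p \<cdot>[s,a0,d] x')"
      using Cmp_reassoc[OF v(2), of s x'] v(1) a(5) u(1) l(1) x'(1) o so by (simp add: Cmp_assoc)
    finally show ?thesis using x'(2) by simp
  qed
  with v(1) show ?thesis by (rule that)
qed

text \<open>The cone of \<open>q\<close> itself need not lie in C. The cone of
  \<open>a0 -> y -> d\<close> is an extension of \<open>Sh a0\<close> by \<open>d\<close>, hence
  does, and replacing \<open>y\<close> by \<open>a0\<close> does not change the image because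
  \<open>a0 -> y\<close> is onto on S-points.\<close>

lemma coker_ex:
  assumes C: "y \<in> C" "d \<in> C" and q: "q \<in> hom y d"
  obtains e r where "e \<in> C" "r \<in> hom d e" "onto d e r" "pexact y d e q r"
proof -
  obtain a1 a0 f p h where a: "a1 \<in> S" "a0 \<in> S" "(a1, a0, y, f, p, h) \<in> Tri T" "f \<in> hom a1 a0"
    "p \<in> hom a0 y" "onto a0 y p" by (rule C_pres[OF C(1)])
  note o = S_Obj[OF a(1)] S_Obj[OF a(2)] C_Obj[OF C(1)] C_Obj[OF C(2)]
  obtain e r h where t: "(a0, d, e, q \<cdot>[a0,y,d] p, r, h) \<in> Tri T"
    using Tri_cone[of a0 d "q \<cdot>[a0,y,d] p"] o q a by auto
  note o' = Tri_arr[OF t]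
  have e: "e \<in> C" using C_ext[OF _ C(2) S1_C[OF sh_S1[OF a(2)]]] triI[OF Tri_rot[OF t]] by blast
  have on: "onto d e r" by (rule onto_Tri[OF t]) (use van_S a in blast)
  have "pexact y d e q r"
    unfolding pexact_def
  proof (intro ballI iffI)
    fix s x assume s: "s \<in> S" and x: "x \<in> hom s d"
    note so = S_Obj[OF s]
    show "\<exists>z\<in>hom s y. x = q \<cdot>[s,y,d] z" if rx: "r \<cdot>[s,d,e] x = \<zero>[s,e]"
    proof -
      obtain z where "z \<in> hom s a0" "x = (q \<cdot>[a0,y,d] p) \<cdot>[s,a0,d] z"
        by (rule pexactE[OF pexact_Tri[OF t] s x rx])
      then show ?thesis using q a(5) o so by (intro bexI[of _ "p \<cdot>[s,a0,y] z"]) (auto simp: Cmp_assoc)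
    qed
    assume "\<exists>z\<in>hom s y. x = q \<cdot>[s,y,d] z"
    then obtain z where z: "z \<in> hom s y" "x = q \<cdot>[s,y,d] z" by blast
    obtain z' where z': "z' \<in> hom s a0" "z = p \<cdot>[s,a0,y] z'" by (rule ontoE[OF a(6) s z(1)])
    have "x = (q \<cdot>[a0,y,d] p) \<cdot>[s,a0,d] z'" using z z' q a(5) o so by (simp add: Cmp_assoc)
    then show "r \<cdot>[s,d,e] x = \<zero>[s,e]"
      using Cmp_reassoc[OF Tri_zero_1[OF t], of s z'] z'(1) o' so by simp
  qed
  with e on show ?thesis using that o' by blast
qed

lemma summand_closed_C:
  assumes "additive_summand_closed (full_sub T C) P" "biprod x a b i j p q" "x \<in> C" "a \<in> C" "b \<in> C"
  shows "x \<in> P \<longleftrightarrow> a \<in> P \<and> b \<in> P"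
proof -
  interpret F: linear_category k "full_sub T C"
    by (rule linear_category_full_sub) (use C_Obj in \<open>auto intro: linear_category_axioms\<close>)
  have "F.biprod x a b i j p q"
    using assms(2-5) unfolding F.biprod_def biprod_def by (simp add: full_sub_def)
  then show ?thesis using F.summand_closed_biprod assms(1) by blast
qed

section \<open>Cotorsion pairs as Ext-orthogonal pairs\<close>

lemma cotorsion_subset:
  assumes "complete_cotorsion_pair T C P Q" shows "P \<subseteq> C" "Q \<subseteq> C"
  using assms unfolding complete_cotorsion_pair_def additive_summand_closed_def by (auto simp: full_sub_def)

text \<open>For \<open>z\<close> orthogonal to \<open>P\<close>, the triangle
  \<open>z -> y -> x\<close> splits, which makes \<open>z\<close> a summand of \<open>y\<close>. The
  other triangle gives the dual statement \<open>cotorsion_perpL\<close>.\<close>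

lemma cotorsion_perpR:
  assumes c: "complete_cotorsion_pair T C P Q" shows "Q = perpR P"
proof
  note PQ = cotorsion_subset[OF c]
  show "Q \<subseteq> perpR P" using c PQ unfolding complete_cotorsion_pair_def perpR_def van_def by auto
  show "perpR P \<subseteq> Q"
  proof
    fix z assume z: "z \<in> perpR P"
    then have "z \<in> C" unfolding perpR_def by blast
    then obtain y x where yx: "y \<in> Q" "x \<in> P" "tri z y x"
      using c unfolding complete_cotorsion_pair_def tri_def by blast
    have v: "van x (sh z)" using z yx unfolding perpR_def by blast
    obtain i j p q where "biprod y z x i j p q" by (rule van_tri_biprod[OF yx(3) v])
    then show "z \<in> Q" using summand_closed_C[of Q y z x i j p q] c yx PQ \<open>z \<in> C\<close>
      unfolding complete_cotorsion_pair_def by blast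
  qed
qed

lemma cotorsion_perpL:
  assumes c: "complete_cotorsion_pair T C P Q" shows "P = perpL Q"
proof
  note PQ = cotorsion_subset[OF c]
  show "P \<subseteq> perpL Q" using c PQ unfolding complete_cotorsion_pair_def perpL_def van_def by auto
  show "perpL Q \<subseteq> P"
  proof
    fix z assume z: "z \<in> perpL Q"
    then have "z \<in> C" unfolding perpL_def by blast
    then obtain y x where yx: "y \<in> Q" "x \<in> P" "tri y x z"
      using c unfolding complete_cotorsion_pair_def tri_def by blast
    have v: "van z (sh y)" using z yx unfolding perpL_def by blast
    obtain i j p q where "biprod x y z i j p q" by (rule van_tri_biprod[OF yx(3) v])
    then show "z \<in> P" using summand_closed_C[of P x y z i j p q] c yx PQ \<open>z \<in> C\<close>
      unfolding complete_cotorsion_pair_def by blast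
  qed
qed

end

section \<open>Finitely presented functors on S\<close>

lemma module_hom_closed: "f \<in> module_hom k M N \<Longrightarrow> x \<in> carrier M \<Longrightarrow> f x \<in> carrier N"
  and module_hom_add: "f \<in> module_hom k M N \<Longrightarrow> x \<in> carrier M \<Longrightarrow> y \<in> carrier M \<Longrightarrow>
    f (x \<oplus>\<^bsub>M\<^esub> y) = f x \<oplus>\<^bsub>N\<^esub> f y"
  and module_hom_smult: "f \<in> module_hom k M N \<Longrightarrow> r \<in> carrier k \<Longrightarrow> x \<in> carrier M \<Longrightarrow>
    f (r \<odot>\<^bsub>M\<^esub> x) = r \<odot>\<^bsub>N\<^esub> f x"
  unfolding module_hom_def by auto

lemma module_hom_zero:
  assumes "module k M" "module k N" "f \<in> module_hom k M N"
  shows "f \<zero>\<^bsub>M\<^esub> = \<zero>\<^bsub>N\<^esub>"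
proof -
  interpret M: module k M by fact
  interpret N: module k N by fact
  have "f \<zero>\<^bsub>M\<^esub> \<oplus>\<^bsub>N\<^esub> f \<zero>\<^bsub>M\<^esub> = f \<zero>\<^bsub>M\<^esub>"
    using module_hom_add[OF assms(3) M.zero_closed M.zero_closed] by simp
  then show ?thesis using module_hom_closed[OF assms(3) M.zero_closed] N.add.l_cancel_one by blast
qed

context presilting_category
begin

section \<open>The category of finitely presented functors\<close>

abbreviation R where "R \<equiv> full_sub T S"
abbreviation H where "H \<equiv> mod_cat k R"

lemma R_simps [simp]: "Obj R = S" "Hom R = Hom T" "Idm R = Idm T" "Cmp R = Cmp T"
  by (simp_all add: full_sub_def)

lemma H_Obj: "M \<in> Obj H \<longleftrightarrow> contravariant_additive k R M \<and> finitely_presented k R M"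
  by (simp add: mod_cat_def)

lemma H_arr: "\<eta> \<in> arr H M N \<longleftrightarrow>
    \<eta> \<in> (\<Pi>\<^sub>E s\<in>S. extensional (carrier (FOb M s))) \<and> natural k R M N \<eta>"
  by (simp add: mod_cat_def)

lemma H_zero [simp]: "s \<in> S \<Longrightarrow> X \<in> carrier (FOb M s) \<Longrightarrow> \<zero>\<^bsub>Hom H M N\<^esub> s X = \<zero>\<^bsub>FOb N s\<^esub>"
  by (simp add: mod_cat_def)

lemma H_Cmp [simp]: "s \<in> S \<Longrightarrow> X \<in> carrier (FOb M s) \<Longrightarrow> Cmp H M N K \<theta> \<eta> s X = \<theta> s (\<eta> s X)"
  by (simp add: mod_cat_def)

lemma H_Idm [simp]: "s \<in> S \<Longrightarrow> X \<in> carrier (FOb M s) \<Longrightarrow> Idm H M s X = X"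
  by (simp add: mod_cat_def)

lemma H_eqI:
  assumes "\<eta> \<in> arr H M N" "\<eta>' \<in> arr H M N" "\<And>s X. s \<in> S \<Longrightarrow> X \<in> carrier (FOb M s) \<Longrightarrow> \<eta> s X = \<eta>' s X"
  shows "\<eta> = \<eta>'"
proof (rule PiE_ext)
  show e: "\<eta> \<in> (\<Pi>\<^sub>E s\<in>S. extensional (carrier (FOb M s)))" "\<eta>' \<in> (\<Pi>\<^sub>E s\<in>S. extensional (carrier (FOb M s)))"
    using assms(1,2) unfolding H_arr by blast+
  show "\<eta> s = \<eta>' s" if "s \<in> S" for s
    by (rule extensionalityI[of _ "carrier (FOb M s)"]) (use e that assms(3) in \<open>auto dest: PiE_mem\<close>)
qed

lemma H_module: "M \<in> Obj H \<Longrightarrow> s \<in> S \<Longrightarrow> module k (FOb M s)"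
  unfolding H_Obj contravariant_additive_def by simp

text \<open>A chart identifies \<open>M\<close> with the restriction of \<open>T(-, c)\<close> to S.
  Since \<open>c\<close> is not determined by \<open>M\<close>, charts are carried along as data
  instead of being chosen once for each functor.\<close>

definition chart :: "'o \<Rightarrow> ('o, 'm, 'k, 'm set) modfunctor \<Rightarrow> ('o \<Rightarrow> 'm \<Rightarrow> 'm set) \<Rightarrow> bool" where
  "chart c M \<theta> \<longleftrightarrow> natural k R (representable T c) M \<theta> \<and>
    (\<forall>s\<in>S. bij_betw (\<theta> s) (hom s c) (carrier (FOb M s)))"

lemma chartD:
  assumes "chart c M \<theta>" "s \<in> S"
  shows "x \<in> hom s c \<Longrightarrow> \<theta> s x \<in> carrier (FOb M s)"
    and "x \<in> hom s c \<Longrightarrow> y \<in> hom s c \<Longrightarrow> \<theta> s (x \<oplus>[s,c] y) = \<theta> s x \<oplus>\<^bsub>FOb M s\<^esub> \<theta> s y"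
    and "r \<in> carrier k \<Longrightarrow> x \<in> hom s c \<Longrightarrow> \<theta> s (r \<odot>\<^bsub>Hom T s c\<^esub> x) = r \<odot>\<^bsub>FOb M s\<^esub> \<theta> s x"
    and "x \<in> hom s c \<Longrightarrow> y \<in> hom s c \<Longrightarrow> \<theta> s x = \<theta> s y \<Longrightarrow> x = y"
    and "s' \<in> S \<Longrightarrow> f \<in> hom s s' \<Longrightarrow> x' \<in> hom s' c \<Longrightarrow>
      \<theta> s (x' \<cdot>[s,s',c] f) = FMor M s s' f (\<theta> s' x')"
proof -
  have h: "\<theta> s \<in> module_hom k (Hom T s c) (FOb M s)"
    using assms(1,2) unfolding chart_def natural_def representable_def by simp
  show "x \<in> hom s c \<Longrightarrow> \<theta> s x \<in> carrier (FOb M s)" by (rule module_hom_closed[OF h])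
  show "x \<in> hom s c \<Longrightarrow> y \<in> hom s c \<Longrightarrow> \<theta> s (x \<oplus>[s,c] y) = \<theta> s x \<oplus>\<^bsub>FOb M s\<^esub> \<theta> s y"
    by (rule module_hom_add[OF h])
  show "r \<in> carrier k \<Longrightarrow> x \<in> hom s c \<Longrightarrow> \<theta> s (r \<odot>\<^bsub>Hom T s c\<^esub> x) = r \<odot>\<^bsub>FOb M s\<^esub> \<theta> s x"
    by (rule module_hom_smult[OF h])
  show "x \<in> hom s c \<Longrightarrow> y \<in> hom s c \<Longrightarrow> \<theta> s x = \<theta> s y \<Longrightarrow> x = y"
    using assms(1,2) unfolding chart_def bij_betw_def inj_on_def by blast
  show "s' \<in> S \<Longrightarrow> f \<in> hom s s' \<Longrightarrow> x' \<in> hom s' c \<Longrightarrow>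
      \<theta> s (x' \<cdot>[s,s',c] f) = FMor M s s' f (\<theta> s' x')"
    using assms(1,2) unfolding chart_def natural_def representable_def by simp
qed

lemma chart_cases:
  assumes "chart c M \<theta>" "s \<in> S" "X \<in> carrier (FOb M s)"
  obtains x where "x \<in> hom s c" "X = \<theta> s x"
  using assms unfolding chart_def bij_betw_def by blast

lemma chart_zero:
  assumes "chart c M \<theta>" "s \<in> S" "c \<in> C" "M \<in> Obj H"
  shows "\<theta> s \<zero>[s,c] = \<zero>\<^bsub>FOb M s\<^esub>"
proof -
  have "\<theta> s \<in> module_hom k (Hom T s c) (FOb M s)"
    using assms(1,2) unfolding chart_def natural_def representable_def by simp
  then show ?thesis using module_hom_zero[OF module_Hom H_module] assms S_Obj C_Obj by blast
qed

lemma chart_eq_zero_iff: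
  assumes "chart c M \<theta>" "s \<in> S" "c \<in> C" "M \<in> Obj H" "x \<in> hom s c"
  shows "\<theta> s x = \<zero>\<^bsub>FOb M s\<^esub> \<longleftrightarrow> x = \<zero>[s,c]"
  using chart_zero[OF assms(1-4)] chartD(4)[OF assms(1,2,5), of "\<zero>[s,c]"] assms by auto

text \<open>The morphism of C lying over a transformation, read in charts. It is determined only up
  to morphisms that are \<open>null\<close>.\<close>

definition induces :: "'o \<Rightarrow> ('o \<Rightarrow> 'm \<Rightarrow> 'm set) \<Rightarrow> 'o \<Rightarrow> ('o \<Rightarrow> 'm \<Rightarrow> 'm set) \<Rightarrow>
    ('o \<Rightarrow> 'm set \<Rightarrow> 'm set) \<Rightarrow> 'm \<Rightarrow> bool" where
  "induces c \<theta> d \<psi> \<eta> w \<longleftrightarrow> (\<forall>s\<in>S. \<forall>x\<in>hom s c. \<eta> s (\<theta> s x) = \<psi> s (w \<cdot>[s,c,d] x))"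

lemma inducesD: "induces c \<theta> d \<psi> \<eta> w \<Longrightarrow> s \<in> S \<Longrightarrow> x \<in> hom s c \<Longrightarrow> \<eta> s (\<theta> s x) = \<psi> s (w \<cdot>[s,c,d] x)"
  unfolding induces_def by blast

lemma arr_FMor:
  assumes "\<eta> \<in> arr H M N" "a \<in> S" "b \<in> S" "f \<in> hom a b" "X \<in> carrier (FOb M b)"
  shows "\<eta> a (FMor M a b f X) = FMor N a b f (\<eta> b X)"
  using assms unfolding H_arr natural_def by auto

lemma arr_carrier:
  assumes "\<eta> \<in> arr H M N" "a \<in> S" "X \<in> carrier (FOb M a)" shows "\<eta> a X \<in> carrier (FOb N a)"
proof -
  have "\<eta> a \<in> module_hom k (FOb M a) (FOb N a)" using assms(1,2) unfolding H_arr natural_def by simp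
  then show ?thesis using assms(3) by (rule module_hom_closed)
qed

lemma arr_zero:
  assumes "\<eta> \<in> arr H M N" "a \<in> S" "M \<in> Obj H" "N \<in> Obj H"
  shows "\<eta> a \<zero>\<^bsub>FOb M a\<^esub> = \<zero>\<^bsub>FOb N a\<^esub>"
proof -
  have "\<eta> a \<in> module_hom k (FOb M a) (FOb N a)" using assms(1,2) unfolding H_arr natural_def by simp
  then show ?thesis using module_hom_zero[OF H_module H_module] assms by blast
qed

text \<open>Yoneda: \<open>\<eta>\<close> sends the generator \<open>p\<close> of \<open>M\<close>
  at \<open>a0\<close> to some \<open>y : a0 -> d\<close>. Naturality gives \<open>y f = 0\<close>
  because \<open>p f = 0\<close>, so \<open>y\<close> descends to the cone \<open>c\<close>.\<close>

lemma hom_lift: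
  assumes c: "c \<in> C" "chart c M \<theta>" "M \<in> Obj H" and d: "d \<in> C" "chart d N \<psi>" "N \<in> Obj H"
    and \<eta>: "\<eta> \<in> arr H M N"
  obtains w where "w \<in> hom c d" "induces c \<theta> d \<psi> \<eta> w"
proof -
  obtain a1 a0 f p h where a: "a1 \<in> S" "a0 \<in> S" "(a1, a0, c, f, p, h) \<in> Tri T" "f \<in> hom a1 a0"
    "p \<in> hom a0 c" "onto a0 c p" by (rule C_pres[OF c(1)])
  note o = S_Obj[OF a(1)] S_Obj[OF a(2)] C_Obj[OF c(1)] C_Obj[OF d(1)]
  have pc: "\<theta> a0 p \<in> carrier (FOb M a0)" using chartD(1)[OF c(2) a(2,5)] .
  have "\<eta> a0 (\<theta> a0 p) \<in> carrier (FOb N a0)" using arr_carrier[OF \<eta> a(2) pc] .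
  then obtain y where y: "y \<in> hom a0 d" "\<eta> a0 (\<theta> a0 p) = \<psi> a0 y" by (rule chart_cases[OF d(2) a(2)])
  have *: "\<psi> s (y \<cdot>[s,a0,d] x) = \<eta> s (\<theta> s (p \<cdot>[s,a0,c] x))" if "s \<in> S" "x \<in> hom s a0" for s x
    using chartD(5)[OF d(2) that(1) a(2) that(2) y(1)] chartD(5)[OF c(2) that(1) a(2) that(2) a(5)]
      arr_FMor[OF \<eta> that(1) a(2) that(2) pc] y(2) by simp
  have "\<psi> a1 (y \<cdot>[a1,a0,d] f) = \<zero>\<^bsub>FOb N a1\<^esub>"
    using *[OF a(1,4)] Tri_zero_1[OF a(3)] chart_zero[OF c(2) a(1) c(1,3)] arr_zero[OF \<eta> a(1) c(3) d(3)] by simp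
  then have "y \<cdot>[a1,a0,d] f = \<zero>[a1,d]"
    using chart_eq_zero_iff[OF d(2) a(1) d(1,3)] y(1) a(4) o by simp
  then obtain w where w: "w \<in> hom c d" "y = w \<cdot>[a0,c,d] p" by (rule weak_cokernel[OF a(3) o(4) y(1)])
  have "induces c \<theta> d \<psi> \<eta> w"
    unfolding induces_def
  proof (intro ballI)
    fix s x assume s: "s \<in> S" and x: "x \<in> hom s c"
    obtain x' where x': "x' \<in> hom s a0" "x = p \<cdot>[s,a0,c] x'" by (rule ontoE[OF a(6) s x])
    show "\<eta> s (\<theta> s x) = \<psi> s (w \<cdot>[s,c,d] x)"
      using *[OF s x'(1)] x' w a(5) o S_Obj[OF s] by (simp add: Cmp_assoc)
  qed
  with w(1) show ?thesis by (rule that)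
qed

lemma hom_of:
  assumes c: "c \<in> C" "chart c M \<theta>" "M \<in> Obj H" and d: "d \<in> C" "chart d N \<psi>" "N \<in> Obj H"
    and w: "w \<in> hom c d"
  obtains \<eta> where "\<eta> \<in> arr H M N" "induces c \<theta> d \<psi> \<eta> w"
proof -
  note o = C_Obj[OF c(1)] C_Obj[OF d(1)]
  define \<eta> where "\<eta> = (\<lambda>s\<in>S. \<lambda>X\<in>carrier (FOb M s). \<psi> s (w \<cdot>[s,c,d] inv_into (hom s c) (\<theta> s) X))"
  have inv: "inv_into (hom s c) (\<theta> s) (\<theta> s x) = x" if "s \<in> S" "x \<in> hom s c" for s x
    using c(2) that unfolding chart_def bij_betw_def by (simp add: inv_into_f_f)
  have \<eta>: "\<eta> s (\<theta> s x) = \<psi> s (w \<cdot>[s,c,d] x)" if "s \<in> S" "x \<in> hom s c" for s x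
    unfolding \<eta>_def using that inv chartD(1)[OF c(2)] by simp
  have wx: "w \<cdot>[s,c,d] x \<in> hom s d" if "s \<in> S" "x \<in> hom s c" for s x using that w o by simp
  have "\<eta> s \<in> module_hom k (FOb M s) (FOb N s)" if s: "s \<in> S" for s
    unfolding module_hom_def
  proof (intro CollectI conjI ballI Pi_I)
    note D = chartD[OF c(2) s] chartD[OF d(2) s]
    have sm: "r \<odot>\<^bsub>Hom T s c\<^esub> x \<in> hom s c" if "r \<in> carrier k" "x \<in> hom s c" for r x
      using module_Hom[of s c] module.smult_closed that s o by fastforce
    fix X assume "X \<in> carrier (FOb M s)"
    then obtain x where x: "x \<in> hom s c" "X = \<theta> s x" by (rule chart_cases[OF c(2) s])
    show "\<eta> s X \<in> carrier (FOb N s)" using x \<eta> s wx D by simp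
    { fix r assume r: "r \<in> carrier k"
      have "r \<odot>\<^bsub>FOb M s\<^esub> X = \<theta> s (r \<odot>\<^bsub>Hom T s c\<^esub> x)" using D(3)[OF r x(1)] x(2) by simp
      then show "\<eta> s (r \<odot>\<^bsub>FOb M s\<^esub> X) = r \<odot>\<^bsub>FOb N s\<^esub> \<eta> s X"
        using x \<eta> s wx sm r w o D(8)[of r] by (simp add: Cmp_smult_right) }
    fix Y assume "Y \<in> carrier (FOb M s)"
    then obtain y where y: "y \<in> hom s c" "Y = \<theta> s y" by (rule chart_cases[OF c(2) s])
    have "X \<oplus>\<^bsub>FOb M s\<^esub> Y = \<theta> s (x \<oplus>[s,c] y)" using D(2) x y by simp
    then show "\<eta> s (X \<oplus>\<^bsub>FOb M s\<^esub> Y) = \<eta> s X \<oplus>\<^bsub>FOb N s\<^esub> \<eta> s Y"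
      using x y \<eta> s wx w o D(7) by (simp add: bilin)
  qed
  moreover have "\<eta> a (FMor M a b f X) = FMor N a b f (\<eta> b X)"
    if s: "a \<in> S" "b \<in> S" and f: "f \<in> hom a b" and X: "X \<in> carrier (FOb M b)" for a b f X
  proof -
    obtain x where x: "x \<in> hom b c" "X = \<theta> b x" by (rule chart_cases[OF c(2) s(2) X])
    have xf: "x \<cdot>[a,b,c] f \<in> hom a c" using x f s o by simp
    have "FMor M a b f X = \<theta> a (x \<cdot>[a,b,c] f)" using chartD(5)[OF c(2) s f x(1)] x(2) by simp
    then show ?thesis
      using \<eta>[OF s(1) xf] \<eta>[OF s(2) x(1)] x chartD(5)[OF d(2) s f wx[OF s(2) x(1)]] w f s o
      by (simp add: Cmp_assoc)
  qed
  ultimately have "natural k R M N \<eta>" unfolding natural_def by simp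
  moreover have "\<eta> \<in> (\<Pi>\<^sub>E s\<in>S. extensional (carrier (FOb M s)))" unfolding \<eta>_def by auto
  ultimately have "\<eta> \<in> arr H M N" unfolding H_arr by blast
  then show ?thesis using that \<eta> unfolding induces_def by blast
qed

lemma hom_eqI:
  assumes "chart c M \<theta>" "\<eta> \<in> arr H M N" "\<eta>' \<in> arr H M N"
    "\<And>s x. s \<in> S \<Longrightarrow> x \<in> hom s c \<Longrightarrow> \<eta> s (\<theta> s x) = \<eta>' s (\<theta> s x)"
  shows "\<eta> = \<eta>'"
  by (rule H_eqI[OF assms(2,3)]) (metis chart_cases[OF assms(1)] assms(4))

text \<open>The functor \<open>T(-, c)\<close> on S, with elements wrapped into singletons to fit the value type of
  \<^const>\<open>mod_cat\<close>.\<close>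

definition Hob :: "'o \<Rightarrow> ('o, 'm, 'k, 'm set) modfunctor" where
  "Hob c = \<lparr>FOb = (\<lambda>a. \<lparr>carrier = (\<lambda>x. {x}) ` hom a c, mult = undefined, one = undefined,
      zero = {\<zero>[a,c]}, add = (\<lambda>X Y. {the_elem X \<oplus>[a,c] the_elem Y}),
      smult = (\<lambda>r X. {r \<odot>\<^bsub>Hom T a c\<^esub> the_elem X})\<rparr>),
    FMor = (\<lambda>a b f X. {the_elem X \<cdot>[a,b,c] f})\<rparr>"

lemma Hob_simps [simp]:
  "carrier (FOb (Hob c) a) = (\<lambda>x. {x}) ` hom a c" "\<zero>\<^bsub>FOb (Hob c) a\<^esub> = {\<zero>[a,c]}"
  "{x} \<oplus>\<^bsub>FOb (Hob c) a\<^esub> {y} = {x \<oplus>[a,c] y}" "r \<odot>\<^bsub>FOb (Hob c) a\<^esub> {x} = {r \<odot>\<^bsub>Hom T a c\<^esub> x}"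
  "FMor (Hob c) a b f {x} = {x \<cdot>[a,b,c] f}"
  by (simp_all add: Hob_def)

lemma Hob_module:
  assumes "a \<in> Obj T" "c \<in> Obj T" shows "module k (FOb (Hob c) a)"
proof -
  interpret M: module k "Hom T a c" using module_Hom assms by blast
  show ?thesis
  proof (rule moduleI)
    show "cring k" by (rule cring_axioms)
    show "abelian_group (FOb (Hob c) a)"
    proof (rule abelian_groupI)
      fix x assume "x \<in> carrier (FOb (Hob c) a)"
      then obtain y where y: "y \<in> hom a c" "x = {y}" by auto
      then have "{neg a c y} \<in> carrier (FOb (Hob c) a)" "{neg a c y} \<oplus>\<^bsub>FOb (Hob c) a\<^esub> x = \<zero>\<^bsub>FOb (Hob c) a\<^esub>"
        by (auto simp: M.l_neg)
      then show "\<exists>z\<in>carrier (FOb (Hob c) a). z \<oplus>\<^bsub>FOb (Hob c) a\<^esub> x = \<zero>\<^bsub>FOb (Hob c) a\<^esub>" by blast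
    qed (auto simp: M.a_assoc M.a_comm M.a_lcomm)
  qed (auto simp: M.smult_l_distr M.smult_r_distr M.smult_assoc1)
qed

lemma module_hom_Cmp_left:
  assumes "a \<in> Obj T" "b \<in> Obj T" "c \<in> Obj T" "f \<in> hom b c"
  shows "(\<lambda>x. f \<cdot>[a,b,c] x) \<in> module_hom k (Hom T a b) (Hom T a c)"
  using assms unfolding module_hom_def by (auto simp: bilin Cmp_smult_right)

lemma chart_Hob: "c \<in> Obj T \<Longrightarrow> chart c (Hob c) (\<lambda>a x. {x})"
  unfolding chart_def natural_def representable_def module_hom_def by (auto simp: bij_betw_def inj_on_def)

lemma Hob_Obj:
  assumes c: "c \<in> C" shows "Hob c \<in> Obj H"
  unfolding H_Obj
proof
  have o: "c \<in> Obj T" using c by simp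
  show "contravariant_additive k R (Hob c)"
    unfolding contravariant_additive_def module_hom_def
    using o by (auto simp: Hob_module bilin Cmp_smult_left Cmp_assoc)
  obtain a1 a0 f p h where a: "a1 \<in> S" "a0 \<in> S" "(a1, a0, c, f, p, h) \<in> Tri T" "f \<in> hom a1 a0"
    "p \<in> hom a0 c" "onto a0 c p" by (rule C_pres[OF c])
  note ao = S_Obj[OF a(1)] S_Obj[OF a(2)]
  show "finitely_presented k R (Hob c)"
    unfolding finitely_presented_def
  proof (intro bexI exI conjI ballI)
    show "natural k R (representable R a1) (representable R a0) (\<lambda>a x. f \<cdot>[a,a1,a0] x)"
      unfolding natural_def representable_def using a(4) ao by (auto simp: module_hom_Cmp_left Cmp_assoc)
    show "natural k R (representable R a0) (Hob c) (\<lambda>a x. {p \<cdot>[a,a0,c] x})"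
      unfolding natural_def representable_def module_hom_def using a(5) ao o
      by (auto simp: bilin Cmp_smult_right Cmp_assoc)
    fix s assume "s \<in> Obj R"
    then have s: "s \<in> S" by simp
    show "(\<lambda>x. {p \<cdot>[s,a0,c] x}) ` arr R s a0 = carrier (FOb (Hob c) s)"
      using a(5,6) s ao o by (auto elim!: ontoE)
    show "(\<lambda>x. f \<cdot>[s,a1,a0] x) ` arr R s a1 = {x \<in> arr R s a0. {p \<cdot>[s,a0,c] x} = \<zero>\<^bsub>FOb (Hob c) s\<^esub>}"
      using pexact_Tri[OF a(3)] s a(4) ao unfolding pexact_def by auto
  qed (use a in auto)
qed

text \<open>By Yoneda the presentation is composition with a morphism
  \<open>f = \<alpha> s (idm s)\<close> of S. Its cone \<open>c\<close> is in C, and the S-points of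
  \<open>c\<close> are the cokernel of composition with \<open>f\<close> because
  \<open>T(S, Sh s) = 0\<close>.\<close>

lemma chart_ex:
  assumes M: "M \<in> Obj H"
  obtains c \<theta> where "c \<in> C" "chart c M \<theta>"
proof -
  obtain s s' \<alpha> \<pi> where s: "s \<in> S" "s' \<in> S" and nat: "natural k R (representable R s) (representable R s') \<alpha>"
    "natural k R (representable R s') M \<pi>" and
    im: "\<And>a. a \<in> S \<Longrightarrow> \<pi> a ` hom a s' = carrier (FOb M a)" and
    ker: "\<And>a. a \<in> S \<Longrightarrow> \<alpha> a ` hom a s = {x \<in> hom a s'. \<pi> a x = \<zero>\<^bsub>FOb M a\<^esub>}"
    using M unfolding H_Obj finitely_presented_def by auto
  note o = S_Obj[OF s(1)] S_Obj[OF s(2)]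
  define f where "f = \<alpha> s (idm s)"
  have "\<alpha> s \<in> module_hom k (Hom T s s) (Hom T s s')"
    using nat(1) s(1) unfolding natural_def representable_def by simp
  then have f: "f \<in> hom s s'" unfolding f_def by (rule module_hom_closed) (use o in simp)
  have \<alpha>: "\<alpha> a x = f \<cdot>[a,s,s'] x" if "a \<in> S" "x \<in> hom a s" for a x
  proof -
    have N: "\<forall>a\<in>S. \<forall>b\<in>S. \<forall>u\<in>hom a b. \<forall>x\<in>hom b s. \<alpha> a (x \<cdot>[a,b,s] u) = \<alpha> b x \<cdot>[a,b,s'] u"
      using nat(1) unfolding natural_def representable_def by simp
    have "\<alpha> a (idm s \<cdot>[a,s,s] x) = \<alpha> s (idm s) \<cdot>[a,s,s'] x"
      by (rule N[rule_format, OF that(1) s(1) that(2)]) (use o in simp)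
    then show ?thesis using that o unfolding f_def by simp
  qed
  obtain c g h where t: "(s, s', c, f, g, h) \<in> Tri T" using Tri_cone o f by blast
  have cC: "c \<in> C" using C_triI[OF triI[OF t] s] .
  note o' = Tri_arr[OF t]
  have on: "onto s' c g" using onto_Tri[OF t] van_S s by blast
  have add: "\<pi> a (x \<oplus>[a,s'] y) = \<pi> a x \<oplus>\<^bsub>FOb M a\<^esub> \<pi> a y" if "a \<in> S" "x \<in> hom a s'" "y \<in> hom a s'" for a x y
    using nat(2) that unfolding natural_def representable_def module_hom_def by auto
  have sm: "\<pi> a (r \<odot>\<^bsub>Hom T a s'\<^esub> x) = r \<odot>\<^bsub>FOb M a\<^esub> \<pi> a x" if "a \<in> S" "x \<in> hom a s'" "r \<in> carrier k" for a x r
    using nat(2) that unfolding natural_def representable_def module_hom_def by auto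
  have nt: "\<pi> a (x \<cdot>[a,b,s'] u) = FMor M a b u (\<pi> b x)" if "a \<in> S" "b \<in> S" "u \<in> hom a b" "x \<in> hom b s'" for a b u x
    using nat(2) that unfolding natural_def representable_def by auto
  have \<pi>c: "\<pi> a x \<in> carrier (FOb M a)" if "a \<in> S" "x \<in> hom a s'" for a x using im that by blast
  have ker': "\<pi> a x = \<zero>\<^bsub>FOb M a\<^esub> \<longleftrightarrow> g \<cdot>[a,s',c] x = \<zero>[a,c]" if a: "a \<in> S" and x: "x \<in> hom a s'" for a x
  proof -
    have "\<pi> a x = \<zero>\<^bsub>FOb M a\<^esub> \<longleftrightarrow> x \<in> \<alpha> a ` hom a s" using ker a x by auto
    also have "\<dots> \<longleftrightarrow> (\<exists>z\<in>hom a s. x = f \<cdot>[a,s,s'] z)" using \<alpha> a by (auto simp: image_iff)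
    also have "\<dots> \<longleftrightarrow> g \<cdot>[a,s',c] x = \<zero>[a,c]" using pexact_Tri[OF t] a x unfolding pexact_def by auto
    finally show ?thesis .
  qed
  \<comment> \<open>Two surjections out of the S-points of \<open>s'\<close> with the same kernel
    have the same fibres; this makes the choice of a preimage in \<open>\<theta>\<close>
    irrelevant.\<close>
  have well: "\<pi> a x = \<pi> a y \<longleftrightarrow> g \<cdot>[a,s',c] x = g \<cdot>[a,s',c] y" if a: "a \<in> S" and x: "x \<in> hom a s'" "y \<in> hom a s'" for a x y
  proof -
    interpret A: module k "FOb M a" using H_module M a by blast
    let ?d = "x \<ominus>[a,s'] y"
    have d: "?d \<in> hom a s'" using a x o by simp
    have "\<pi> a x = \<pi> a ?d \<oplus>\<^bsub>FOb M a\<^esub> \<pi> a y" using add[OF a d x(2)] a x o by simp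
    then have "\<pi> a x = \<pi> a y \<longleftrightarrow> \<pi> a ?d = \<zero>\<^bsub>FOb M a\<^esub>"
      using \<pi>c[OF a d] \<pi>c[OF a x(2)] by (metis A.add.l_cancel_one A.add.m_comm A.l_zero)
    also have "\<dots> \<longleftrightarrow> g \<cdot>[a,s',c] ?d = \<zero>[a,c]" by (rule ker'[OF a d])
    also have "\<dots> \<longleftrightarrow> g \<cdot>[a,s',c] x = g \<cdot>[a,s',c] y"
      using a x o o' by (simp add: bilin)
    finally show ?thesis .
  qed
  define \<theta> where "\<theta> a y = \<pi> a (SOME x. x \<in> hom a s' \<and> y = g \<cdot>[a,s',c] x)" for a y
  have \<theta>: "\<theta> a (g \<cdot>[a,s',c] x) = \<pi> a x" if a: "a \<in> S" and x: "x \<in> hom a s'" for a x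
  proof -
    let ?P = "\<lambda>z. z \<in> hom a s' \<and> g \<cdot>[a,s',c] x = g \<cdot>[a,s',c] z"
    have z: "?P (SOME z. ?P z)" by (rule someI[of ?P x]) (use x in simp)
    have "\<pi> a x = \<pi> a (SOME z. ?P z)" using well[OF a x z[THEN conjunct1]] z by blast
    then show ?thesis unfolding \<theta>_def by (rule sym)
  qed
  have "chart c M \<theta>"
    unfolding chart_def natural_def
  proof (intro conjI ballI)
    have ex: "\<exists>x\<in>hom a s'. y = g \<cdot>[a,s',c] x" if "a \<in> S" "y \<in> hom a c" for a y
      using on that unfolding onto_def by blast
    fix a assume "a \<in> Obj R" then have a: "a \<in> S" by simp
    note ao = S_Obj[OF a]
    show "\<theta> a \<in> module_hom k (FOb (representable T c) a) (FOb M a)"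
      unfolding module_hom_def representable_def modfunctor.simps
    proof (intro CollectI conjI ballI Pi_I)
      fix y assume "y \<in> hom a c"
      then obtain x where x: "x \<in> hom a s'" "y = g \<cdot>[a,s',c] x" using ex a by blast
      show "\<theta> a y \<in> carrier (FOb M a)" using \<theta> \<pi>c a x by simp
      { fix r assume r: "r \<in> carrier k"
        have "r \<odot>\<^bsub>Hom T a s'\<^esub> x \<in> hom a s'" using module_Hom[OF ao o(2)] module.smult_closed r x by fastforce
        then show "\<theta> a (r \<odot>\<^bsub>Hom T a c\<^esub> y) = r \<odot>\<^bsub>FOb M a\<^esub> \<theta> a y"
          using \<theta>[OF a, of "r \<odot>\<^bsub>Hom T a s'\<^esub> x"] \<theta>[OF a x(1)] sm[OF a x(1) r] r x o o' ao
          by (simp add: Cmp_smult_right) }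
      fix y' assume "y' \<in> hom a c"
      then obtain x' where x': "x' \<in> hom a s'" "y' = g \<cdot>[a,s',c] x'" using ex a by blast
      show "\<theta> a (y \<oplus>\<^bsub>Hom T a c\<^esub> y') = \<theta> a y \<oplus>\<^bsub>FOb M a\<^esub> \<theta> a y'"
        using \<theta>[OF a, of "x \<oplus>[a,s'] x'"] \<theta>[OF a x(1)] \<theta>[OF a x'(1)] add[OF a x(1) x'(1)] x x' o o' ao
        by (simp add: bilin)
    qed
    fix b u y assume "b \<in> Obj R" "u \<in> carrier (Hom R a b)" "y \<in> carrier (FOb (representable T c) b)"
    then have b: "b \<in> S" and u: "u \<in> hom a b" and y: "y \<in> hom b c" by (simp_all add: representable_def)
    obtain x where x: "x \<in> hom b s'" "y = g \<cdot>[b,s',c] x" using ex b y by blast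
    have "\<theta> a (y \<cdot>[a,b,c] u) = \<theta> a (g \<cdot>[a,s',c] (x \<cdot>[a,b,s'] u))"
      using x u o o' ao S_Obj[OF b] by (simp add: Cmp_assoc)
    also have "\<dots> = \<pi> a (x \<cdot>[a,b,s'] u)" by (rule \<theta>[OF a]) (use x u o o' ao S_Obj[OF b] in simp)
    also have "\<dots> = FMor M a b u (\<theta> b y)" using nt[OF a b u x(1)] \<theta>[OF b x(1)] x(2) by simp
    finally show "\<theta> a (FMor (representable T c) a b u y) = FMor M a b u (\<theta> b y)"
      by (simp add: representable_def)
  next
    fix a assume a: "a \<in> S"
    show "bij_betw (\<theta> a) (hom a c) (carrier (FOb M a))"
      unfolding bij_betw_def
    proof
      show "inj_on (\<theta> a) (hom a c)"
      proof (rule inj_onI)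
        fix y y' assume yy: "y \<in> hom a c" "y' \<in> hom a c" "\<theta> a y = \<theta> a y'"
        obtain x where x: "x \<in> hom a s'" "y = g \<cdot>[a,s',c] x" by (rule ontoE[OF on a yy(1)])
        obtain x' where x': "x' \<in> hom a s'" "y' = g \<cdot>[a,s',c] x'" by (rule ontoE[OF on a yy(2)])
        show "y = y'" using yy(3) \<theta>[OF a x(1)] \<theta>[OF a x'(1)] well[OF a x(1) x'(1)] x(2) x'(2) by simp
      qed
      show "\<theta> a ` hom a c = carrier (FOb M a)"
      proof
        show "\<theta> a ` hom a c \<subseteq> carrier (FOb M a)"
          using on a \<theta> \<pi>c unfolding onto_def by force
        show "carrier (FOb M a) \<subseteq> \<theta> a ` hom a c"
        proof
          fix X assume "X \<in> carrier (FOb M a)"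
          then obtain x where x: "x \<in> hom a s'" "X = \<pi> a x" using im[OF a] by blast
          then have "X = \<theta> a (g \<cdot>[a,s',c] x)" using \<theta>[OF a x(1)] by simp
          then show "X \<in> \<theta> a ` hom a c" using x o o' S_Obj[OF a] by auto
        qed
      qed
    qed
  qed
  with cC show ?thesis by (rule that)
qed

text \<open>Turns the Hom-orthogonality in torsion pairs into a condition in C. Each direction needs
  one of the two lifting lemmas, \<open>hom_of\<close> and \<open>hom_lift\<close>.\<close>

lemma hom_zero_iff:
  assumes c: "c \<in> C" "chart c M \<theta>" "M \<in> Obj H" and d: "d \<in> C" "chart d N \<psi>" "N \<in> Obj H"
    and lc: "linear_category k H"
  shows "arr H M N = {\<zero>\<^bsub>Hom H M N\<^esub>} \<longleftrightarrow> (\<forall>w\<in>hom c d. null c d w)"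
proof
  interpret L: linear_category k H by (rule lc)
  note o = C_Obj[OF c(1)] C_Obj[OF d(1)]
  show "\<forall>w\<in>hom c d. null c d w" if z: "arr H M N = {\<zero>\<^bsub>Hom H M N\<^esub>}"
  proof
    fix w assume w: "w \<in> hom c d"
    obtain \<eta> where \<eta>: "\<eta> \<in> arr H M N" "induces c \<theta> d \<psi> \<eta> w" by (rule hom_of[OF c d w])
    then have \<eta>z: "\<eta> = \<zero>\<^bsub>Hom H M N\<^esub>" using z by blast
    show "null c d w"
      unfolding null_def
    proof (intro ballI)
      fix s x assume s: "s \<in> S" and x: "x \<in> hom s c"
      have "\<psi> s (w \<cdot>[s,c,d] x) = \<zero>\<^bsub>FOb N s\<^esub>"
        using inducesD[OF \<eta>(2) s x] \<eta>z chartD(1)[OF c(2) s x] s by simp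
      then show "w \<cdot>[s,c,d] x = \<zero>[s,d]" using chart_eq_zero_iff[OF d(2) s d(1,3)] w x s o by simp
    qed
  qed
  assume n: "\<forall>w\<in>hom c d. null c d w"
  have "\<eta> = \<zero>\<^bsub>Hom H M N\<^esub>" if \<eta>: "\<eta> \<in> arr H M N" for \<eta>
  proof -
    obtain w where w: "w \<in> hom c d" "induces c \<theta> d \<psi> \<eta> w" by (rule hom_lift[OF c d \<eta>])
    show ?thesis
    proof (rule hom_eqI[OF c(2) \<eta> L.zer_arr[OF c(3) d(3)]])
      fix s x assume s: "s \<in> S" and x: "x \<in> hom s c"
      show "\<eta> s (\<theta> s x) = \<zero>\<^bsub>Hom H M N\<^esub> s (\<theta> s x)"
        using inducesD[OF w(2) s x] nullD[OF n[rule_format, OF w(1)] s x] chart_zero[OF d(2) s d(1,3)]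
          chartD(1)[OF c(2) s x] s by simp
    qed
  qed
  then show "arr H M N = {\<zero>\<^bsub>Hom H M N\<^esub>}" using L.zer_arr[OF c(3) d(3)] by blast
qed

text \<open>A test object is charted and the test morphism lifted to C. There
  \<open>factor_pinj\<close> and \<open>factor_coker\<close> supply the factorizations, and
  uniqueness holds since \<open>j\<close> is injective and \<open>w\<close> surjective on
  S-points.\<close>

lemma short_exact_chart:
  assumes e: "e \<in> C" "chart e M \<theta>" "M \<in> Obj H" and c: "c \<in> C" "chart c N \<psi>" "N \<in> Obj H"
    and d: "d \<in> C" "chart d K \<phi>" "K \<in> Obj H" and lc: "linear_category k H"
    and j: "j \<in> hom e c" "pinj e c j" and w: "w \<in> hom c d" "onto c d w" and ex: "pexact e c d j w"
    and \<eta>: "\<eta> \<in> arr H M N" "induces e \<theta> c \<psi> \<eta> j" and \<zeta>: "\<zeta> \<in> arr H N K" "induces c \<psi> d \<phi> \<zeta> w"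
  shows "short_exact H M N K \<eta> \<zeta>"
proof -
  interpret L: linear_category k H by (rule lc)
  note o = C_Obj[OF e(1)] C_Obj[OF c(1)] C_Obj[OF d(1)]
  have jz: "j \<cdot>[s,e,c] z \<in> hom s c" if "s \<in> S" "z \<in> hom s e" for s z using j that o by simp
  have wz: "w \<cdot>[s,c,d] z \<in> hom s d" if "s \<in> S" "z \<in> hom s c" for s z using w that o by simp
  have comp: "Cmp H M N K \<zeta> \<eta> = \<zero>\<^bsub>Hom H M K\<^esub>"
  proof (rule hom_eqI[OF e(2)])
    show "Cmp H M N K \<zeta> \<eta> \<in> arr H M K" "\<zero>\<^bsub>Hom H M K\<^esub> \<in> arr H M K" using \<eta> \<zeta> e c d by auto
    fix s x assume s: "s \<in> S" and x: "x \<in> hom s e"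
    have "\<zeta> s (\<eta> s (\<theta> s x)) = \<phi> s (w \<cdot>[s,c,d] (j \<cdot>[s,e,c] x))"
      using inducesD[OF \<eta>(2) s x] inducesD[OF \<zeta>(2) s jz[OF s x]] by simp
    also have "\<dots> = \<zero>\<^bsub>FOb K s\<^esub>"
      using pexactD[OF ex s x e(1) c(1) j(1)] chart_zero[OF d(2) s d(1,3)] by simp
    finally show "Cmp H M N K \<zeta> \<eta> s (\<theta> s x) = \<zero>\<^bsub>Hom H M K\<^esub> s (\<theta> s x)"
      using chartD(1)[OF e(2) s x] s by simp
  qed
  have inj: "x = y" if "s \<in> S" "x \<in> hom s e" "y \<in> hom s e" "j \<cdot>[s,e,c] x = j \<cdot>[s,e,c] y" for s x y
  proof -
    have "j \<cdot>[s,e,c] (x \<ominus>[s,e] y) = \<zero>[s,c]" using that j(1) o by (simp add: bilin)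
    then have "x \<ominus>[s,e] y = \<zero>[s,e]" using pinjD[OF j(2) that(1)] that o by simp
    then show ?thesis using that o by simp
  qed
  have ker: "\<exists>!v. v \<in> arr H X M \<and> Cmp H X M N \<eta> v = u"
    if X: "X \<in> Obj H" and u: "u \<in> arr H X N" and z: "Cmp H X N K \<zeta> u = \<zero>\<^bsub>Hom H X K\<^esub>" for X u
  proof -
    obtain x \<xi> where x: "x \<in> C" "chart x X \<xi>" by (rule chart_ex[OF X])
    obtain b where b: "b \<in> hom x c" "induces x \<xi> c \<psi> u b" by (rule hom_lift[OF x X c u])
    note xo = C_Obj[OF x(1)]
    have bty: "b \<cdot>[s,x,c] y \<in> hom s c" if "s \<in> S" "y \<in> hom s x" for s y using b that xo o by simp
    have "\<exists>z\<in>hom s e. b \<cdot>[s,x,c] y = j \<cdot>[s,e,c] z" if s: "s \<in> S" and y: "y \<in> hom s x" for s y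
    proof -
      have "\<zeta> s (u s (\<xi> s y)) = \<zero>\<^bsub>FOb K s\<^esub>"
        using fun_cong[OF fun_cong[OF z], of s "\<xi> s y"] s chartD(1)[OF x(2) s y] by simp
      then have "\<phi> s (w \<cdot>[s,c,d] (b \<cdot>[s,x,c] y)) = \<zero>\<^bsub>FOb K s\<^esub>"
        using inducesD[OF b(2) s y] inducesD[OF \<zeta>(2) s bty[OF s y]] by simp
      then have "w \<cdot>[s,c,d] (b \<cdot>[s,x,c] y) = \<zero>[s,d]"
        using chart_eq_zero_iff[OF d(2) s d(1,3) wz[OF s bty[OF s y]]] by simp
      then show ?thesis using pexactE[OF ex s bty[OF s y]] by blast
    qed
    then obtain g where g: "g \<in> hom x e" "\<And>s y. s \<in> S \<Longrightarrow> y \<in> hom s x \<Longrightarrow> b \<cdot>[s,x,c] y = j \<cdot>[s,e,c] (g \<cdot>[s,x,e] y)"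
      using factor_pinj[OF x(1) e(1) c(1) b(1) j] by metis
    obtain v where v: "v \<in> arr H X M" "induces x \<xi> e \<theta> v g" by (rule hom_of[OF x X e g(1)])
    have "Cmp H X M N \<eta> v = u"
    proof (rule hom_eqI[OF x(2)])
      show "Cmp H X M N \<eta> v \<in> arr H X N" "u \<in> arr H X N" using \<eta> v u X e c by auto
      fix s y assume s: "s \<in> S" and y: "y \<in> hom s x"
      have gy: "g \<cdot>[s,x,e] y \<in> hom s e" using g(1) y s xo o by simp
      show "Cmp H X M N \<eta> v s (\<xi> s y) = u s (\<xi> s y)"
        using inducesD[OF v(2) s y] inducesD[OF \<eta>(2) s gy] inducesD[OF b(2) s y] g(2)[OF s y]
          chartD(1)[OF x(2) s y] s by simp
    qed
    moreover have "v' = v" if v': "v' \<in> arr H X M" "Cmp H X M N \<eta> v' = u" for v'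
    proof (rule hom_eqI[OF x(2) v'(1) v(1)])
      fix s y assume s: "s \<in> S" and y: "y \<in> hom s x"
      note yc = chartD(1)[OF x(2) s y]
      obtain z where z: "z \<in> hom s e" "v s (\<xi> s y) = \<theta> s z"
        by (rule chart_cases[OF e(2) s arr_carrier[OF v(1) s yc]])
      obtain z' where z': "z' \<in> hom s e" "v' s (\<xi> s y) = \<theta> s z'"
        by (rule chart_cases[OF e(2) s arr_carrier[OF v'(1) s yc]])
      have "\<eta> s (v' s (\<xi> s y)) = \<eta> s (v s (\<xi> s y))"
        using fun_cong[OF fun_cong[OF v'(2)], of s "\<xi> s y"] fun_cong[OF fun_cong[OF calculation], of s "\<xi> s y"] s yc by simp
      then have "\<psi> s (j \<cdot>[s,e,c] z') = \<psi> s (j \<cdot>[s,e,c] z)"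
        using inducesD[OF \<eta>(2) s] z z' by simp
      then have "j \<cdot>[s,e,c] z' = j \<cdot>[s,e,c] z" using chartD(4)[OF c(2) s jz[OF s z'(1)] jz[OF s z(1)]] by simp
      then show "v' s (\<xi> s y) = v s (\<xi> s y)" using inj[OF s z'(1) z(1)] z z' by simp
    qed
    ultimately show ?thesis using v(1) by blast
  qed
  have coker: "\<exists>!v. v \<in> arr H K X \<and> Cmp H N K X v \<zeta> = u"
    if X: "X \<in> Obj H" and u: "u \<in> arr H N X" and z: "Cmp H M N X u \<eta> = \<zero>\<^bsub>Hom H M X\<^esub>" for X u
  proof -
    obtain x \<xi> where x: "x \<in> C" "chart x X \<xi>" by (rule chart_ex[OF X])
    obtain b where b: "b \<in> hom c x" "induces c \<psi> x \<xi> u b" by (rule hom_lift[OF c x X u])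
    note xo = C_Obj[OF x(1)]
    have "b \<cdot>[s,c,x] (j \<cdot>[s,e,c] y) = \<zero>[s,x]" if s: "s \<in> S" and y: "y \<in> hom s e" for s y
    proof -
      have "u s (\<eta> s (\<theta> s y)) = \<zero>\<^bsub>FOb X s\<^esub>"
        using fun_cong[OF fun_cong[OF z], of s "\<theta> s y"] s chartD(1)[OF e(2) s y] by simp
      then have "\<xi> s (b \<cdot>[s,c,x] (j \<cdot>[s,e,c] y)) = \<zero>\<^bsub>FOb X s\<^esub>"
        using inducesD[OF \<eta>(2) s y] inducesD[OF b(2) s jz[OF s y]] by simp
      then show ?thesis using chart_eq_zero_iff[OF x(2) s x(1) X] b(1) jz[OF s y] s xo o by simp
    qed
    then obtain g where g: "g \<in> hom d x" "\<And>s y. s \<in> S \<Longrightarrow> y \<in> hom s c \<Longrightarrow> b \<cdot>[s,c,x] y = g \<cdot>[s,d,x] (w \<cdot>[s,c,d] y)"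
      using factor_coker[OF e(1) c(1) d(1) x(1) j(1) w ex b(1)] by metis
    obtain v where v: "v \<in> arr H K X" "induces d \<phi> x \<xi> v g" by (rule hom_of[OF d x X g(1)])
    have vu: "Cmp H N K X v \<zeta> = u"
    proof (rule hom_eqI[OF c(2)])
      show "Cmp H N K X v \<zeta> \<in> arr H N X" "u \<in> arr H N X" using \<zeta> v u X c d by auto
      fix s y assume s: "s \<in> S" and y: "y \<in> hom s c"
      show "Cmp H N K X v \<zeta> s (\<psi> s y) = u s (\<psi> s y)"
        using inducesD[OF v(2) s wz[OF s y]] inducesD[OF \<zeta>(2) s y] inducesD[OF b(2) s y] g(2)[OF s y]
          chartD(1)[OF c(2) s y] s by simp
    qed
    moreover have "v' = v" if v': "v' \<in> arr H K X" "Cmp H N K X v' \<zeta> = u" for v'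
    proof (rule hom_eqI[OF d(2) v'(1) v(1)])
      fix s y assume s: "s \<in> S" and y: "y \<in> hom s d"
      obtain y' where y': "y' \<in> hom s c" "y = w \<cdot>[s,c,d] y'" by (rule ontoE[OF w(2) s y])
      note yc = chartD(1)[OF c(2) s y'(1)]
      have "v' s (\<zeta> s (\<psi> s y')) = v s (\<zeta> s (\<psi> s y'))"
        using fun_cong[OF fun_cong[OF v'(2)], of s "\<psi> s y'"] fun_cong[OF fun_cong[OF vu], of s "\<psi> s y'"] s yc by simp
      then show "v' s (\<phi> s y) = v s (\<phi> s y)" using inducesD[OF \<zeta>(2) s y'(1)] y'(2) by simp
    qed
    ultimately show ?thesis using v(1) by blast
  qed
  show ?thesis
    unfolding short_exact_def is_kernel_def is_cokernel_def using \<eta>(1) \<zeta>(1) comp ker coker by blast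
qed

end

section \<open>From cotorsion pairs to torsion pairs\<close>

locale noetherian_presilting = presilting_category k T S
  for k :: "'k ring" and T :: "('o, 'm, 'k, 'z) tricat_scheme" and S :: "'o set" +
  assumes noeth: "noetherian_category k (mod_cat k (full_sub T S))"
begin

lemma H_abelian: "abelian_category k H"
  using noeth noetherian_category_def by blast

lemma H_linear: "linear_category k H"
  using H_abelian abelian_category_def additive_category_def by blast

lemma H_Cmp_arr: "\<lbrakk>M \<in> Obj H; N \<in> Obj H; K \<in> Obj H; f \<in> arr H M N; g \<in> arr H N K\<rbrakk> \<Longrightarrow> Cmp H M N K g f \<in> arr H M K"
  using linear_category.Cmp_arr[OF H_linear] by blast

lemma H_zero_arr: "\<lbrakk>M \<in> Obj H; N \<in> Obj H\<rbrakk> \<Longrightarrow> \<zero>\<^bsub>Hom H M N\<^esub> \<in> arr H M N"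
  using linear_category.zer_arr[OF H_linear] by blast

section \<open>Kernels and ascending chains on S-points\<close>

lemma pinj_eq:
  assumes "pinj c d w" "s \<in> S" "x \<in> hom s c" "y \<in> hom s c" "w \<cdot>[s,c,d] x = w \<cdot>[s,c,d] y"
    "c \<in> C" "d \<in> C" "w \<in> hom c d"
  shows "x = y"
proof -
  note o = S_Obj[OF assms(2)] C_Obj[OF assms(6)] C_Obj[OF assms(7)]
  have "w \<cdot>[s,c,d] (x \<ominus>[s,c] y) = \<zero>[s,d]" using assms o by (simp add: bilin)
  then have "x \<ominus>[s,c] y = \<zero>[s,c]" using pinjD[OF assms(1,2)] assms o by simp
  then show ?thesis using assms o by simp
qed

text \<open>Cones yield cokernels within C; the kernel is instead taken in the abelian category
  \<open>H\<close> and then charted. Injectivity and exactness are tested on the functors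
  \<open>Hob s\<close>, whose transformations into a functor are its elements at
  \<open>s\<close>.\<close>

lemma kernel_ex:
  assumes C: "c \<in> C" "d \<in> C" and w: "w \<in> hom c d"
  obtains e j where "e \<in> C" "j \<in> hom e c" "pinj e c j" "pexact e c d j w"
proof -
  let ?i = "\<lambda>a x. {x}"
  note o = C_Obj[OF C(1)] C_Obj[OF C(2)]
  note c = C(1) chart_Hob[OF o(1)] Hob_Obj[OF C(1)] and d = C(2) chart_Hob[OF o(2)] Hob_Obj[OF C(2)]
  obtain \<eta> where \<eta>: "\<eta> \<in> arr H (Hob c) (Hob d)" "induces c ?i d ?i \<eta> w" by (rule hom_of[OF c d w])
  obtain M \<phi> where M: "M \<in> Obj H" and ker: "is_kernel H M (Hob c) (Hob d) \<phi> \<eta>"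
    using abelian_category.kernel_exists[OF H_abelian c(3) d(3) \<eta>(1)] by blast
  then have \<phi>: "\<phi> \<in> arr H M (Hob c)" "Cmp H M (Hob c) (Hob d) \<eta> \<phi> = \<zero>\<^bsub>Hom H M (Hob d)\<^esub>" and
    univ: "\<And>X u. \<lbrakk>X \<in> Obj H; u \<in> arr H X (Hob c); Cmp H X (Hob c) (Hob d) \<eta> u = \<zero>\<^bsub>Hom H X (Hob d)\<^esub>\<rbrakk> \<Longrightarrow>
      \<exists>!v. v \<in> arr H X M \<and> Cmp H X M (Hob c) \<phi> v = u"
    unfolding is_kernel_def by blast+
  obtain e \<theta> where e: "e \<in> C" "chart e M \<theta>" by (rule chart_ex[OF M])
  note eo = C_Obj[OF e(1)]
  obtain j where j: "j \<in> hom e c" "induces e \<theta> c ?i \<phi> j" by (rule hom_lift[OF e M c \<phi>(1)])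
  have ji: "\<phi> s (\<theta> s z) = {j \<cdot>[s,e,c] z}" if "s \<in> S" "z \<in> hom s e" for s z using inducesD[OF j(2) that] .
  have wi: "\<eta> s {z} = {w \<cdot>[s,c,d] z}" if "s \<in> S" "z \<in> hom s c" for s z using inducesD[OF \<eta>(2) that] .
  have jz: "j \<cdot>[s,e,c] z \<in> hom s c" if "s \<in> S" "z \<in> hom s e" for s z using j that o eo by simp
  have wj: "w \<cdot>[s,c,d] (j \<cdot>[s,e,c] z) = \<zero>[s,d]" if s: "s \<in> S" and z: "z \<in> hom s e" for s z
  proof -
    have "\<eta> s (\<phi> s (\<theta> s z)) = {\<zero>[s,d]}"
      using fun_cong[OF fun_cong[OF \<phi>(2)], of s "\<theta> s z"] s chartD(1)[OF e(2) s z] by simp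
    then show ?thesis using ji[OF s z] wi[OF s jz[OF s z]] by simp
  qed
  have "pinj e c j"
    unfolding pinj_def
  proof (intro ballI impI)
    fix s x assume s: "s \<in> S" and x: "x \<in> hom s e" and jx: "j \<cdot>[s,e,c] x = \<zero>[s,c]"
    note so = S_Obj[OF s] and sC = S_C[OF s]
    note sc = sC chart_Hob[OF so] Hob_Obj[OF sC]
    have z: "\<zero>[s,e] \<in> hom s e" using so eo by simp
    obtain u where u: "u \<in> arr H (Hob s) M" "induces s ?i e \<theta> u x" by (rule hom_of[OF sc e M x])
    \<comment> \<open>The elements \<open>x\<close> and zero of \<open>e\<close> at \<open>s\<close>
      have the same image under \<open>j\<close>. As transformations out of \<open>Hob s\<close>
      they must agree, by uniqueness of factorizations through the kernel.\<close>
    obtain v where v: "v \<in> arr H (Hob s) M" "induces s ?i e \<theta> v \<zero>[s,e]" by (rule hom_of[OF sc e M z])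
    have "Cmp H (Hob s) M (Hob c) \<phi> u = Cmp H (Hob s) M (Hob c) \<phi> v"
    proof (rule hom_eqI[OF sc(2)])
      show "Cmp H (Hob s) M (Hob c) \<phi> u \<in> arr H (Hob s) (Hob c)"
        "Cmp H (Hob s) M (Hob c) \<phi> v \<in> arr H (Hob s) (Hob c)" 
        by (rule H_Cmp_arr[OF sc(3) M c(3) u(1) \<phi>(1)], rule H_Cmp_arr[OF sc(3) M c(3) v(1) \<phi>(1)])
      fix a y assume a: "a \<in> S" and y: "y \<in> hom a s"
      note ao = S_Obj[OF a]
      have xy: "x \<cdot>[a,s,e] y \<in> hom a e" using x y so ao eo by simp
      have "\<phi> a (u a {y}) = {j \<cdot>[a,e,c] (x \<cdot>[a,s,e] y)}"
        using inducesD[OF u(2) a y] ji[OF a xy] by simp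
      also have "\<dots> = {\<zero>[a,c]}" using Cmp_reassoc[OF jx] x y j(1) so ao eo o by simp
      also have "\<dots> = \<phi> a (v a {y})" using inducesD[OF v(2) a y] ji[OF a, of "\<zero>[a,e]"] y j(1) so ao eo o by simp
      finally show "Cmp H (Hob s) M (Hob c) \<phi> u a {y} = Cmp H (Hob s) M (Hob c) \<phi> v a {y}"
        using a y by simp
    qed
    moreover have "Cmp H (Hob s) (Hob c) (Hob d) \<eta> (Cmp H (Hob s) M (Hob c) \<phi> v) = \<zero>\<^bsub>Hom H (Hob s) (Hob d)\<^esub>"
    proof (rule hom_eqI[OF sc(2)])
      show "Cmp H (Hob s) (Hob c) (Hob d) \<eta> (Cmp H (Hob s) M (Hob c) \<phi> v) \<in> arr H (Hob s) (Hob d)"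
        "\<zero>\<^bsub>Hom H (Hob s) (Hob d)\<^esub> \<in> arr H (Hob s) (Hob d)" 
        by (rule H_Cmp_arr[OF sc(3) c(3) d(3) H_Cmp_arr[OF sc(3) M c(3) v(1) \<phi>(1)] \<eta>(1)],
            rule H_zero_arr[OF sc(3) d(3)])
      fix a y assume a: "a \<in> S" and y: "y \<in> hom a s"
      have "\<phi> a (v a {y}) = {\<zero>[a,c]}"
        using inducesD[OF v(2) a y] ji[OF a, of "\<zero>[a,e]"] y j(1) so S_Obj[OF a] eo o by simp
      then show "Cmp H (Hob s) (Hob c) (Hob d) \<eta> (Cmp H (Hob s) M (Hob c) \<phi> v) a {y} = \<zero>\<^bsub>Hom H (Hob s) (Hob d)\<^esub> a {y}"
        using wi[OF a, of "\<zero>[a,c]"] w a y S_Obj[OF a] o by simp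
    qed
    ultimately have "u = v"
      using univ[OF sc(3) H_Cmp_arr[OF sc(3) M c(3) v(1) \<phi>(1)]] u(1) v(1) by blast
    then have "\<theta> s (x \<cdot>[s,s,e] idm s) = \<theta> s (\<zero>[s,e] \<cdot>[s,s,e] idm s)"
      using inducesD[OF u(2) s, of "idm s"] inducesD[OF v(2) s, of "idm s"] so by simp
    then show "x = \<zero>[s,e]" using chartD(4)[OF e(2) s x z] x z so eo by simp
  qed
  moreover have "pexact e c d j w"
    unfolding pexact_def
  proof (intro ballI iffI)
    fix s x assume s: "s \<in> S" and x: "x \<in> hom s c"
    note so = S_Obj[OF s] and sC = S_C[OF s]
    note sc = sC chart_Hob[OF so] Hob_Obj[OF sC]
    show "w \<cdot>[s,c,d] x = \<zero>[s,d]" if "\<exists>z\<in>hom s e. x = j \<cdot>[s,e,c] z" using that wj s by blast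
    assume wx: "w \<cdot>[s,c,d] x = \<zero>[s,d]"
    obtain u where u: "u \<in> arr H (Hob s) (Hob c)" "induces s ?i c ?i u x" by (rule hom_of[OF sc c x])
    have "Cmp H (Hob s) (Hob c) (Hob d) \<eta> u = \<zero>\<^bsub>Hom H (Hob s) (Hob d)\<^esub>"
    proof (rule hom_eqI[OF sc(2)])
      show "Cmp H (Hob s) (Hob c) (Hob d) \<eta> u \<in> arr H (Hob s) (Hob d)"
        "\<zero>\<^bsub>Hom H (Hob s) (Hob d)\<^esub> \<in> arr H (Hob s) (Hob d)" 
        by (rule H_Cmp_arr[OF sc(3) c(3) d(3) u(1) \<eta>(1)], rule H_zero_arr[OF sc(3) d(3)])
      fix a y assume a: "a \<in> S" and y: "y \<in> hom a s"
      note ao = S_Obj[OF a]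
      have xy: "x \<cdot>[a,s,c] y \<in> hom a c" using x y so ao o by simp
      show "Cmp H (Hob s) (Hob c) (Hob d) \<eta> u a {y} = \<zero>\<^bsub>Hom H (Hob s) (Hob d)\<^esub> a {y}"
        using inducesD[OF u(2) a y] wi[OF a xy] Cmp_reassoc[OF wx, of a y] w x y a so ao o by simp
    qed
    then obtain v where v: "v \<in> arr H (Hob s) M" "Cmp H (Hob s) M (Hob c) \<phi> v = u"
      using univ[OF sc(3) u(1)] by blast
    obtain z where z: "z \<in> hom s e" "induces s ?i e \<theta> v z" by (rule hom_lift[OF sc e M v(1)])
    have "\<phi> s (v s {idm s}) = u s {idm s}"
      using fun_cong[OF fun_cong[OF v(2)], of s "{idm s}"] s so by simp
    then have "{j \<cdot>[s,e,c] z} = {x}"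
      using inducesD[OF z(2) s, of "idm s"] inducesD[OF u(2) s, of "idm s"] ji[OF s z(1)] z(1) x so eo o by simp
    then show "\<exists>z\<in>hom s e. x = j \<cdot>[s,e,c] z" using z(1) by blast
  qed
  ultimately show ?thesis using that e(1) j(1) by blast
qed

text \<open>Inclusion of images in the functor of \<open>c\<close>. For \<open>pinj\<close> maps
  this is the order on subobjects in which the chain condition of \<open>noetherian_object\<close>
  is phrased; \<open>factor_pinj\<close> translates between the two.\<close>

definition img_le :: "'o \<Rightarrow> 'o \<Rightarrow> 'm \<Rightarrow> 'o \<Rightarrow> 'm \<Rightarrow> bool" where
  "img_le c e j e' j' \<longleftrightarrow> (\<forall>s\<in>S. \<forall>x\<in>hom s e. \<exists>y\<in>hom s e'. j \<cdot>[s,e,c] x = j' \<cdot>[s,e',c] y)"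

lemma img_chain_stable:
  assumes c: "c \<in> C" and e: "\<And>i::nat. e i \<in> C" "\<And>i. j i \<in> hom (e i) c" "\<And>i. pinj (e i) c (j i)"
    and le: "\<And>i. img_le c (e i) (j i) (e (Suc i)) (j (Suc i))"
  shows "\<exists>i. img_le c (e (Suc i)) (j (Suc i)) (e i) (j i)"
proof -
  let ?i = "\<lambda>a x. {x}"
  note co = C_Obj[OF c] and eo = C_Obj[OF e(1)]
  note cc = c chart_Hob[OF co] Hob_Obj[OF c] and ec = e(1) chart_Hob[OF eo] Hob_Obj[OF e(1)]
  have "\<exists>u. u \<in> arr H (Hob (e i)) (Hob c) \<and> induces (e i) ?i c ?i u (j i)" for i
    by (rule hom_of[OF ec cc e(2)]) blast
  then obtain u where u: "\<And>i. u i \<in> arr H (Hob (e i)) (Hob c)" "\<And>i. induces (e i) ?i c ?i (u i) (j i)"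
    by metis
  have mono: "is_mono H (Hob (e i)) (Hob c) (u i)" for i
    unfolding is_mono_def
  proof (intro conjI ballI impI u(1))
    fix X v v' assume X: "X \<in> Obj H" and v: "v \<in> arr H X (Hob (e i))" "v' \<in> arr H X (Hob (e i))"
      and eq: "Cmp H X (Hob (e i)) (Hob c) (u i) v = Cmp H X (Hob (e i)) (Hob c) (u i) v'"
    show "v = v'"
    proof (rule H_eqI[OF v])
      fix s Y assume s: "s \<in> S" and Y: "Y \<in> carrier (FOb X s)"
      obtain x where x: "x \<in> hom s (e i)" "v s Y = {x}" using arr_carrier[OF v(1) s Y] by auto
      obtain y where y: "y \<in> hom s (e i)" "v' s Y = {y}" using arr_carrier[OF v(2) s Y] by auto
      have "u i s {x} = u i s {y}"
        using fun_cong[OF fun_cong[OF eq], of s Y] s Y x y by simp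
      then have "j i \<cdot>[s,e i,c] x = j i \<cdot>[s,e i,c] y"
        using inducesD[OF u(2) s] x(1) y(1) by simp
      then show "v s Y = v' s Y" using pinj_eq[OF e(3) s x(1) y(1) _ e(1) c e(2)] x(2) y(2) by simp
    qed
  qed
  have step: "\<exists>v \<in> arr H (Hob (e i)) (Hob (e (Suc i))). u i = Cmp H (Hob (e i)) (Hob (e (Suc i))) (Hob c) (u (Suc i)) v" for i
  proof -
    have *: "\<exists>y\<in>hom s (e (Suc i)). j i \<cdot>[s,e i,c] x = j (Suc i) \<cdot>[s,e (Suc i),c] y" if "s \<in> S" "x \<in> hom s (e i)" for s x
      using le[of i] that unfolding img_le_def by blast
    obtain g where g: "g \<in> hom (e i) (e (Suc i))" "\<And>s x. s \<in> S \<Longrightarrow> x \<in> hom s (e i) \<Longrightarrow>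
        j i \<cdot>[s,e i,c] x = j (Suc i) \<cdot>[s,e (Suc i),c] (g \<cdot>[s,e i,e (Suc i)] x)"
      by (rule factor_pinj[OF e(1) e(1) c e(2) e(2) e(3) *]) blast+
    obtain v where v: "v \<in> arr H (Hob (e i)) (Hob (e (Suc i)))" "induces (e i) ?i (e (Suc i)) ?i v g"
      by (rule hom_of[OF ec ec g(1)])
    have "u i = Cmp H (Hob (e i)) (Hob (e (Suc i))) (Hob c) (u (Suc i)) v"
    proof (rule hom_eqI[OF ec(2) u(1) H_Cmp_arr[OF ec(3) ec(3) cc(3) v(1) u(1)]])
      fix s x assume s: "s \<in> S" and x: "x \<in> hom s (e i)"
      have gx: "g \<cdot>[s,e i,e (Suc i)] x \<in> hom s (e (Suc i))" using g(1) x s eo by simp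
      show "u i s {x} = Cmp H (Hob (e i)) (Hob (e (Suc i))) (Hob c) (u (Suc i)) v s {x}"
        using inducesD[OF u(2) s x] inducesD[OF v(2) s x] inducesD[OF u(2) s gx] g(2)[OF s x] s x by simp
    qed
    then show ?thesis using v(1) by blast
  qed
  have "noetherian_object H (Hob c)" using noeth cc(3) unfolding noetherian_category_def by blast
  then have "\<exists>N. \<forall>i\<ge>N. \<exists>v \<in> arr H (Hob (e (Suc i))) (Hob (e i)).
      u (Suc i) = Cmp H (Hob (e (Suc i))) (Hob (e i)) (Hob c) (u i) v"
    unfolding noetherian_object_def
    by (elim allE[of _ "\<lambda>i. Hob (e i)"] allE[of _ u]) (use ec(3) mono step in blast)
  then obtain i v where v: "v \<in> arr H (Hob (e (Suc i))) (Hob (e i))"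
      "u (Suc i) = Cmp H (Hob (e (Suc i))) (Hob (e i)) (Hob c) (u i) v" by blast
  obtain g where g: "g \<in> hom (e (Suc i)) (e i)" "induces (e (Suc i)) ?i (e i) ?i v g"
    by (rule hom_lift[OF ec ec v(1)])
  have "img_le c (e (Suc i)) (j (Suc i)) (e i) (j i)"
    unfolding img_le_def
  proof (intro ballI)
    fix s x assume s: "s \<in> S" and x: "x \<in> hom s (e (Suc i))"
    have gx: "g \<cdot>[s,e (Suc i),e i] x \<in> hom s (e i)" using g(1) x s eo by simp
    have "{j (Suc i) \<cdot>[s,e (Suc i),c] x} = {j i \<cdot>[s,e i,c] (g \<cdot>[s,e (Suc i),e i] x)}"
      using inducesD[OF u(2) s x] inducesD[OF g(2) s x] inducesD[OF u(2) s gx]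
        fun_cong[OF fun_cong[OF v(2)], of s "{x}"] s x by simp
    then show "\<exists>y\<in>hom s (e i). j (Suc i) \<cdot>[s,e (Suc i),c] x = j i \<cdot>[s,e i,c] y" using gx by blast
  qed
  then show ?thesis by blast
qed

text \<open>Without a maximal member, dependent choice builds a strictly ascending chain of images,
  contradicting \<open>img_chain_stable\<close>.\<close>

lemma max_img:
  assumes c: "c \<in> C" and K: "\<And>e j. Q e j \<Longrightarrow> e \<in> C \<and> j \<in> hom e c \<and> pinj e c j" and ne: "Q e0 j0"
  obtains e j where "Q e j" "\<forall>e' j'. Q e' j' \<longrightarrow> img_le c e j e' j' \<longrightarrow> img_le c e' j' e j"
proof (rule ccontr)
  assume neg: "\<not> thesis"
  note ret = that
  have step: "\<exists>y. Q (fst y) (snd y) \<and> (img_le c (fst x) (snd x) (fst y) (snd y) \<and> \<not> img_le c (fst y) (snd y) (fst x) (snd x))"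
    if "Q (fst x) (snd x)" for x
    using neg ret[of "fst x" "snd x"] that by (metis fst_conv snd_conv)
  have "\<exists>f. \<forall>n::nat. Q (fst (f n)) (snd (f n)) \<and>
    (img_le c (fst (f n)) (snd (f n)) (fst (f (Suc n))) (snd (f (Suc n))) \<and>
     \<not> img_le c (fst (f (Suc n))) (snd (f (Suc n))) (fst (f n)) (snd (f n)))"
    by (rule dependent_nat_choice) (use ne step in auto)
  then obtain f where f: "\<And>n::nat. Q (fst (f n)) (snd (f n))"
    "\<And>n. img_le c (fst (f n)) (snd (f n)) (fst (f (Suc n))) (snd (f (Suc n)))"
    "\<And>n. \<not> img_le c (fst (f (Suc n))) (snd (f (Suc n))) (fst (f n)) (snd (f n))" by blast
  then show False using img_chain_stable[OF c, of "\<lambda>n. fst (f n)" "\<lambda>n. snd (f n)"] K by blast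
qed

text \<open>Among the subfunctors of \<open>T(-, c)\<close> of the form \<open>T(-, e)\<close> with e in Y choose a maximal one, and let
  d represent the quotient. For q from y to d, the preimage I in c of the image J of q is an extension of J
  by e, so it also belongs to Y and is not larger than e.\<close>

lemma torsion_decomposition:
  assumes X: "X \<subseteq> C" and c: "c \<in> C"
  obtains e d j w where "e \<in> perpR X" "d \<in> C" "j \<in> hom e c" "w \<in> hom c d" "pinj e c j" "onto c d w"
    "pexact e c d j w" "\<forall>y\<in>perpR X. \<forall>q\<in>hom y d. null y d q"
proof -
  let ?Q = "\<lambda>e j. e \<in> perpR X \<and> j \<in> hom e c \<and> pinj e c j"
  have YC: "y \<in> C" if "y \<in> perpR X" for y using that unfolding perpR_def by blast
  obtain z where z: "z \<in> Obj T" "idm z = \<zero>[z,z]" by (rule zero_ex)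
  have zC: "z \<in> C" using S_C zero_S z by blast
  have "van x (sh z)" if "x \<in> X" for x using zero_van(2)[OF Sh_Obj[OF z(1)] sh_zero[OF z]] X that by auto
  then have Qz: "?Q z \<zero>[z,c]" using zC c z vanD[OF zero_van(2)[OF z]] unfolding perpR_def pinj_def by auto
  obtain e j where ej: "?Q e j" and max: "\<forall>e' j'. ?Q e' j' \<longrightarrow> img_le c e j e' j' \<longrightarrow> img_le c e' j' e j"
    by (rule max_img[of c ?Q z "\<zero>[z,c]", OF c _ Qz]) (use YC in blast)
  then have e: "e \<in> perpR X" "e \<in> C" and j: "j \<in> hom e c" "pinj e c j" using YC by auto
  obtain d w where d: "d \<in> C" and w: "w \<in> hom c d" "onto c d w" and ex: "pexact e c d j w"
    by (rule coker_ex[OF e(2) c j(1)])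
  have "null y d q" if y: "y \<in> perpR X" and q: "q \<in> hom y d" for y q
  proof -
    note yC = YC[OF y]
    obtain d' r where d': "d' \<in> C" and r: "r \<in> hom d d'" "onto d d' r" and exr: "pexact y d d' q r"
      by (rule coker_ex[OF yC d q])
    note o = C_Obj[OF e(2)] C_Obj[OF c] C_Obj[OF d] C_Obj[OF yC] C_Obj[OF d']
    have rw: "r \<cdot>[c,d,d'] w \<in> hom c d'" using r w o by simp
    \<comment> \<open>\<open>l\<close> is the image of \<open>q\<close>, obtained as the kernel of
      its cokernel \<open>r\<close>; \<open>i\<close> is the preimage of that image, obtained as the
      kernel of \<open>r w\<close>.\<close>
    obtain J l where J: "J \<in> C" and l: "l \<in> hom J d" "pinj J d l" and exl: "pexact J d d' l r"
      by (rule kernel_ex[OF d d' r(1)])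
    obtain I i where I: "I \<in> C" and i: "i \<in> hom I c" "pinj I c i" and exi: "pexact I c d' i (r \<cdot>[c,d,d'] w)"
      by (rule kernel_ex[OF c d' rw])
    note o' = o C_Obj[OF J] C_Obj[OF I] S_Obj
    have 1: "\<exists>v\<in>hom s J. q \<cdot>[s,y,d] x = l \<cdot>[s,J,d] v" if s: "s \<in> S" and x: "x \<in> hom s y" for s x
      using pexactE[OF exl s _ pexactD[OF exr s x yC d q]] q x o S_Obj[OF s] by (metis Cmp_arr)
    obtain g where g: "g \<in> hom y J" "\<And>s x. s \<in> S \<Longrightarrow> x \<in> hom s y \<Longrightarrow>
        q \<cdot>[s,y,d] x = l \<cdot>[s,J,d] (g \<cdot>[s,y,J] x)"
      by (rule factor_pinj[OF yC J d q l 1]) blast+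
    have "onto y J g"
      unfolding onto_def
    proof (intro ballI)
      fix s v assume s: "s \<in> S" and v: "v \<in> hom s J"
      have lv: "l \<cdot>[s,J,d] v \<in> hom s d" using l v o' s by simp
      obtain x where x: "x \<in> hom s y" "l \<cdot>[s,J,d] v = q \<cdot>[s,y,d] x"
        by (rule pexactE[OF exr s lv pexactD[OF exl s v J d l(1)]])
      have gx: "g \<cdot>[s,y,J] x \<in> hom s J" using g(1) x(1) o' s by simp
      have "v = g \<cdot>[s,y,J] x" by (rule pinj_eq[OF l(2) s v gx _ J d l(1)]) (use x g(2)[OF s x(1)] in simp)
      then show "\<exists>x\<in>hom s y. v = g \<cdot>[s,y,J] x" using x(1) by blast
    qed
    then have JY: "J \<in> perpR X" using perpR_quotient[OF X y J g(1)] by blast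
    have rwa: "(r \<cdot>[c,d,d'] w) \<cdot>[s,c,d'] x = r \<cdot>[s,d,d'] (w \<cdot>[s,c,d] x)" if "s \<in> S" "x \<in> hom s c" for s x
      using r w that o' by (simp add: Cmp_assoc)
    have 2: "\<exists>v\<in>hom s I. j \<cdot>[s,e,c] x = i \<cdot>[s,I,c] v" if s: "s \<in> S" and x: "x \<in> hom s e" for s x
    proof -
      have jx: "j \<cdot>[s,e,c] x \<in> hom s c" using j x o' s by simp
      have "(r \<cdot>[c,d,d'] w) \<cdot>[s,c,d'] (j \<cdot>[s,e,c] x) = \<zero>[s,d']"
        using rwa[OF s jx] pexactD[OF ex s x e(2) c j(1)] r o' s by simp
      then show ?thesis using pexactE[OF exi s jx] by blast
    qed
    obtain g1 where g1: "g1 \<in> hom e I" "\<And>s x. s \<in> S \<Longrightarrow> x \<in> hom s e \<Longrightarrow>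
        j \<cdot>[s,e,c] x = i \<cdot>[s,I,c] (g1 \<cdot>[s,e,I] x)"
      by (rule factor_pinj[OF e(2) I c j(1) i 2]) blast+
    have wi: "w \<cdot>[I,c,d] i \<in> hom I d" using w i o' by simp
    have wia: "(w \<cdot>[I,c,d] i) \<cdot>[s,I,d] x = w \<cdot>[s,c,d] (i \<cdot>[s,I,c] x)" if "s \<in> S" "x \<in> hom s I" for s x
      using w i that o' by (simp add: Cmp_assoc)
    have ix: "i \<cdot>[s,I,c] x \<in> hom s c" if "s \<in> S" "x \<in> hom s I" for s x using i that o' by simp
    have wix: "w \<cdot>[s,c,d] (i \<cdot>[s,I,c] x) \<in> hom s d" if "s \<in> S" "x \<in> hom s I" for s x using w ix[OF that] that o' by simp
    have 3: "\<exists>v\<in>hom s J. (w \<cdot>[I,c,d] i) \<cdot>[s,I,d] x = l \<cdot>[s,J,d] v" if s: "s \<in> S" and x: "x \<in> hom s I" for s x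
      using pexactE[OF exl s wix[OF s x]] pexactD[OF exi s x I c i(1)] rwa[OF s ix[OF s x]] wia[OF s x] by metis
    obtain g2 where g2: "g2 \<in> hom I J" "\<And>s x. s \<in> S \<Longrightarrow> x \<in> hom s I \<Longrightarrow>
        (w \<cdot>[I,c,d] i) \<cdot>[s,I,d] x = l \<cdot>[s,J,d] (g2 \<cdot>[s,I,J] x)"
      by (rule factor_pinj[OF I J d wi l 3]) blast+
    have pre: "\<exists>t\<in>hom s I. u = i \<cdot>[s,I,c] t" if s: "s \<in> S" and u: "u \<in> hom s c" and z: "r \<cdot>[s,d,d'] (w \<cdot>[s,c,d] u) = \<zero>[s,d']" for s u
      using pexactE[OF exi s u] rwa[OF s u] z by metis
    have on2: "onto I J g2"
      unfolding onto_def
    proof (intro ballI)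
      fix s v assume s: "s \<in> S" and v: "v \<in> hom s J"
      have lv: "l \<cdot>[s,J,d] v \<in> hom s d" using l v o' s by simp
      obtain u where u: "u \<in> hom s c" "l \<cdot>[s,J,d] v = w \<cdot>[s,c,d] u" by (rule ontoE[OF w(2) s lv])
      obtain t where t: "t \<in> hom s I" "u = i \<cdot>[s,I,c] t"
        using pre[OF s u(1)] pexactD[OF exl s v J d l(1)] u(2) by auto
      have gt: "g2 \<cdot>[s,I,J] t \<in> hom s J" using g2(1) t(1) o' s by simp
      have "v = g2 \<cdot>[s,I,J] t"
        by (rule pinj_eq[OF l(2) s v gt _ J d l(1)]) (use u t g2(2)[OF s t(1)] wia[OF s t(1)] in simp)
      then show "\<exists>x\<in>hom s I. v = g2 \<cdot>[s,I,J] x" using t(1) by blast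
    qed
    have "pexact e I J g1 g2"
      unfolding pexact_def
    proof (intro ballI)
      fix s x assume s: "s \<in> S" and x: "x \<in> hom s I"
      have gx: "g2 \<cdot>[s,I,J] x \<in> hom s J" using g2(1) x o' s by simp
      have "g2 \<cdot>[s,I,J] x = \<zero>[s,J] \<longleftrightarrow> l \<cdot>[s,J,d] (g2 \<cdot>[s,I,J] x) = \<zero>[s,d]"
        using pinjD[OF l(2) s gx] l(1) o' s by auto
      also have "\<dots> \<longleftrightarrow> w \<cdot>[s,c,d] (i \<cdot>[s,I,c] x) = \<zero>[s,d]" using g2(2)[OF s x] wia[OF s x] by simp
      also have "\<dots> \<longleftrightarrow> (\<exists>z\<in>hom s e. i \<cdot>[s,I,c] x = j \<cdot>[s,e,c] z)"
        using ex s ix[OF s x] unfolding pexact_def by blast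
      also have "\<dots> \<longleftrightarrow> (\<exists>z\<in>hom s e. x = g1 \<cdot>[s,e,I] z)"
      proof (intro bex_cong refl)
        fix z assume z: "z \<in> hom s e"
        have gz: "g1 \<cdot>[s,e,I] z \<in> hom s I" using g1(1) z o' s by simp
        show "i \<cdot>[s,I,c] x = j \<cdot>[s,e,c] z \<longleftrightarrow> x = g1 \<cdot>[s,e,I] z"
          using pinj_eq[OF i(2) s x gz _ I c i(1)] g1(2)[OF s z] by auto
      qed
      finally show "g2 \<cdot>[s,I,J] x = \<zero>[s,J] \<longleftrightarrow> (\<exists>z\<in>hom s e. x = g1 \<cdot>[s,e,I] z)" .
    qed
    then have "I \<in> perpR X" using perpR_extension[OF X e(1) JY I g1(1) g2(1) on2] by blast
    then have QI: "?Q I i" using i by blast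
    have "img_le c e j I i" unfolding img_le_def using 2 by blast
    then have le: "img_le c I i e j" using max QI by blast
    \<comment> \<open>Any value of \<open>q\<close> lifts along \<open>w\<close> to a point of
      \<open>I\<close>. By maximality that point comes from \<open>e\<close>, so it vanishes in the
      quotient \<open>d\<close>.\<close>
    show ?thesis
      unfolding null_def
    proof (intro ballI)
      fix s x assume s: "s \<in> S" and x: "x \<in> hom s y"
      have qx: "q \<cdot>[s,y,d] x \<in> hom s d" using q x o' s by simp
      obtain u where u: "u \<in> hom s c" "q \<cdot>[s,y,d] x = w \<cdot>[s,c,d] u" by (rule ontoE[OF w(2) s qx])
      obtain t where t: "t \<in> hom s I" "u = i \<cdot>[s,I,c] t"
        using pre[OF s u(1)] pexactD[OF exr s x yC d q] u(2) by auto
      obtain z where z: "z \<in> hom s e" "i \<cdot>[s,I,c] t = j \<cdot>[s,e,c] z" using le s t(1) unfolding img_le_def by blast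
      show "q \<cdot>[s,y,d] x = \<zero>[s,d]" using u t z pexactD[OF ex s z(1) e(2) c j(1)] by simp
    qed
  qed
  then show ?thesis using that e(1) d j w ex by blast
qed

section \<open>The torsion pair of a cotorsion pair\<close>

definition UY :: "'o set \<Rightarrow> ('o, 'm, 'k, 'm set) modfunctor set" where
  "UY Y = {M \<in> Obj H. \<exists>y\<in>Y. \<exists>\<theta>. chart y M \<theta>}"

text \<open>The identity of \<open>M\<close>, lifted between two charts, is bijective on S-points.
  As \<open>perpR X\<close> is closed under quotients, membership in it is independent of the chart
  (\<open>UY_iff\<close>).\<close>

lemma chart_compare:
  assumes c: "c \<in> C" "chart c M \<theta>" and y: "y \<in> C" "chart y M \<psi>" and M: "M \<in> Obj H"
  obtains w where "w \<in> hom y c" "onto y c w"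
proof -
  have "Idm H M \<in> arr H M M" using linear_category.Idm_arr[OF H_linear M] .
  then obtain w where w: "w \<in> hom y c" "induces y \<psi> c \<theta> (Idm H M) w" by (rule hom_lift[OF y M c M])
  have "onto y c w"
    unfolding onto_def
  proof (intro ballI)
    fix s z assume s: "s \<in> S" and z: "z \<in> hom s c"
    note zc = chartD(1)[OF c(2) s z]
    obtain x where x: "x \<in> hom s y" "\<theta> s z = \<psi> s x" by (rule chart_cases[OF y(2) s zc])
    have wx: "w \<cdot>[s,y,c] x \<in> hom s c" using w x s c y by simp
    have "\<psi> s x = \<theta> s (w \<cdot>[s,y,c] x)" using inducesD[OF w(2) s x(1)] chartD(1)[OF y(2) s x(1)] s by simp
    then have "z = w \<cdot>[s,y,c] x" using chartD(4)[OF c(2) s z wx] x(2) by simp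
    then show "\<exists>x\<in>hom s y. z = w \<cdot>[s,y,c] x" using x(1) by blast
  qed
  with w(1) show ?thesis by (rule that)
qed

lemma perpR_subset: "perpR X \<subseteq> C" unfolding perpR_def by blast

lemma UY_iff:
  assumes X: "X \<subseteq> C" and c: "c \<in> C" "chart c M \<theta>" "M \<in> Obj H"
  shows "M \<in> UY (perpR X) \<longleftrightarrow> c \<in> perpR X"
proof
  assume "M \<in> UY (perpR X)"
  then obtain y \<psi> where y: "y \<in> perpR X" "chart y M \<psi>" unfolding UY_def by blast
  have yC: "y \<in> C" using y perpR_subset by blast
  obtain w where "w \<in> hom y c" "onto y c w" by (rule chart_compare[OF c(1,2) yC y(2) c(3)])
  then show "c \<in> perpR X" using perpR_quotient[OF X y(1) c(1)] by blast
qed (use c in \<open>auto simp: UY_def\<close>)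

lemma UY_inj:
  assumes "X \<subseteq> C" "X' \<subseteq> C" "UY (perpR X) = UY (perpR X')" shows "perpR X = perpR X'"
proof -
  have "c \<in> perpR X \<longleftrightarrow> c \<in> perpR X'" if c: "c \<in> C" for c
    using UY_iff[OF assms(1) c chart_Hob Hob_Obj] UY_iff[OF assms(2) c chart_Hob Hob_Obj] assms(3) c C_Obj by blast
  then show ?thesis using perpR_subset by blast
qed

text \<open>The exact sequences come from \<open>torsion_decomposition\<close>. If the functor of
  \<open>c\<close> is left orthogonal to the torsion-free class, the projection \<open>w\<close> to
  the torsion-free part is null, so exactness makes \<open>j\<close> onto and \<open>c\<close> a
  quotient of its torsion part.\<close>

lemma torsion_pair_UY:
  assumes X: "X \<subseteq> C"
  shows "torsion_pair H (UY (perpR X)) (right_perp H (UY (perpR X)))"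
proof -
  let ?U = "UY (perpR X)" and ?V = "right_perp H (UY (perpR X))"
  have VI: "Hob d \<in> ?V" if d: "d \<in> C" and n: "\<forall>y\<in>perpR X. \<forall>q\<in>hom y d. null y d q" for d
    unfolding right_perp_def
  proof (intro CollectI conjI ballI Hob_Obj d)
    fix u assume "u \<in> ?U"
    then obtain y \<psi> where y: "y \<in> perpR X" "chart y u \<psi>" "u \<in> Obj H" unfolding UY_def by blast
    have yC: "y \<in> C" using y perpR_subset by blast
    show "arr H u (Hob d) = {\<zero>\<^bsub>Hom H u (Hob d)\<^esub>}"
      using hom_zero_iff[OF yC y(2,3) d chart_Hob[OF C_Obj[OF d]] Hob_Obj[OF d] H_linear] n y(1) by blast
  qed
  have "left_perp H ?V = ?U"
  proof
    show "?U \<subseteq> left_perp H ?V" unfolding left_perp_def right_perp_def UY_def by blast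
    show "left_perp H ?V \<subseteq> ?U"
    proof
      fix M assume "M \<in> left_perp H ?V"
      then have M: "M \<in> Obj H" and z: "\<And>N. N \<in> ?V \<Longrightarrow> arr H M N = {\<zero>\<^bsub>Hom H M N\<^esub>}" unfolding left_perp_def by auto
      obtain c \<theta> where c: "c \<in> C" "chart c M \<theta>" by (rule chart_ex[OF M])
      obtain e d j w where D: "e \<in> perpR X" "d \<in> C" "j \<in> hom e c" "w \<in> hom c d" "pinj e c j" "onto c d w"
        "pexact e c d j w" "\<forall>y\<in>perpR X. \<forall>q\<in>hom y d. null y d q"
        by (rule torsion_decomposition[OF X c(1)])
      have "null c d w"
        using hom_zero_iff[OF c M D(2) chart_Hob[OF C_Obj[OF D(2)]] Hob_Obj[OF D(2)] H_linear] z[OF VI[OF D(2,8)]] D(4) by blast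
      then have "onto e c j" unfolding onto_def null_def using D(7) unfolding pexact_def by blast
      then have "c \<in> perpR X" using perpR_quotient[OF X D(1) c(1) D(3)] by blast
      then show "M \<in> ?U" using UY_iff[OF X c M] by blast
    qed
  qed
  moreover have "\<exists>u\<in>?U. \<exists>v\<in>?V. \<exists>f g. short_exact H u M v f g" if M: "M \<in> Obj H" for M
  proof -
    obtain c \<theta> where c: "c \<in> C" "chart c M \<theta>" by (rule chart_ex[OF M])
    obtain e d j w where D: "e \<in> perpR X" "d \<in> C" "j \<in> hom e c" "w \<in> hom c d" "pinj e c j" "onto c d w"
      "pexact e c d j w" "\<forall>y\<in>perpR X. \<forall>q\<in>hom y d. null y d q"
      by (rule torsion_decomposition[OF X c(1)])
    have eC: "e \<in> C" using D(1) perpR_subset by blast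
    note e = eC chart_Hob[OF C_Obj[OF eC]] Hob_Obj[OF eC] and d = D(2) chart_Hob[OF C_Obj[OF D(2)]] Hob_Obj[OF D(2)]
    obtain \<eta> where \<eta>: "\<eta> \<in> arr H (Hob e) M" "induces e (\<lambda>a x. {x}) c \<theta> \<eta> j" by (rule hom_of[OF e c M D(3)])
    obtain \<zeta> where \<zeta>: "\<zeta> \<in> arr H M (Hob d)" "induces c \<theta> d (\<lambda>a x. {x}) \<zeta> w" by (rule hom_of[OF c M d D(4)])
    have "short_exact H (Hob e) M (Hob d) \<eta> \<zeta>"
      by (rule short_exact_chart[OF e c M d H_linear D(3,5,4,6,7) \<eta> \<zeta>])
    moreover have "Hob e \<in> ?U" using UY_iff[OF X e] D(1) by blast
    ultimately show ?thesis using VI[OF D(2,8)] by blast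
  qed
  ultimately show ?thesis unfolding torsion_pair_def UY_def right_perp_def by blast
qed

text \<open>For the approximation property, a transformation to the functor of \<open>y'\<close> is
  lifted to \<open>m : c -> y'\<close>. The obstruction to extending \<open>m\<close> along
  \<open>c -> y\<close> lies in \<open>T(x, sh y')\<close>, which is zero.\<close>

lemma cotorsion_to_torsion:
  assumes PQ: "complete_cotorsion_pair T C P Q"
  shows "functorially_finite_torsion_pair H (UY Q) (right_perp H (UY Q))"
proof -
  note sub = cotorsion_subset[OF PQ] and Q = cotorsion_perpR[OF PQ]
  have "\<exists>u\<in>UY Q. \<exists>f\<in>arr H M u. \<forall>u'\<in>UY Q. \<forall>g\<in>arr H M u'. \<exists>e\<in>arr H u u'. g = Cmp H M u u' e f" if M: "M \<in> Obj H" for M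
  proof -
    obtain c \<theta> where c: "c \<in> C" "chart c M \<theta>" by (rule chart_ex[OF M])
    obtain y x f g h where t: "(c, y, x, f, g, h) \<in> Tri T" and y: "y \<in> Q" and x: "x \<in> P"
      using PQ c(1) unfolding complete_cotorsion_pair_def by blast
    note o = Tri_arr[OF t]
    have yC: "y \<in> C" using y sub by blast
    have f: "f \<in> hom c y" using o by blast
    note yc = yC chart_Hob[OF C_Obj[OF yC]] Hob_Obj[OF yC]
    obtain \<phi> where \<phi>: "\<phi> \<in> arr H M (Hob y)" "induces c \<theta> y (\<lambda>a x. {x}) \<phi> f" by (rule hom_of[OF c M yc f])
    have "\<exists>e\<in>arr H (Hob y) N. \<gamma> = Cmp H M (Hob y) N e \<phi>" if N: "N \<in> UY Q" and \<gamma>: "\<gamma> \<in> arr H M N" for N \<gamma>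
    proof -
      obtain y' \<psi> where y': "y' \<in> Q" "chart y' N \<psi>" and NO: "N \<in> Obj H" using N unfolding UY_def by blast
      have yC': "y' \<in> C" using y' sub by blast
      obtain m where m: "m \<in> hom c y'" "induces c \<theta> y' \<psi> \<gamma> m" by (rule hom_lift[OF c M yC' y'(2) NO \<gamma>])
      have "van x (sh y')" using y'(1) x unfolding Q perpR_def by blast
      then have "shm c y' m \<cdot>[x,sh c,sh y'] h = \<zero>[x,sh y']"
        by (rule vanD) (use m o yC' in auto)
      then obtain v where v: "v \<in> hom y y'" "m = v \<cdot>[c,y,y'] f"
        by (rule extend_along[OF t C_Obj[OF yC'] m(1)])
      obtain e where e: "e \<in> arr H (Hob y) N" "induces y (\<lambda>a x. {x}) y' \<psi> e v"
        by (rule hom_of[OF yc yC' y'(2) NO v(1)])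
      have "\<gamma> = Cmp H M (Hob y) N e \<phi>"
      proof (rule hom_eqI[OF c(2) \<gamma> H_Cmp_arr[OF M yc(3) NO \<phi>(1) e(1)]])
        fix s z assume s: "s \<in> S" and z: "z \<in> hom s c"
        have fz: "f \<cdot>[s,c,y] z \<in> hom s y" using o z s by simp
        show "\<gamma> s (\<theta> s z) = Cmp H M (Hob y) N e \<phi> s (\<theta> s z)"
          using inducesD[OF m(2) s z] inducesD[OF \<phi>(2) s z] inducesD[OF e(2) s fz] v f z s o C_Obj[OF yC']
            chartD(1)[OF c(2) s z] by (simp add: Cmp_assoc)
      qed
      with e(1) show ?thesis by blast
    qed
    moreover have "Hob y \<in> UY Q" using yc y unfolding UY_def by blast
    ultimately show ?thesis using \<phi>(1) by blast
  qed
  then have "covariantly_finite H (UY Q)" unfolding covariantly_finite_def by blast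
  moreover have "torsion_pair H (UY Q) (right_perp H (UY Q))" using torsion_pair_UY[OF sub(1)] Q by simp
  ultimately show ?thesis unfolding functorially_finite_torsion_pair_def by blast
qed

end

section \<open>Minimal approximations\<close>

context triangulated_category
begin

text \<open>\<open>Tri_cone\<close> prescribes the first map of a triangle. To prescribe the third
  one, take the cone of \<open>\<phi>\<close>, write it as a shift up to isomorphism and rotate back
  twice.\<close>

lemma Tri_fibre:
  assumes o: "a \<in> Obj T" "c \<in> Obj T" and f: "\<phi> \<in> hom c (sh a)"
  obtains b f g where "(a, b, c, f, g, \<phi>) \<in> Tri T"
proof -
  obtain e p q where t: "(c, sh a, e, \<phi>, p, q) \<in> Tri T" using Tri_cone[of c "sh a" \<phi>] o f by auto
  note o' = Tri_arr[OF t]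
  obtain b where b: "b \<in> Obj T" "isos (sh b) e" by (rule isos_sh_ex[of e]) (use o' in auto)
  obtain v v' where v: "v \<in> hom (sh b) e" "v' \<in> hom e (sh b)" "v \<cdot>[e,sh b,e] v' = idm e" "v' \<cdot>[sh b,e,sh b] v = idm (sh b)"
    "is_iso T e (sh b) v'" using b(2) by (rule isosE)
  have "(c, sh a, sh b, \<phi>, v' \<cdot>[sh a,e,sh b] p, q \<cdot>[sh b,e,sh c] v) \<in> Tri T"
    by (rule Tri_iso[OF t _ _ _ _ _ _ is_iso_Idm is_iso_Idm v(5)])
      (use o o' f b v(1,2) in \<open>simp_all add: Cmp_assoc v(3)\<close>)
  then obtain f where "(b, c, sh a, f, \<phi>, v' \<cdot>[sh a,e,sh b] p) \<in> Tri T" using Tri_unrot b(1) by blast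
  then obtain f' where "(a, b, c, f', f, \<phi>) \<in> Tri T" using Tri_unrot o(1) by blast
  then show ?thesis by (rule that)
qed

section \<open>Morphisms between objects with local endomorphism rings\<close>

abbreviation local_obj :: "'o \<Rightarrow> bool" where "local_obj a \<equiv> local_ring (End_ring T a)"

lemma Units_End: "Units (End_ring T a) = {u. is_iso T a a u}"
  unfolding Units_def is_iso_def End_ring_def by auto

lemma local_sum:
  assumes "local_obj a" "u \<in> hom a a" "v \<in> hom a a" "u \<oplus>[a,a] v = idm a" "a \<in> Obj T"
  shows "is_iso T a a u \<or> is_iso T a a v"
proof (rule ccontr)
  assume "\<not> ?thesis"
  then have "u \<in> carrier (End_ring T a) - Units (End_ring T a)" "v \<in> carrier (End_ring T a) - Units (End_ring T a)"
    using assms unfolding Units_End by (auto simp: End_ring_def)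
  then have "u \<oplus>\<^bsub>End_ring T a\<^esub> v \<notin> Units (End_ring T a)" using assms(1) unfolding local_ring_def by blast
  moreover have "u \<oplus>\<^bsub>End_ring T a\<^esub> v = idm a" using assms(4) by (simp add: End_ring_def)
  ultimately show False unfolding Units_End using assms(5) by simp
qed

lemma local_one_minus:
  assumes "local_obj a" "u \<in> hom a a" "\<not> is_iso T a a u" "a \<in> Obj T"
  shows "is_iso T a a (idm a \<ominus>[a,a] u)"
  using local_sum[of a u "idm a \<ominus>[a,a] u"] assms by simp

lemma local_nonzero: "local_obj a \<Longrightarrow> idm a \<noteq> \<zero>[a,a]"
  unfolding local_ring_def End_ring_def by simp

text \<open>Composing with an inverse of the sum writes \<open>idm a\<close> as a sum of two
  endomorphisms, one of which is invertible because the endomorphism ring of \<open>a\<close> is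
  local.\<close>

lemma noniso_sum:
  assumes o: "a \<in> Obj T" "b \<in> Obj T" and l: "local_obj a" and u: "u \<in> hom a b" "\<not> is_iso T a b u"
    and v: "v \<in> hom a b" "\<not> is_iso T a b v"
  shows "\<not> is_iso T a b (u \<oplus>[a,b] v)"
proof
  assume "is_iso T a b (u \<oplus>[a,b] v)"
  then obtain t where t: "t \<in> hom b a" "t \<cdot>[a,b,a] (u \<oplus>[a,b] v) = idm a" "is_iso T a b (u \<oplus>[a,b] v)"
    "(u \<oplus>[a,b] v) \<cdot>[b,a,b] t = idm b"
    by (meson is_isoE)
  let ?s = "u \<oplus>[a,b] v"
  have "(t \<cdot>[a,b,a] u) \<oplus>[a,a] (t \<cdot>[a,b,a] v) = idm a" using t(1,2) u(1) v(1) o by (simp add: bilin)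
  then have "is_iso T a a (t \<cdot>[a,b,a] u) \<or> is_iso T a a (t \<cdot>[a,b,a] v)"
    by (rule local_sum[OF l, rotated 2]) (use t u v o in auto)
  moreover have "is_iso T a b w" if w: "w \<in> hom a b" and i: "is_iso T a a (t \<cdot>[a,b,a] w)" for w
  proof -
    have "is_iso T a b (?s \<cdot>[a,a,b] (t \<cdot>[a,b,a] w))" by (rule is_iso_Cmp[OF o(1) o(1) o(2) i t(3)])
    moreover have "?s \<cdot>[a,a,b] (t \<cdot>[a,b,a] w) = w" using Cmp_reassoc[OF t(4)] w t(1) u(1) v(1) o by simp
    ultimately show ?thesis by simp
  qed
  ultimately show False using u v by blast
qed

text \<open>If \<open>v u\<close> were invertible, \<open>v\<close> would have a right inverse
  \<open>r\<close>, and \<open>r v\<close> would be an idempotent of a local ring, hence 1 or 0. The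
  first case makes \<open>v\<close> invertible, the second gives
  \<open>idm b = v (r v) r = 0\<close>.\<close>

lemma noniso_Cmp:
  assumes o: "p \<in> Obj T" "a \<in> Obj T" "b \<in> Obj T" and l: "local_obj a" "local_obj b"
    and v: "v \<in> hom a b" "\<not> is_iso T a b v" and u: "u \<in> hom p a"
  shows "\<not> is_iso T p b (v \<cdot>[p,a,b] u)"
proof
  assume "is_iso T p b (v \<cdot>[p,a,b] u)"
  then obtain t where t: "t \<in> hom b p" "(v \<cdot>[p,a,b] u) \<cdot>[b,p,b] t = idm b" by (meson is_isoE)
  let ?r = "u \<cdot>[b,p,a] t"
  let ?e = "?r \<cdot>[a,b,a] v"
  have r: "?r \<in> hom b a" and e: "?e \<in> hom a a" using u t v o by auto
  have vr: "v \<cdot>[b,a,b] ?r = idm b" using t u v o by (simp add: Cmp_assoc)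
  have ee: "?e \<cdot>[a,a,a] ?e = ?e"
    using Cmp_reassoc[OF vr, of a v] Cmp_assoc[of a b a a v ?r ?e] r v(1) o e
    by (simp add: Cmp_assoc[of a b a a v ?r] Cmp_assoc[of a a b a ?e v ?r] flip: Cmp_assoc[of a b a b v ?r v])
  show False
  proof (cases "is_iso T a a ?e")
    case True
    then obtain s where s: "s \<in> hom a a" "s \<cdot>[a,a,a] ?e = idm a" by (meson is_isoE)
    have "?e = s \<cdot>[a,a,a] (?e \<cdot>[a,a,a] ?e)" using Cmp_reassoc[OF s(2) o(2,2,2,2) e e s(1)] e o by simp
    then have "?e = idm a" using ee s(2) by simp
    then have "is_iso T a b v" using is_isoI[OF v(1) r _ vr] by simp
    then show False using v by blast
  next
    case False
    then obtain s where s: "s \<in> hom a a" "s \<cdot>[a,a,a] (idm a \<ominus>[a,a] ?e) = idm a"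
      using local_one_minus[OF l(1) e] o by (meson is_isoE)
    have "(idm a \<ominus>[a,a] ?e) \<cdot>[a,a,a] ?e = \<zero>[a,a]"
      using ee e o by (simp add: Cmp_mns_left)
    then have e0: "?e = \<zero>[a,a]" using Cmp_reassoc[OF s(2) o(2,2,2,2) e _ s(1)] s(1) e o by simp
    have "idm b = v \<cdot>[b,a,b] (?e \<cdot>[b,a,a] ?r)"
      using vr r v(1) o by (simp add: Cmp_assoc[of b a b a ?r v ?r])
    also have "\<dots> = \<zero>[b,b]" unfolding e0 using r v(1) o by simp
    finally show False using local_nonzero[OF l(2)] by blast
  qed
qed

text \<open>A Krull-Schmidt decomposition indexed by an arbitrary finite set, so that a summand can
  be deleted without renumbering the others.\<close>

definition local_dsum :: "'o \<Rightarrow> nat set \<Rightarrow> (nat \<Rightarrow> 'o) \<Rightarrow> (nat \<Rightarrow> 'm) \<Rightarrow> (nat \<Rightarrow> 'm) \<Rightarrow> bool" where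
  "local_dsum y J xs \<iota> \<pi> \<longleftrightarrow> y \<in> Obj T \<and> finite J \<and>
    (\<forall>l\<in>J. xs l \<in> Obj T \<and> local_obj (xs l) \<and> \<iota> l \<in> hom (xs l) y \<and> \<pi> l \<in> hom y (xs l)) \<and>
    (\<forall>l\<in>J. \<forall>m\<in>J. \<pi> m \<cdot>[xs l,y,xs m] \<iota> l = (if l = m then idm (xs l) else \<zero>[xs l,xs m])) \<and>
    hsum y y (\<lambda>l. \<iota> l \<cdot>[y,xs l,y] \<pi> l) J = idm y"

lemma Krull_Schmidt_local_dsum:
  assumes "Krull_Schmidt T" "y \<in> Obj T"
  shows "\<exists>J xs \<iota> \<pi>. local_dsum y J xs \<iota> \<pi>"
proof -
  obtain n xs where n: "direct_sum T y n xs" "\<forall>i<n. local_obj (xs i)"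
    using assms unfolding Krull_Schmidt_def by blast
  then obtain \<iota> \<pi> where
    "(\<forall>i<n. \<iota> i \<in> arr T (xs i) y \<and> \<pi> i \<in> arr T y (xs i))"
    "(\<forall>i<n. \<forall>j<n. Cmp T (xs i) y (xs j) (\<pi> j) (\<iota> i) = (if i = j then Idm T (xs i) else \<zero>\<^bsub>Hom T (xs i) (xs j)\<^esub>))"
    "(\<Oplus>\<^bsub>Hom T y y\<^esub>i\<in>{..<n}. Cmp T y (xs i) y (\<iota> i) (\<pi> i)) = Idm T y" "\<forall>i<n. xs i \<in> Obj T"
    unfolding direct_sum_def by blast
  then have "local_dsum y {..<n} xs \<iota> \<pi>"
    unfolding local_dsum_def using n(2) assms(2) by auto
  then show ?thesis by blast
qed

text \<open>The induction eliminates one summand at a time: the equation for \<open>\<psi> j\<close>, in which the coefficient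
  \<open>1 - b j \<iota> j\<close> is invertible, is solved and substituted into the others.\<close>

lemma radical_fixed_zero:
  assumes D: "local_dsum y J xs \<iota> \<pi>" and w: "w \<in> Obj T" and a: "a \<in> hom y y"
    and rad: "\<And>i j. i \<in> J \<Longrightarrow> j \<in> J \<Longrightarrow> \<not> is_iso T (xs j) (xs i) (\<pi> i \<cdot>[xs j,y,xs i] (a \<cdot>[xs j,y,y] \<iota> j))"
    and \<phi>: "\<phi> \<in> hom y w" "\<phi> \<cdot>[y,y,w] a = \<phi>"
  shows "\<phi> = \<zero>[y,w]"
proof -
  have y: "y \<in> Obj T" and J: "finite J" and xs: "\<And>l. l \<in> J \<Longrightarrow> xs l \<in> Obj T" "\<And>l. l \<in> J \<Longrightarrow> local_obj (xs l)"
    and \<iota>: "\<And>l. l \<in> J \<Longrightarrow> \<iota> l \<in> hom (xs l) y" and \<pi>: "\<And>l. l \<in> J \<Longrightarrow> \<pi> l \<in> hom y (xs l)"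
    and one: "hsum y y (\<lambda>l. \<iota> l \<cdot>[y,xs l,y] \<pi> l) J = idm y"
    using D unfolding local_dsum_def by auto
  define \<psi> where "\<psi> i = \<phi> \<cdot>[xs i,y,w] \<iota> i" for i
  have \<psi>: "\<psi> i \<in> hom (xs i) w" if "i \<in> J" for i unfolding \<psi>_def using \<phi>(1) \<iota> xs y w that by simp
  \<comment> \<open>Invariant of the elimination: \<open>\<phi>\<close> is a combination of the
    \<open>\<psi> i\<close> with \<open>i\<close> in \<open>I\<close>, with coefficients whose
    entries between local summands are all non-isomorphisms. It starts from
    \<open>\<phi> = \<phi> a\<close> with \<open>I = J\<close>; for empty \<open>I\<close> it says
    \<open>\<phi> = 0\<close>.\<close>
  have "(\<forall>i\<in>I. b i \<in> hom y (xs i) \<and> (\<forall>l\<in>J. \<not> is_iso T (xs l) (xs i) (b i \<cdot>[xs l,y,xs i] \<iota> l))) \<Longrightarrow>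
      \<phi> = hsum y w (\<lambda>i. \<psi> i \<cdot>[y,xs i,w] b i) I \<Longrightarrow> \<phi> = \<zero>[y,w]" if "finite I" "I \<subseteq> J" for I b
    using that
  proof (induction I arbitrary: b rule: finite_induct)
    case empty
    then show ?case using y w by simp
  next
    case (insert j I)
    then have jJ: "j \<in> J" and IJ: "\<And>i. i \<in> I \<Longrightarrow> i \<in> J" by auto
    have b: "\<And>i. i \<in> insert j I \<Longrightarrow> b i \<in> hom y (xs i)"
      and nb: "\<And>i l. i \<in> insert j I \<Longrightarrow> l \<in> J \<Longrightarrow> \<not> is_iso T (xs l) (xs i) (b i \<cdot>[xs l,y,xs i] \<iota> l)"
      using insert.prems by auto
    note xj = xs[OF jJ] and bj = b[OF insertI1]
    let ?G = "hsum y w (\<lambda>i. \<psi> i \<cdot>[y,xs i,w] b i) I"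
    have G: "?G \<in> hom y w" by (rule hsum_arr) (use y w b IJ xs \<psi> in auto)
    have eq: "\<phi> = (\<psi> j \<cdot>[y,xs j,w] b j) \<oplus>[y,w] ?G"
      using insert.prems(2) hsum_insert[of y w I j "\<lambda>i. \<psi> i \<cdot>[y,xs i,w] b i"] insert.hyps y w b IJ xs \<psi> jJ by auto
    let ?c = "b j \<cdot>[xs j,y,xs j] \<iota> j"
    have cj: "?c \<in> hom (xs j) (xs j)" using bj \<iota>[OF jJ] xj y by simp
    have "\<psi> j = ((\<psi> j \<cdot>[y,xs j,w] b j) \<oplus>[y,w] ?G) \<cdot>[xs j,y,w] \<iota> j"
      using eq unfolding \<psi>_def[of j] by simp
    also have "\<dots> = (\<psi> j \<cdot>[xs j,xs j,w] ?c) \<oplus>[xs j,w] (?G \<cdot>[xs j,y,w] \<iota> j)"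
      using \<psi>[OF jJ] bj G \<iota>[OF jJ] xj(1) y w by (simp add: Cmp_add_left Cmp_assoc)
    finally have 1: "\<psi> j = (\<psi> j \<cdot>[xs j,xs j,w] ?c) \<oplus>[xs j,w] (?G \<cdot>[xs j,y,w] \<iota> j)" .
    have Gj: "?G \<cdot>[xs j,y,w] \<iota> j \<in> hom (xs j) w" using G \<iota>[OF jJ] xj y w by simp
    have \<psi>c: "\<psi> j \<cdot>[xs j,xs j,w] ?c \<in> hom (xs j) w" using \<psi>[OF jJ] cj xj w by simp
    have "?G \<cdot>[xs j,y,w] \<iota> j = \<psi> j \<ominus>[xs j,w] (\<psi> j \<cdot>[xs j,xs j,w] ?c)"
      by (rule eq_mnsI) (use 1 Gj \<psi>c \<psi>[OF jJ] xj w pls_comm in auto)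
    then have 2: "\<psi> j \<cdot>[xs j,xs j,w] (idm (xs j) \<ominus>[xs j,xs j] ?c) = ?G \<cdot>[xs j,y,w] \<iota> j"
      using \<psi>[OF jJ] cj xj(1) w by (simp add: Cmp_mns_right)
    obtain r where r: "r \<in> hom (xs j) (xs j)" "(idm (xs j) \<ominus>[xs j,xs j] ?c) \<cdot>[xs j,xs j,xs j] r = idm (xs j)"
      using local_one_minus[OF xj(2) cj nb[OF insertI1 jJ] xj(1)] by (meson is_isoE)
    have ic: "idm (xs j) \<ominus>[xs j,xs j] ?c \<in> hom (xs j) (xs j)" using cj xj(1) by simp
    have "\<psi> j = \<psi> j \<cdot>[xs j,xs j,w] ((idm (xs j) \<ominus>[xs j,xs j] ?c) \<cdot>[xs j,xs j,xs j] r)"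
      unfolding r(2) using \<psi>[OF jJ] xj(1) w by simp
    also have "\<dots> = (?G \<cdot>[xs j,y,w] \<iota> j) \<cdot>[xs j,xs j,w] r"
      using Cmp_reassoc[OF 2 xj(1) xj(1) xj(1) w r(1) ic \<psi>[OF jJ]] .
    finally have 3: "\<psi> j = (?G \<cdot>[xs j,y,w] \<iota> j) \<cdot>[xs j,xs j,w] r" .
    \<comment> \<open>Substituting the solution \<open>\<psi> j = ?G \<iota>_j r\<close> into
      \<open>\<phi> = \<psi> j b_j + ?G\<close> gives \<open>\<phi> = ?G ?E\<close>.\<close>
    let ?E = "(\<iota> j \<cdot>[y,xs j,y] (r \<cdot>[y,xs j,xs j] b j)) \<oplus>[y,y] idm y"
    have rb: "r \<cdot>[y,xs j,xs j] b j \<in> hom y (xs j)" using r(1) bj xj y by simp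
    have E: "?E \<in> hom y y" using rb \<iota>[OF jJ] xj y by simp
    have "\<phi> = ?G \<cdot>[y,y,w] ?E"
      using eq 3 G \<iota>[OF jJ] r(1) bj xj(1) y w by (simp add: Cmp_add_right Cmp_assoc)
    also have "\<dots> = hsum y w (\<lambda>i. (\<psi> i \<cdot>[y,xs i,w] b i) \<cdot>[y,y,w] ?E) I"
      by (rule Cmp_hsum_left) (use y w E insert.hyps b IJ xs \<psi> in auto)
    also have "\<dots> = hsum y w (\<lambda>i. \<psi> i \<cdot>[y,xs i,w] (b i \<cdot>[y,y,xs i] ?E)) I"
      by (rule hsum_cong) (use y w E b IJ xs \<psi> in \<open>auto simp: Cmp_assoc\<close>)
    finally have 4: "\<phi> = hsum y w (\<lambda>i. \<psi> i \<cdot>[y,xs i,w] (b i \<cdot>[y,y,xs i] ?E)) I" .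
    show ?case
    proof (rule insert.IH[OF _ 4])
      show "I \<subseteq> J" using IJ by blast
      show "\<forall>i\<in>I. b i \<cdot>[y,y,xs i] ?E \<in> hom y (xs i) \<and>
        (\<forall>l\<in>J. \<not> is_iso T (xs l) (xs i) ((b i \<cdot>[y,y,xs i] ?E) \<cdot>[xs l,y,xs i] \<iota> l))"
      proof (intro ballI conjI)
        fix i assume i: "i \<in> I"
        note xi = xs[OF IJ[OF i]] and bi = b[OF insertI2[OF i]]
        show "b i \<cdot>[y,y,xs i] ?E \<in> hom y (xs i)" using bi E xi y by simp
        fix l assume l: "l \<in> J"
        note xl = xs[OF l]
        let ?m = "r \<cdot>[xs l,xs j,xs j] (b j \<cdot>[xs l,y,xs j] \<iota> l)"
        have m: "?m \<in> hom (xs l) (xs j)" using r(1) bj \<iota>[OF l] xl xj y by simp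
        \<comment> \<open>A new coefficient entry is the old one plus a composite through the old
          entry from \<open>xs j\<close> to \<open>xs i\<close>. Both are non-isomorphisms, so the
          invariant survives.\<close>
        have "\<not> is_iso T (xs l) (xs i) ((b i \<cdot>[xs j,y,xs i] \<iota> j) \<cdot>[xs l,xs j,xs i] ?m)"
          by (rule noniso_Cmp[OF xl(1) xj(1) xi(1) xj(2) xi(2) _ nb[OF insertI2[OF i] jJ] m])
            (use bi \<iota>[OF jJ] xi xj y in simp)
        then have "\<not> is_iso T (xs l) (xs i)
            (((b i \<cdot>[xs j,y,xs i] \<iota> j) \<cdot>[xs l,xs j,xs i] ?m) \<oplus>[xs l,xs i] (b i \<cdot>[xs l,y,xs i] \<iota> l))"
          by (rule noniso_sum[OF xl(1) xi(1) xl(2), rotated 1])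
            (use bi \<iota>[OF jJ] \<iota>[OF l] m xi xj xl y nb[OF insertI2[OF i] l] in auto)
        moreover have "(b i \<cdot>[y,y,xs i] ?E) \<cdot>[xs l,y,xs i] \<iota> l =
            ((b i \<cdot>[xs j,y,xs i] \<iota> j) \<cdot>[xs l,xs j,xs i] ?m) \<oplus>[xs l,xs i] (b i \<cdot>[xs l,y,xs i] \<iota> l)"
          using bi \<iota>[OF jJ] \<iota>[OF l] r(1) bj xi(1) xj(1) xl(1) y
          by (simp add: Cmp_add_right Cmp_add_left Cmp_assoc)
        ultimately show "\<not> is_iso T (xs l) (xs i) ((b i \<cdot>[y,y,xs i] ?E) \<cdot>[xs l,y,xs i] \<iota> l)" by simp
      qed
    qed
  qed
  note claim = this[OF J subset_refl, of "\<lambda>i. \<pi> i \<cdot>[y,y,xs i] a"]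
  have ia: "\<iota> i \<cdot>[y,xs i,y] (\<pi> i \<cdot>[y,y,xs i] a) \<in> hom y y" if "i \<in> J" for i
    using \<iota>[OF that] \<pi>[OF that] xs(1)[OF that] a y by simp
  have "a = hsum y y (\<lambda>i. \<iota> i \<cdot>[y,xs i,y] \<pi> i) J \<cdot>[y,y,y] a" unfolding one using a y by simp
  also have "\<dots> = hsum y y (\<lambda>i. (\<iota> i \<cdot>[y,xs i,y] \<pi> i) \<cdot>[y,y,y] a) J"
    by (rule Cmp_hsum_left) (use y a J xs \<iota> \<pi> in auto)
  also have "\<dots> = hsum y y (\<lambda>i. \<iota> i \<cdot>[y,xs i,y] (\<pi> i \<cdot>[y,y,xs i] a)) J"
    by (rule hsum_cong) (use y a xs \<iota> \<pi> ia in \<open>auto simp: Cmp_assoc\<close>)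
  finally have "\<phi> \<cdot>[y,y,w] a = \<phi> \<cdot>[y,y,w] hsum y y (\<lambda>i. \<iota> i \<cdot>[y,xs i,y] (\<pi> i \<cdot>[y,y,xs i] a)) J" by simp
  also have "\<dots> = hsum y w (\<lambda>i. \<phi> \<cdot>[y,y,w] (\<iota> i \<cdot>[y,xs i,y] (\<pi> i \<cdot>[y,y,xs i] a))) J"
    by (rule Cmp_hsum_right) (use y w J \<phi>(1) ia in auto)
  also have "\<dots> = hsum y w (\<lambda>i. \<psi> i \<cdot>[y,xs i,w] (\<pi> i \<cdot>[y,y,xs i] a)) J"
    unfolding \<psi>_def by (rule hsum_cong) (use y w a xs \<iota> \<pi> \<phi>(1) in \<open>auto simp: Cmp_assoc\<close>)
  finally have "\<phi> = hsum y w (\<lambda>i. \<psi> i \<cdot>[y,xs i,w] (\<pi> i \<cdot>[y,y,xs i] a)) J" using \<phi>(2) by simp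
  then show ?thesis
    by (rule claim[rotated]) (use rad \<pi> xs \<iota> a y in \<open>auto simp: Cmp_assoc\<close>)
qed

text \<open>Passing through \<open>e\<close> loses only the \<open>j\<close>-th summand:
  \<open>\<pi> j\<close> kills the other inclusions, and \<open>q\<close> kills
  \<open>\<iota> j\<close>.\<close>

lemma local_dsum_remove:
  assumes D: "local_dsum y J xs \<iota> \<pi>" and j: "j \<in> J" and B: "biprod y (xs j) e (\<iota> j) i (\<pi> j) q"
  shows "local_dsum e (J - {j}) xs (\<lambda>l. q \<cdot>[xs l,y,e] \<iota> l) (\<lambda>l. \<pi> l \<cdot>[e,y,xs l] i)"
proof -
  have y: "y \<in> Obj T" and J: "finite J" and xs: "\<And>l. l \<in> J \<Longrightarrow> xs l \<in> Obj T" "\<And>l. l \<in> J \<Longrightarrow> local_obj (xs l)"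
    and \<iota>: "\<And>l. l \<in> J \<Longrightarrow> \<iota> l \<in> hom (xs l) y" and \<pi>: "\<And>l. l \<in> J \<Longrightarrow> \<pi> l \<in> hom y (xs l)"
    and del: "\<And>l m. l \<in> J \<Longrightarrow> m \<in> J \<Longrightarrow> \<pi> m \<cdot>[xs l,y,xs m] \<iota> l = (if l = m then idm (xs l) else \<zero>[xs l,xs m])"
    and one: "hsum y y (\<lambda>l. \<iota> l \<cdot>[y,xs l,y] \<pi> l) J = idm y"
    using D unfolding local_dsum_def by auto
  have e: "e \<in> Obj T" "i \<in> hom e y" "q \<in> hom y e" and qi: "q \<cdot>[e,y,e] i = idm e" and q\<iota>: "q \<cdot>[xs j,y,e] \<iota> j = \<zero>[xs j,e]"
    and sum: "(\<iota> j \<cdot>[y,xs j,y] \<pi> j) \<oplus>[y,y] (i \<cdot>[y,e,y] q) = idm y"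
    using B unfolding biprod_def by auto
  have \<iota>\<pi>: "\<iota> l \<cdot>[y,xs l,y] \<pi> l \<in> hom y y" if "l \<in> J" for l using \<iota> \<pi> xs y that by simp
  have "(\<pi> m \<cdot>[e,y,xs m] i) \<cdot>[xs l,e,xs m] (q \<cdot>[xs l,y,e] \<iota> l) = (if l = m then idm (xs l) else \<zero>[xs l,xs m])"
    if l: "l \<in> J" "l \<noteq> j" and m: "m \<in> J" "m \<noteq> j" for l m
  proof -
    have z: "\<pi> j \<cdot>[xs l,y,xs j] \<iota> l = \<zero>[xs l,xs j]" using del[OF l(1) j] l by simp
    have "\<pi> m \<cdot>[xs l,y,xs m] \<iota> l = \<pi> m \<cdot>[xs l,y,xs m] (((\<iota> j \<cdot>[y,xs j,y] \<pi> j) \<oplus>[y,y] (i \<cdot>[y,e,y] q)) \<cdot>[xs l,y,y] \<iota> l)"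
      unfolding sum using \<iota> xs y l by simp
    also have "\<dots> = (\<pi> m \<cdot>[e,y,xs m] i) \<cdot>[xs l,e,xs m] (q \<cdot>[xs l,y,e] \<iota> l)"
      using z \<iota>[OF l(1)] \<iota>[OF j] \<pi>[OF j] \<pi>[OF m(1)] e xs(1)[OF l(1)] xs(1)[OF j] xs(1)[OF m(1)] y
      by (simp add: Cmp_add_left Cmp_assoc)
    finally show ?thesis using del[OF l(1) m(1)] by simp
  qed
  moreover have "hsum e e (\<lambda>l. (q \<cdot>[xs l,y,e] \<iota> l) \<cdot>[e,xs l,e] (\<pi> l \<cdot>[e,y,xs l] i)) (J - {j}) = idm e"
  proof -
    let ?s = "hsum y y (\<lambda>l. \<iota> l \<cdot>[y,xs l,y] \<pi> l) (J - {j})"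
    have s: "?s \<in> hom y y" by (rule hsum_arr) (use y \<iota>\<pi> in auto)
    have 1: "idm y = (\<iota> j \<cdot>[y,xs j,y] \<pi> j) \<oplus>[y,y] ?s"
      using hsum_remove[of y y J j "\<lambda>l. \<iota> l \<cdot>[y,xs l,y] \<pi> l"] one y J j \<iota>\<pi> by simp
    have "idm e = q \<cdot>[e,y,e] (((\<iota> j \<cdot>[y,xs j,y] \<pi> j) \<oplus>[y,y] ?s) \<cdot>[e,y,y] i)"
      using e y qi by (simp flip: 1)
    also have "\<dots> = q \<cdot>[e,y,e] (?s \<cdot>[e,y,y] i)"
      using s \<iota>[OF j] \<pi>[OF j] e xs(1)[OF j] y Cmp_reassoc[OF q\<iota>, of e "\<pi> j \<cdot>[e,y,xs j] i"]
      by (simp add: Cmp_add_left Cmp_add_right Cmp_assoc)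
    also have "?s \<cdot>[e,y,y] i = hsum e y (\<lambda>l. (\<iota> l \<cdot>[y,xs l,y] \<pi> l) \<cdot>[e,y,y] i) (J - {j})"
      by (rule Cmp_hsum_left) (use e y J \<iota>\<pi> in auto)
    also have "q \<cdot>[e,y,e] \<dots> = hsum e e (\<lambda>l. q \<cdot>[e,y,e] ((\<iota> l \<cdot>[y,xs l,y] \<pi> l) \<cdot>[e,y,y] i)) (J - {j})"
      by (rule Cmp_hsum_right) (use e y J \<iota>\<pi> in auto)
    also have "\<dots> = hsum e e (\<lambda>l. (q \<cdot>[xs l,y,e] \<iota> l) \<cdot>[e,xs l,e] (\<pi> l \<cdot>[e,y,xs l] i)) (J - {j})"
      by (rule hsum_cong) (use e y xs \<iota> \<pi> in \<open>auto simp: Cmp_assoc\<close>)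
    finally show ?thesis by simp
  qed
  ultimately show ?thesis unfolding local_dsum_def using e J xs \<iota> \<pi> y by auto
qed

end

section \<open>From torsion pairs to cotorsion pairs\<close>

context presilting_category
begin

text \<open>Asking for \<open>null\<close> instead of zero makes this a condition on functors over
  S. With \<open>W\<close> the objects representing torsion-free functors, it is the class of
  objects representing torsion functors.\<close>

definition torsY :: "'o set \<Rightarrow> 'o set" where
  "torsY W = {c \<in> C. \<forall>d\<in>W. \<forall>u\<in>hom c d. null c d u}"

lemma torsY_C: "y \<in> torsY W \<Longrightarrow> y \<in> C" unfolding torsY_def by blast

lemma C_retract:
  assumes "a \<in> Obj T" "b \<in> C" "i \<in> hom a b" "p \<in> hom b a" "p \<cdot>[a,b,a] i = idm a"
  shows "a \<in> C"
proof -
  obtain e j q where "biprod b a e i j p q" by (rule split_mono_complement[of a b i p]) (use assms in auto)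
  then show ?thesis using C_biprod assms(2) by blast
qed

lemma torsY_retract:
  assumes W: "W \<subseteq> C" and a: "a \<in> C" and b: "b \<in> torsY W" and i: "i \<in> hom a b" and p: "p \<in> hom b a" "p \<cdot>[a,b,a] i = idm a"
  shows "a \<in> torsY W"
  unfolding torsY_def
proof (intro CollectI conjI ballI a)
  fix d u assume d: "d \<in> W" and u: "u \<in> hom a d"
  note bC = torsY_C[OF b]
  have dC: "d \<in> C" using W d by blast
  have o: "a \<in> Obj T" "b \<in> Obj T" "d \<in> Obj T" using a bC dC by auto
  have n: "null b d (u \<cdot>[b,a,d] p)" using b d u p(1) o unfolding torsY_def by auto
  show "null a d u"
    unfolding null_def
  proof (intro ballI)
    fix s x assume s: "s \<in> S" and x: "x \<in> hom s a"
    have ix: "i \<cdot>[s,a,b] x \<in> hom s b" using i x s o by simp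
    have "u \<cdot>[s,a,d] x = (u \<cdot>[b,a,d] p) \<cdot>[s,b,d] (i \<cdot>[s,a,b] x)"
      using Cmp_reassoc[OF p(2), of s x] u p(1) i x s o by (simp add: Cmp_assoc)
    then show "u \<cdot>[s,a,d] x = \<zero>[s,d]" using nullD[OF n s ix] by simp
  qed
qed

lemma torsY_sum:
  assumes W: "W \<subseteq> C" and b: "b \<in> C" and fin: "finite I" and ob: "\<And>l. l \<in> I \<Longrightarrow> xs l \<in> torsY W"
    and i: "\<And>l. l \<in> I \<Longrightarrow> i l \<in> hom (xs l) b" and p: "\<And>l. l \<in> I \<Longrightarrow> p l \<in> hom b (xs l)"
    and sum: "hsum b b (\<lambda>l. i l \<cdot>[b,xs l,b] p l) I = idm b"
  shows "b \<in> torsY W"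
  unfolding torsY_def
proof (intro CollectI conjI ballI b)
  fix d u assume d: "d \<in> W" and u: "u \<in> hom b d"
  have dC: "d \<in> C" using W d by blast
  have o: "b \<in> Obj T" "d \<in> Obj T" "\<And>l. l \<in> I \<Longrightarrow> xs l \<in> Obj T" using b dC C_Obj[OF torsY_C[OF ob]] by auto
  show "null b d u"
    unfolding null_def
  proof (intro ballI)
    fix s x assume s: "s \<in> S" and x: "x \<in> hom s b"
    note so = S_Obj[OF s]
    have 1: "i l \<cdot>[b,xs l,b] p l \<in> hom b b" if "l \<in> I" for l using i p o that by simp
    have 2: "i l \<cdot>[s,xs l,b] (p l \<cdot>[s,b,xs l] x) \<in> hom s b" if "l \<in> I" for l using i p o so x that by simp
    have z: "u \<cdot>[s,b,d] (i l \<cdot>[s,xs l,b] (p l \<cdot>[s,b,xs l] x)) = \<zero>[s,d]" if l: "l \<in> I" for l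
    proof -
      have "null (xs l) d (u \<cdot>[xs l,b,d] i l)" using ob[OF l] d u i[OF l] o l unfolding torsY_def by auto
      moreover have "p l \<cdot>[s,b,xs l] x \<in> hom s (xs l)" using p[OF l] x o l so by simp
      ultimately have "(u \<cdot>[xs l,b,d] i l) \<cdot>[s,xs l,d] (p l \<cdot>[s,b,xs l] x) = \<zero>[s,d]" using nullD s by blast
      then show ?thesis using u i[OF l] p[OF l] x o l so by (simp add: Cmp_assoc)
    qed
    have "x = hsum b b (\<lambda>l. i l \<cdot>[b,xs l,b] p l) I \<cdot>[s,b,b] x" unfolding sum using x so o by simp
    also have "\<dots> = hsum s b (\<lambda>l. (i l \<cdot>[b,xs l,b] p l) \<cdot>[s,b,b] x) I"
      by (rule Cmp_hsum_left) (use o so x fin 1 in auto)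
    also have "\<dots> = hsum s b (\<lambda>l. i l \<cdot>[s,xs l,b] (p l \<cdot>[s,b,xs l] x)) I"
      by (rule hsum_cong) (use o so x i p 2 in \<open>auto simp: Cmp_assoc\<close>)
    finally have "u \<cdot>[s,b,d] x = u \<cdot>[s,b,d] hsum s b (\<lambda>l. i l \<cdot>[s,xs l,b] (p l \<cdot>[s,b,xs l] x)) I" by simp
    also have "\<dots> = hsum s d (\<lambda>l. u \<cdot>[s,b,d] (i l \<cdot>[s,xs l,b] (p l \<cdot>[s,b,xs l] x))) I"
      by (rule Cmp_hsum_right) (use o so u fin 2 in auto)
    also have "\<dots> = \<zero>[s,d]" by (rule hsum_zer) (use o so z in auto)
    finally show "u \<cdot>[s,b,d] x = \<zero>[s,d]" .
  qed
qed

lemma torsY_biprod: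
  assumes W: "W \<subseteq> C" and B: "biprod x a b i j p q" and ab: "a \<in> torsY W" "b \<in> torsY W"
  shows "x \<in> torsY W"
proof -
  have "x \<in> C" using C_ext[OF biprod_tri[OF B]] torsY_C ab by blast
  have B': "x \<in> Obj T" "a \<in> Obj T" "b \<in> Obj T" "i \<in> hom a x" "j \<in> hom b x" "p \<in> hom x a" "q \<in> hom x b"
    "(i \<cdot>[x,a,x] p) \<oplus>[x,x] (j \<cdot>[x,b,x] q) = idm x" using B unfolding biprod_def by auto
  let ?xs = "\<lambda>n::nat. if n = 0 then a else b" and ?i = "\<lambda>n::nat. if n = 0 then i else j"
    and ?p = "\<lambda>n::nat. if n = 0 then p else q"
  have "hsum x x (\<lambda>l. ?i l \<cdot>[x,?xs l,x] ?p l) {..<2} = idm x"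
    using hsum_2[of x x "\<lambda>l. ?i l \<cdot>[x,?xs l,x] ?p l"] B' by simp
  then show ?thesis
    by (rule torsY_sum[OF W \<open>x \<in> C\<close>, of "{..<2}" ?xs ?i ?p, rotated 4]) (use ab B' in auto)
qed

text \<open>These objects have no nonzero S-points, so they represent the zero functor. Thus
  \<open>sh a1\<close> may be added to approximations, and orthogonality to \<open>torsY W\<close>
  includes \<open>T(x, Sh Sh S) = 0\<close>.\<close>

lemma S1_torsY: "W \<subseteq> C \<Longrightarrow> t \<in> S1 \<Longrightarrow> t \<in> torsY W"
proof -
  assume W: "W \<subseteq> C" and t: "t \<in> S1"
  have "u \<cdot>[s,t,d] x = \<zero>[s,d]" if "d \<in> W" "u \<in> hom t d" "s \<in> S" "x \<in> hom s t" for d u s x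
  proof -
    have "d \<in> Obj T" "x = \<zero>[s,t]" using that W vanD[OF van_S_S1[OF that(3) t]] by auto
    then show ?thesis using that t by simp
  qed
  then show ?thesis unfolding torsY_def null_def using S1_C[OF t] by blast
qed

lemma torsY_ext:
  assumes W: "W \<subseteq> C" and t: "(a, b, c, f, g, h) \<in> Tri T" and ac: "a \<in> torsY W" "c \<in> torsY W"
  shows "b \<in> torsY W"
proof -
  note o = Tri_arr[OF t]
  have aC: "a \<in> C" and cC: "c \<in> C" using ac torsY_C by auto
  have bC: "b \<in> C" using C_ext[OF triI[OF t] aC cC] .
  have on: "onto b c g" using onto_Tri[OF t] van_S_sh_C aC by blast
  note ex = pexact_Tri[OF t]
  show ?thesis
    unfolding torsY_def
  proof (intro CollectI conjI ballI bC)
    fix d u assume d: "d \<in> W" and u: "u \<in> hom b d"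
    have dC: "d \<in> C" using W d by blast
    note do = C_Obj[OF dC]
    have n: "null a d (u \<cdot>[a,b,d] f)" using ac(1) d u o do unfolding torsY_def by auto
    have uf: "u \<cdot>[s,b,d] (f \<cdot>[s,a,b] z) = \<zero>[s,d]" if "s \<in> S" "z \<in> hom s a" for s z
      using nullD[OF n that] u o do that by (simp add: Cmp_assoc)
    obtain v where v: "v \<in> hom c d" "\<And>s y. s \<in> S \<Longrightarrow> y \<in> hom s b \<Longrightarrow> u \<cdot>[s,b,d] y = v \<cdot>[s,c,d] (g \<cdot>[s,b,c] y)"
      by (rule factor_coker[OF aC bC cC dC _ _ on ex u uf]) (use o in blast)+
    have "null c d v" using ac(2) d v(1) unfolding torsY_def by blast
    then show "null b d u" unfolding null_def using v(2) o by simp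
  qed
qed

section \<open>Left approximations and their minimal versions\<close>

definition approx :: "'o set \<Rightarrow> 'o \<Rightarrow> 'o \<Rightarrow> 'm \<Rightarrow> bool" where
  "approx Y c y f \<longleftrightarrow> y \<in> Y \<and> f \<in> hom c y \<and> (\<forall>y'\<in>Y. \<forall>u\<in>hom c y'. \<exists>e\<in>hom y y'. u = e \<cdot>[c,y,y'] f)"

text \<open>The hypothesis says that \<open>f\<close> approximates on the level of functors. A null
  error term kills \<open>p : a0 -> c\<close>, so it factors through \<open>h : c -> sh a1\<close>;
  the additional component \<open>sh a1\<close> absorbs it.\<close>

lemma approx_from_null:
  assumes W: "W \<subseteq> C" and c: "c \<in> C" and y: "y \<in> torsY W" and f: "f \<in> hom c y"
    and ap: "\<And>y' u. y' \<in> torsY W \<Longrightarrow> u \<in> hom c y' \<Longrightarrow> \<exists>e\<in>hom y y'. null c y' (u \<ominus>[c,y'] (e \<cdot>[c,y,y'] f))"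
  shows "\<exists>y1 f1. approx (torsY W) c y1 f1"
proof -
  obtain a1 a0 f0 p h where a: "a1 \<in> S" "a0 \<in> S" "(a1, a0, c, f0, p, h) \<in> Tri T" "f0 \<in> hom a1 a0"
    "p \<in> hom a0 c" "onto a0 c p" "h \<in> hom c (sh a1)" by (rule C_pres[OF c]) blast
  have o: "a1 \<in> Obj T" "a0 \<in> Obj T" "c \<in> Obj T" "y \<in> Obj T" "sh a1 \<in> Obj T" using a c torsY_C[OF y] by auto
  have "\<exists>x. direct_sum T x 2 (\<lambda>n. if n = 0 then y else sh a1)" by (rule direct_sum_exists) (use o in auto)
  then obtain y1 i j P Q where B: "biprod y1 y (sh a1) i j P Q" using direct_sum_2 by metis
  then have B': "y1 \<in> Obj T" "i \<in> hom y y1" "j \<in> hom (sh a1) y1" "P \<in> hom y1 y" "Q \<in> hom y1 (sh a1)"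
    and e: "P \<cdot>[y,y1,y] i = idm y" "Q \<cdot>[sh a1,y1,sh a1] j = idm (sh a1)"
    "Q \<cdot>[y,y1,sh a1] i = \<zero>[y,sh a1]" "P \<cdot>[sh a1,y1,y] j = \<zero>[sh a1,y]"
    unfolding biprod_def by auto
  have y1: "y1 \<in> torsY W" using torsY_biprod[OF W B y S1_torsY[OF W sh_S1[OF a(1)]]] .
  let ?f = "(i \<cdot>[c,y,y1] f) \<oplus>[c,y1] (j \<cdot>[c,sh a1,y1] h)"
  have Pf: "P \<cdot>[c,y1,y] ?f = f" and Qf: "Q \<cdot>[c,y1,sh a1] ?f = h"
    using B' f a(7) o by (simp_all add: Cmp_add_right Cmp_reassoc[OF e(1)] Cmp_reassoc[OF e(2)]
      Cmp_reassoc[OF e(3)] Cmp_reassoc[OF e(4)])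
  have f1: "?f \<in> hom c y1" using B' f a(7) o by simp
  have "\<exists>e\<in>hom y1 y'. u = e \<cdot>[c,y1,y'] ?f" if y': "y' \<in> torsY W" and u: "u \<in> hom c y'" for y' u
  proof -
    note yo = C_Obj[OF torsY_C[OF y']]
    obtain e where e: "e \<in> hom y y'" "null c y' (u \<ominus>[c,y'] (e \<cdot>[c,y,y'] f))" using ap[OF y' u] by blast
    let ?d = "u \<ominus>[c,y'] (e \<cdot>[c,y,y'] f)"
    have d: "?d \<in> hom c y'" using u e(1) f o yo by simp
    obtain v where v: "v \<in> hom (sh a1) y'" "?d = v \<cdot>[c,sh a1,y'] h"
      by (rule weak_cokernel[OF Tri_rot[OF a(3)] yo d nullD[OF e(2) a(2,5)]])
    have "u = (e \<cdot>[c,y,y'] f) \<oplus>[c,y'] ?d" using u e(1) f o yo by simp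
    also have "\<dots> = ((e \<cdot>[y1,y,y'] P) \<oplus>[y1,y'] (v \<cdot>[y1,sh a1,y'] Q)) \<cdot>[c,y1,y'] ?f"
      unfolding v(2) using Pf Qf f1 B' e(1) v(1) o yo by (simp add: Cmp_add_left Cmp_assoc del: Cmp_add_right)
    finally have "u = ((e \<cdot>[y1,y,y'] P) \<oplus>[y1,y'] (v \<cdot>[y1,sh a1,y'] Q)) \<cdot>[c,y1,y'] ?f" .
    moreover have "(e \<cdot>[y1,y,y'] P) \<oplus>[y1,y'] (v \<cdot>[y1,sh a1,y'] Q) \<in> hom y1 y'" using B' e(1) v(1) o yo by simp
    ultimately show ?thesis by blast
  qed
  then show ?thesis unfolding approx_def using y1 f1 by blast
qed

text \<open>An invertible entry of \<open>a\<close> allows one component of \<open>a f = 0\<close>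
  to be solved for the component of \<open>f\<close> in \<open>xs j\<close>. That component then
  factors through the rest of \<open>f\<close>, so \<open>xs j\<close> can be discarded.\<close>

lemma approx_remove:
  assumes W: "W \<subseteq> C" and c: "c \<in> C" and ap: "approx (torsY W) c y f" and D: "local_dsum y J xs \<iota> \<pi>"
    and ij: "i \<in> J" "j \<in> J" and a: "a \<in> hom y y" "a \<cdot>[c,y,y] f = \<zero>[c,y]"
    and iso: "is_iso T (xs j) (xs i) (\<pi> i \<cdot>[xs j,y,xs i] (a \<cdot>[xs j,y,y] \<iota> j))"
  shows "\<exists>y' f' \<iota>' \<pi>'. approx (torsY W) c y' f' \<and> local_dsum y' (J - {j}) xs \<iota>' \<pi>'"
proof -
  have y: "y \<in> torsY W" and f: "f \<in> hom c y" using ap unfolding approx_def by auto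
  have o: "c \<in> Obj T" "y \<in> Obj T" "xs i \<in> Obj T" "xs j \<in> Obj T" and h: "\<pi> i \<in> hom y (xs i)" "\<pi> j \<in> hom y (xs j)"
    "\<iota> j \<in> hom (xs j) y" "\<pi> j \<cdot>[xs j,y,xs j] \<iota> j = idm (xs j)"
    using c D ij unfolding local_dsum_def by auto
  obtain e l q where B: "biprod y (xs j) e (\<iota> j) l (\<pi> j) q"
    by (rule split_mono_complement[OF o(4,2) h(3,2,4)])
  then have e: "e \<in> Obj T" "l \<in> hom e y" "q \<in> hom y e" "q \<cdot>[e,y,e] l = idm e"
    and sum: "(\<iota> j \<cdot>[y,xs j,y] \<pi> j) \<oplus>[y,y] (l \<cdot>[y,e,y] q) = idm y" unfolding biprod_def by auto
  have eC: "e \<in> C" by (rule C_retract[OF e(1) torsY_C[OF y] e(2-4)])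
  have eY: "e \<in> torsY W" by (rule torsY_retract[OF W eC y e(2-4)])
  let ?f = "q \<cdot>[c,y,e] f" and ?g = "\<pi> j \<cdot>[c,y,xs j] f"
  let ?b = "\<pi> i \<cdot>[xs j,y,xs i] (a \<cdot>[xs j,y,y] \<iota> j)"
  have f': "?f \<in> hom c e" and g: "?g \<in> hom c (xs j)" and b: "?b \<in> hom (xs j) (xs i)" using e f h a o by auto
  have ff: "f = (\<iota> j \<cdot>[c,xs j,y] ?g) \<oplus>[c,y] (l \<cdot>[c,e,y] ?f)"
  proof -
    have "f = ((\<iota> j \<cdot>[y,xs j,y] \<pi> j) \<oplus>[y,y] (l \<cdot>[y,e,y] q)) \<cdot>[c,y,y] f" unfolding sum using f o by simp
    then show ?thesis using e f h o by (simp add: Cmp_add_left Cmp_assoc)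
  qed
  obtain t where t: "t \<in> hom (xs i) (xs j)" "t \<cdot>[xs j,xs i,xs j] ?b = idm (xs j)" using iso by (meson is_isoE)
  let ?m = "\<pi> i \<cdot>[e,y,xs i] (a \<cdot>[e,y,y] l)"
  have m: "?m \<in> hom e (xs i)" using h a e o by simp
  have 0: "(?b \<cdot>[c,xs j,xs i] ?g) \<oplus>[c,xs i] (?m \<cdot>[c,e,xs i] ?f) = \<zero>[c,xs i]"
  proof -
    have "\<pi> i \<cdot>[c,y,xs i] (a \<cdot>[c,y,y] ((\<iota> j \<cdot>[c,xs j,y] ?g) \<oplus>[c,y] (l \<cdot>[c,e,y] ?f))) = \<zero>[c,xs i]"
      unfolding ff[symmetric] a(2) using h o by simp
    then show ?thesis using h(1,3) a(1) e(1-3) g f' o by (simp add: Cmp_add_right Cmp_assoc)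
  qed
  \<comment> \<open>The \<open>xs i\<close> component of \<open>a f = 0\<close> reads
    \<open>?b ?g + ?m ?f = 0\<close>. As \<open>t\<close> is a left inverse of \<open>?b\<close>,
    this solves to \<open>?g = w ?f\<close>.\<close>
  define w where "w = neg e (xs j) (t \<cdot>[e,xs i,xs j] ?m)"
  have w: "w \<in> hom e (xs j)" unfolding w_def using t(1) m e o by simp
  have bg: "?b \<cdot>[c,xs j,xs i] ?g \<in> hom c (xs i)" and mf: "?m \<cdot>[c,e,xs i] ?f \<in> hom c (xs i)"
    using b g m f' o e by simp_all
  have "?b \<cdot>[c,xs j,xs i] ?g = neg c (xs i) (?m \<cdot>[c,e,xs i] ?f)"
    by (rule neg_unique) (use 0 bg mf o pls_comm in auto)
  then have "t \<cdot>[c,xs i,xs j] (?b \<cdot>[c,xs j,xs i] ?g) = w \<cdot>[c,e,xs j] ?f"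
    unfolding w_def using t(1) m f' mf e(1) o
    by (simp only: Cmp_neg_left Cmp_neg_right Cmp_arr Cmp_assoc)
  then have gw: "?g = w \<cdot>[c,e,xs j] ?f" using Cmp_reassoc[OF t(2) o(1) o(4) o(3) o(4) g b t(1)] g o by simp
  let ?k = "(\<iota> j \<cdot>[e,xs j,y] w) \<oplus>[e,y] l"
  have k: "?k \<in> hom e y" using h w e o by simp
  have fk: "f = ?k \<cdot>[c,e,y] ?f"
    using ff unfolding gw using h(3) w e(1,2) f' o by (simp add: Cmp_add_left Cmp_assoc)
  have "\<exists>v\<in>hom e y'. u = v \<cdot>[c,e,y'] ?f" if y': "y' \<in> torsY W" and u: "u \<in> hom c y'" for y' u
  proof -
    note yo = C_Obj[OF torsY_C[OF y']]
    obtain v where v: "v \<in> hom y y'" "u = v \<cdot>[c,y,y'] f" using ap y' u unfolding approx_def by blast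
    have "u = v \<cdot>[c,y,y'] (?k \<cdot>[c,e,y] ?f)" using v(2) fk by simp
    also have "\<dots> = (v \<cdot>[e,y,y'] ?k) \<cdot>[c,e,y'] ?f"
      by (rule Cmp_assoc[symmetric]) (use v(1) k f' o e yo in auto)
    finally have "u = (v \<cdot>[e,y,y'] ?k) \<cdot>[c,e,y'] ?f" .
    moreover have "v \<cdot>[e,y,y'] ?k \<in> hom e y'" by (rule Cmp_arr) (use v(1) k o e yo in auto)
    ultimately show ?thesis by blast
  qed
  then have "approx (torsY W) c e ?f" unfolding approx_def using eY f' by blast
  then show ?thesis using local_dsum_remove[OF D ij(2) B] by blast
qed

text \<open>Take an approximation with the fewest local summands. By \<open>approx_remove\<close> no
  entry of an \<open>a\<close> with \<open>a f = 0\<close> is invertible, so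
  \<open>radical_fixed_zero\<close> applies. In terms of \<open>e = idm y - a\<close>, every
  \<open>e\<close> with \<open>e f = f\<close> is an epimorphism.\<close>

lemma minimal_approx:
  assumes KS: "Krull_Schmidt T" and W: "W \<subseteq> C" and c: "c \<in> C" and ex: "\<exists>y f. approx (torsY W) c y f"
  obtains y f where "approx (torsY W) c y f"
    "\<And>a w \<phi>. a \<in> hom y y \<Longrightarrow> a \<cdot>[c,y,y] f = \<zero>[c,y] \<Longrightarrow> w \<in> Obj T \<Longrightarrow> \<phi> \<in> hom y w \<Longrightarrow> \<phi> \<cdot>[y,y,w] a = \<phi> \<Longrightarrow> \<phi> = \<zero>[y,w]"
proof -
  define P where "P n \<longleftrightarrow> (\<exists>y f J xs \<iota> \<pi>. approx (torsY W) c y f \<and> local_dsum y J xs \<iota> \<pi> \<and> card J = n)" for n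
  obtain y0 f0 where y0: "approx (torsY W) c y0 f0" using ex by blast
  then have "y0 \<in> Obj T" unfolding approx_def using torsY_C by auto
  then obtain J0 xs0 \<iota>0 \<pi>0 where "local_dsum y0 J0 xs0 \<iota>0 \<pi>0" using Krull_Schmidt_local_dsum[OF KS] by blast
  then have "P (card J0)" unfolding P_def using y0 by blast
  then obtain n where n: "P n" "\<And>m. m < n \<Longrightarrow> \<not> P m" using exists_least_iff[of P] by blast
  obtain y f J xs \<iota> \<pi> where ap: "approx (torsY W) c y f" and D: "local_dsum y J xs \<iota> \<pi>" and J: "card J = n"
    using n(1) unfolding P_def by blast
  have fin: "finite J" using D unfolding local_dsum_def by blast
  have "\<phi> = \<zero>[y,w]" if a: "a \<in> hom y y" "a \<cdot>[c,y,y] f = \<zero>[c,y]" and w: "w \<in> Obj T" and \<phi>: "\<phi> \<in> hom y w" "\<phi> \<cdot>[y,y,w] a = \<phi>" for a w \<phi>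
  proof (rule radical_fixed_zero[OF D w a(1) _ \<phi>])
    fix i j assume ij: "i \<in> J" "j \<in> J"
    show "\<not> is_iso T (xs j) (xs i) (\<pi> i \<cdot>[xs j,y,xs i] (a \<cdot>[xs j,y,y] \<iota> j))"
    proof
      assume "is_iso T (xs j) (xs i) (\<pi> i \<cdot>[xs j,y,xs i] (a \<cdot>[xs j,y,y] \<iota> j))"
      from approx_remove[OF W c ap D ij a this] have "P (card (J - {j}))" unfolding P_def by blast
      moreover have "card (J - {j}) < n" using J fin ij(2) by (metis card_Diff1_less)
      ultimately show False using n(2) by blast
    qed
  qed
  with ap show ?thesis using that by blast
qed

text \<open>Wakamatsu's lemma for a minimal approximation f with cone x: a morphism \<open>\<delta>\<close> from x to \<open>\<Sigma>y'\<close> composed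
  with \<open>y \<rightarrow> x\<close> classifies an extension of y by y'. As f lifts to that extension and the lift
  factors through f, minimality forces the extension to split.\<close>

lemma cone_minimal_approx:
  assumes W: "W \<subseteq> C" and c: "c \<in> C" and ap: "approx (torsY W) c y f"
    and min: "\<And>a w \<phi>. a \<in> hom y y \<Longrightarrow> a \<cdot>[c,y,y] f = \<zero>[c,y] \<Longrightarrow> w \<in> Obj T \<Longrightarrow> \<phi> \<in> hom y w \<Longrightarrow>
      \<phi> \<cdot>[y,y,w] a = \<phi> \<Longrightarrow> \<phi> = \<zero>[y,w]"
    and t: "(c, y, x, f, g, h) \<in> Tri T" and y': "y' \<in> torsY W"
  shows "van x (sh y')"
proof -
  note o = Tri_arr[OF t] C_Obj[OF torsY_C[OF y']]
  have y: "y \<in> torsY W" using ap unfolding approx_def by blast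
  show ?thesis
  proof (rule vanI)
    fix \<delta> assume \<delta>: "\<delta> \<in> hom x (sh y')"
    let ?\<phi> = "\<delta> \<cdot>[y,x,sh y'] g"
    have \<phi>: "?\<phi> \<in> hom y (sh y')" using \<delta> o by simp
    obtain z \<alpha> \<beta> where tz: "(y', z, y, \<alpha>, \<beta>, ?\<phi>) \<in> Tri T" by (rule Tri_fibre[OF _ _ \<phi>]) (use o in auto)
    note oz = Tri_arr[OF tz]
    have z: "z \<in> torsY W" by (rule torsY_ext[OF W tz y' y])
    have "?\<phi> \<cdot>[c,y,sh y'] f = \<zero>[c,sh y']"
      using Tri_zero_1[OF t] \<delta> o by (simp add: Cmp_assoc)
    then obtain f' where f': "f' \<in> hom c z" "f = \<beta> \<cdot>[c,z,y] f'"
      using weak_kernel[OF Tri_rot[OF tz], of c f] o by metis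
    obtain e where e: "e \<in> hom y z" "f' = e \<cdot>[c,y,z] f" using ap z f'(1) unfolding approx_def by blast
    let ?a = "idm y \<ominus>[y,y] (\<beta> \<cdot>[y,z,y] e)"
    have a: "?a \<in> hom y y" using e oz by simp
    have bef: "\<beta> \<cdot>[c,z,y] (e \<cdot>[c,y,z] f) = f" using e(2) f'(2) by simp
    have "?a \<cdot>[c,y,y] f = \<zero>[c,y]"
      using bef e(1) o oz by (simp add: Cmp_mns_left Cmp_assoc)
    moreover have "?\<phi> \<cdot>[y,y,sh y'] ?a = ?\<phi>"
      using \<phi> e(1) o oz Cmp_reassoc[OF Tri_zero_2[OF tz], of y e] by (simp add: Cmp_mns_right)
    ultimately have \<phi>0: "?\<phi> = \<zero>[y,sh y']" using min[OF a] \<phi> o by simp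
    \<comment> \<open>Now \<open>\<delta>\<close> factors through \<open>h\<close> as the shift of
      some \<open>v : c -> y'\<close>. The approximation property factors \<open>v\<close> through
      \<open>f\<close>, and the shift of \<open>f\<close> kills \<open>h\<close>.\<close>
    obtain V where V: "V \<in> hom (sh c) (sh y')" "\<delta> = V \<cdot>[x,sh c,sh y'] h"
      by (rule weak_cokernel[OF Tri_rot[OF t] _ \<delta> \<phi>0]) (use o in auto)
    obtain v where v: "v \<in> hom c y'" "V = shm c y' v" by (rule shm_surj[OF _ _ V(1)]) (use o in auto)
    obtain m where m: "m \<in> hom y y'" "v = m \<cdot>[c,y,y'] f" using ap y' v(1) unfolding approx_def by blast
    show "\<delta> = \<zero>[x,sh y']"
      using V(2) v(2) m o Tri_zero_3[OF t] by (simp add: ShM_Cmp Cmp_assoc)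
  qed (use o in auto)
qed

text \<open>Octahedra present \<open>x\<close> as an extension of \<open>sh (sh a1)\<close> by
  \<open>p\<close>, with \<open>p\<close> an extension of \<open>sh a0\<close> by \<open>y\<close>
  and so in C. The map \<open>x -> sh (sh a1)\<close> is zero by hypothesis, hence \<open>x\<close>
  is a retract of \<open>p\<close>.\<close>

lemma cone_in_C:
  assumes t: "tri c y x" and c: "c \<in> C" and y: "y \<in> C" and v: "\<And>s. s \<in> S \<Longrightarrow> van x (sh (sh s))"
  shows "x \<in> C"
proof -
  obtain a1 a0 where a: "a1 \<in> S" "a0 \<in> S" "tri a1 a0 c" by (rule C_triE[OF c])
  have o: "a1 \<in> Obj T" "a0 \<in> Obj T" "c \<in> Obj T" "x \<in> Obj T" using a t tri_Obj by auto
  have 1: "tri y x (sh c)" using t tri_rot[of c y x] o by blast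
  have "tri a0 c (sh a1)" using a(3) tri_rot[of a1 a0 c] o by blast
  then have 2: "tri (sh a0) (sh c) (sh (sh a1))" using tri_sh[of a0 c "sh a1"] o by simp
  obtain p where p: "tri p x (sh (sh a1))" "tri y p (sh a0)" by (rule octa_dual[OF 1 2])
  have pC: "p \<in> C" by (rule C_ext[OF p(2) y S1_C[OF sh_S1[OF a(2)]]])
  obtain f g h where t': "(p, x, sh (sh a1), f, g, h) \<in> Tri T" using p(1) unfolding tri_def by blast
  note o' = Tri_arr[OF t']
  have "g \<cdot>[x,x,sh (sh a1)] idm x = \<zero>[x,sh (sh a1)]" using vanD[OF v[OF a(1)]] o' by simp
  then obtain w where w: "w \<in> hom x p" "idm x = f \<cdot>[x,p,x] w" using weak_kernel[OF t' o(4)] o' Idm_arr by metis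
  show ?thesis by (rule C_retract[OF o(4) pC w(1) _ w(2)[symmetric]]) (use o' in blast)
qed

theorem cotorsion_of_torsY:
  assumes KS: "Krull_Schmidt T" and W: "W \<subseteq> C" and ap: "\<And>c. c \<in> C \<Longrightarrow> \<exists>y f. approx (torsY W) c y f"
  shows "complete_cotorsion_pair T C (perpL (torsY W)) (torsY W)"
proof -
  let ?Y = "torsY W" and ?X = "perpL (torsY W)"
  have left: "\<exists>y\<in>?Y. \<exists>x\<in>?X. tri c y x" if c: "c \<in> C" for c
  proof -
    obtain y f where A: "approx ?Y c y f" and min: "\<And>a w \<phi>. a \<in> hom y y \<Longrightarrow> a \<cdot>[c,y,y] f = \<zero>[c,y] \<Longrightarrow>
        w \<in> Obj T \<Longrightarrow> \<phi> \<in> hom y w \<Longrightarrow> \<phi> \<cdot>[y,y,w] a = \<phi> \<Longrightarrow> \<phi> = \<zero>[y,w]"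
      by (rule minimal_approx[OF KS W c ap[OF c]]) blast
    then have y: "y \<in> ?Y" "f \<in> hom c y" unfolding approx_def by auto
    obtain x g h where t: "(c, y, x, f, g, h) \<in> Tri T" 
      using Tri_cone[of c y f] C_Obj[OF c] C_Obj[OF torsY_C[OF y(1)]] y(2) by blast
    have v: "van x (sh y')" if "y' \<in> ?Y" for y' by (rule cone_minimal_approx[OF W c A min t that])
    \<comment> \<open>Orthogonality of \<open>x\<close> to the objects \<open>sh s\<close>, which
      belong to \<open>?Y\<close>, is the vanishing required by \<open>cone_in_C\<close>.\<close>
    have "x \<in> C"
      by (rule cone_in_C[OF triI[OF t] c torsY_C[OF y(1)]]) (use v S1_torsY[OF W sh_S1] in blast)
    then have "x \<in> ?X" using v unfolding perpL_def by blast
    then show ?thesis using y(1) triI[OF t] by blast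
  qed
  have right: "\<exists>y\<in>?Y. \<exists>x\<in>?X. tri y x c" if c: "c \<in> C" for c
  proof -
    obtain a1 a0 where a: "a1 \<in> S" "a0 \<in> S" "tri a1 a0 c" by (rule C_triE[OF c])
    obtain y x where yx: "y \<in> ?Y" "x \<in> ?X" "tri a1 y x" using left[OF S_C[OF a(1)]] by blast
    have xC: "x \<in> C" using yx(2) unfolding perpL_def by blast
    have o: "a1 \<in> Obj T" "a0 \<in> Obj T" "c \<in> Obj T" "x \<in> Obj T" "y \<in> Obj T" using a yx tri_Obj by auto
    have 1: "tri c (sh a1) (sh a0)" using a(3) tri_rot[of a1 a0 c] tri_rot[of a0 c "sh a1"] o by simp
    have 2: "tri (sh a1) (sh y) (sh x)" using yx(3) tri_sh o by simp
    \<comment> \<open>The pushout appears shifted: the cone of \<open>c -> sh a1 -> sh y\<close> is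
      \<open>sh e\<close>. Undoing the shift gives the triangles \<open>y -> e -> c\<close> and
      \<open>a0 -> e -> x\<close>; the second shows that \<open>e\<close> is in C and left
      orthogonal to \<open>?Y\<close>.\<close>
    obtain E where E: "tri c (sh y) E" "tri (sh a0) E (sh x)" by (rule octa[OF 1 2])
    obtain e where e: "e \<in> Obj T" "isos (sh e) E" by (rule isos_sh_ex[of E]) (use E tri_Obj in blast)
    have "tri c (sh y) (sh e)" by (rule tri_isos[OF E(1) _ _ isos_sym[OF e(2)]]) (use o in auto)
    then have 3: "tri y e c" using tri_rot[of y e c] tri_rot[of e c "sh y"] o e by simp
    have "tri (sh a0) (sh e) (sh x)" by (rule tri_isos[OF E(2) _ isos_sym[OF e(2)]]) (use o in auto)
    then have 4: "tri a0 e x" using tri_sh o e by simp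
    have eC: "e \<in> C" by (rule C_ext[OF 4 S_C[OF a(2)] xC])
    have "van e (sh y')" if y': "y' \<in> ?Y" for y'
      by (rule tri_van_left[OF 4]) (use y' torsY_C[OF y'] van_S_sh_C[OF a(2)] yx(2) in \<open>auto simp: perpL_def\<close>)
    then have "e \<in> ?X" unfolding perpL_def using eC by blast
    then show ?thesis using yx(1) 3 by blast
  qed
  have CO: "C \<subseteq> Obj T" by auto
  have ds: "x \<in> C" "\<forall>l<n. xs l \<in> C" "\<exists>i p. (\<forall>l<n. i l \<in> hom (xs l) x \<and> p l \<in> hom x (xs l) \<and> p l \<cdot>[xs l,x,xs l] i l = idm (xs l)) \<and>
      hsum x x (\<lambda>l. i l \<cdot>[x,xs l,x] p l) {..<n} = idm x"
    if d: "direct_sum (full_sub T C) x n xs" for x n xs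
  proof -
    have d': "x \<in> C" "\<forall>l<n. xs l \<in> C" "direct_sum T x n xs" using d direct_sum_full_sub[OF CO] by auto
    then show "x \<in> C" "\<forall>l<n. xs l \<in> C" by auto
    obtain i p where ip: "\<forall>l<n. i l \<in> hom (xs l) x \<and> p l \<in> hom x (xs l)"
      "\<forall>l<n. \<forall>m<n. p m \<cdot>[xs l,x,xs m] i l = (if l = m then idm (xs l) else \<zero>[xs l,xs m])"
      "hsum x x (\<lambda>l. i l \<cdot>[x,xs l,x] p l) {..<n} = idm x"
      using d'(3) unfolding direct_sum_def by blast
    show "\<exists>i p. (\<forall>l<n. i l \<in> hom (xs l) x \<and> p l \<in> hom x (xs l) \<and> p l \<cdot>[xs l,x,xs l] i l = idm (xs l)) \<and>
      hsum x x (\<lambda>l. i l \<cdot>[x,xs l,x] p l) {..<n} = idm x"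
      using ip by (intro exI[of _ i] exI[of _ p]) auto
  qed
  have "additive_summand_closed (full_sub T C) ?Y"
    unfolding additive_summand_closed_def
  proof (intro conjI allI impI)
    show "?Y \<subseteq> Obj (full_sub T C)" using torsY_C by (auto simp: full_sub_def)
    fix x n xs
    { assume A: "direct_sum (full_sub T C) x n xs \<and> (\<forall>i<n. xs i \<in> ?Y)"
      obtain i p where ip: "\<forall>l<n. i l \<in> hom (xs l) x \<and> p l \<in> hom x (xs l) \<and> p l \<cdot>[xs l,x,xs l] i l = idm (xs l)"
        "hsum x x (\<lambda>l. i l \<cdot>[x,xs l,x] p l) {..<n} = idm x" using ds(3)[OF conjunct1[OF A]] by blast
      have "x \<in> C" using A ds(1) by blast
      show "x \<in> ?Y" by (rule torsY_sum[OF W \<open>x \<in> C\<close> _ _ _ _ ip(2)]) (use A ip(1) in auto) }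
    fix l assume A: "direct_sum (full_sub T C) x n xs \<and> x \<in> ?Y" and l: "l < n"
    obtain i p where ip: "\<forall>l<n. i l \<in> hom (xs l) x \<and> p l \<in> hom x (xs l) \<and> p l \<cdot>[xs l,x,xs l] i l = idm (xs l)"
      using ds(3)[OF conjunct1[OF A]] by blast
    show "xs l \<in> ?Y" using torsY_retract[OF W, of "xs l" x "i l" "p l"] A ip l ds(2) by blast
  qed
  moreover have "additive_summand_closed (full_sub T C) ?X"
    unfolding additive_summand_closed_def
  proof (intro conjI allI impI)
    show "?X \<subseteq> Obj (full_sub T C)" unfolding perpL_def by (auto simp: full_sub_def)
    fix x n xs
    { assume A: "direct_sum (full_sub T C) x n xs \<and> (\<forall>i<n. xs i \<in> ?X)"
      obtain i p where ip: "\<forall>l<n. i l \<in> hom (xs l) x \<and> p l \<in> hom x (xs l) \<and> p l \<cdot>[xs l,x,xs l] i l = idm (xs l)"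
        "hsum x x (\<lambda>l. i l \<cdot>[x,xs l,x] p l) {..<n} = idm x" using ds(3)[OF conjunct1[OF A]] by blast
      have xC: "x \<in> C" using A ds(1) by blast
      have xo: "\<And>l. l < n \<Longrightarrow> xs l \<in> Obj T" using A ds(2) by auto
      have "van x (sh y)" if y: "y \<in> ?Y" for y
      proof (rule vanI)
        note yo = C_Obj[OF torsY_C[OF y]]
        fix u assume u: "u \<in> hom x (sh y)"
        have 1: "i l \<cdot>[x,xs l,x] p l \<in> hom x x" if "l < n" for l using ip(1) xo xC that by simp
        have 2: "u \<cdot>[x,x,sh y] (i l \<cdot>[x,xs l,x] p l) = \<zero>[x,sh y]" if l: "l < n" for l
        proof -
          have "van (xs l) (sh y)" using A l y unfolding perpL_def by blast
          then have z: "u \<cdot>[xs l,x,sh y] i l = \<zero>[xs l,sh y]" by (rule vanD) (use u ip(1) xo xC yo l in simp)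
          then show ?thesis using Cmp_reassoc[OF z, of x "p l"] u ip(1) xo xC yo l by simp
        qed
        have "u = u \<cdot>[x,x,sh y] hsum x x (\<lambda>l. i l \<cdot>[x,xs l,x] p l) {..<n}" unfolding ip(2) using u xC yo by simp
        also have "\<dots> = hsum x (sh y) (\<lambda>l. u \<cdot>[x,x,sh y] (i l \<cdot>[x,xs l,x] p l)) {..<n}"
          by (rule Cmp_hsum_right) (use u xC yo 1 in auto)
        also have "\<dots> = \<zero>[x,sh y]" by (rule hsum_zer) (use 2 xC yo in auto)
        finally show "u = \<zero>[x,sh y]" .
      qed (use xC torsY_C[OF y] in auto)
      then show "x \<in> ?X" unfolding perpL_def using xC by blast }
    fix l assume A: "direct_sum (full_sub T C) x n xs \<and> x \<in> ?X" and l: "l < n"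
    obtain i p where ip: "\<forall>l<n. i l \<in> hom (xs l) x \<and> p l \<in> hom x (xs l) \<and> p l \<cdot>[xs l,x,xs l] i l = idm (xs l)"
      using ds(3)[OF conjunct1[OF A]] by blast
    have xC: "x \<in> C" "xs l \<in> C" using A l ds(1,2) by blast+
    have "van (xs l) (sh y)" if y: "y \<in> ?Y" for y
      by (rule van_retract_left[of "xs l" x "sh y" "i l" "p l"])
        (use A ip l xC y torsY_C[OF y] in \<open>auto simp: perpL_def\<close>)
    then show "xs l \<in> ?X" unfolding perpL_def using xC by blast
  qed
  moreover have "\<forall>x\<in>?X. \<forall>y\<in>?Y. hom x (sh y) = {\<zero>[x,sh y]}" unfolding perpL_def van_def by blast
  ultimately show ?thesis unfolding complete_cotorsion_pair_def using left right unfolding tri_def by blast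
qed

end

context noetherian_presilting
begin

lemma torsion_to_cotorsion:
  assumes KS: "Krull_Schmidt T" and ff: "functorially_finite_torsion_pair H U V"
  shows "\<exists>P Q. complete_cotorsion_pair T C P Q \<and> UY Q = U"
proof -
  have UO: "U \<subseteq> Obj H" and VO: "V \<subseteq> Obj H" and U: "U = left_perp H V" and cov: "covariantly_finite H U"
    using ff unfolding functorially_finite_torsion_pair_def torsion_pair_def by auto
  define W where "W = {d \<in> C. \<exists>N\<in>V. \<exists>\<psi>. chart d N \<psi>}"
  have WC: "W \<subseteq> C" unfolding W_def by blast
  have mem: "M \<in> U \<longleftrightarrow> c \<in> torsY W" if c: "c \<in> C" "chart c M \<theta>" "M \<in> Obj H" for c M \<theta>
  proof
    assume M: "M \<in> U"
    have "null c d u" if d: "d \<in> W" and u: "u \<in> hom c d" for d u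
    proof -
      obtain N \<psi> where N: "N \<in> V" "chart d N \<psi>" "d \<in> C" using d unfolding W_def by blast
      have "arr H M N = {\<zero>\<^bsub>Hom H M N\<^esub>}" using M N(1) unfolding U left_perp_def by blast
      then show ?thesis using hom_zero_iff[OF c N(3,2) _ H_linear] N(1) VO u by blast
    qed
    then show "c \<in> torsY W" unfolding torsY_def using c(1) by blast
  next
    assume cY: "c \<in> torsY W"
    have "arr H M N = {\<zero>\<^bsub>Hom H M N\<^esub>}" if N: "N \<in> V" for N
    proof -
      have NO: "N \<in> Obj H" using N VO by blast
      obtain d \<psi> where d: "d \<in> C" "chart d N \<psi>" by (rule chart_ex[OF NO])
      have "d \<in> W" unfolding W_def using d N by blast
      then show ?thesis using hom_zero_iff[OF c d NO H_linear] cY unfolding torsY_def by blast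
    qed
    then show "M \<in> U" unfolding U left_perp_def using c(3) by blast
  qed
  have "UY (torsY W) = U"
  proof
    show "UY (torsY W) \<subseteq> U" unfolding UY_def using mem torsY_C by blast
    show "U \<subseteq> UY (torsY W)"
    proof
      fix M assume M: "M \<in> U"
      then have MO: "M \<in> Obj H" using UO by blast
      obtain c \<theta> where c: "c \<in> C" "chart c M \<theta>" by (rule chart_ex[OF MO])
      then show "M \<in> UY (torsY W)" unfolding UY_def using mem[OF c MO] M MO by blast
    qed
  qed
  moreover have "\<exists>y f. approx (torsY W) c y f" if c: "c \<in> C" for c
  proof -
    note cc = c chart_Hob[OF C_Obj[OF c]] Hob_Obj[OF c]
    obtain M \<phi> where M: "M \<in> U" "\<phi> \<in> arr H (Hob c) M" and
      univ: "\<And>N g. N \<in> U \<Longrightarrow> g \<in> arr H (Hob c) N \<Longrightarrow> \<exists>e\<in>arr H M N. g = Cmp H (Hob c) M N e \<phi>"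
      using cov cc(3) unfolding covariantly_finite_def by blast
    have MO: "M \<in> Obj H" using M UO by blast
    obtain y \<theta> where y: "y \<in> C" "chart y M \<theta>" by (rule chart_ex[OF MO])
    have yY: "y \<in> torsY W" using mem[OF y MO] M(1) by blast
    obtain f where f: "f \<in> hom c y" "induces c (\<lambda>a x. {x}) y \<theta> \<phi> f" by (rule hom_lift[OF cc y MO M(2)])
    show ?thesis
    proof (rule approx_from_null[OF WC c yY f(1)])
      fix y' u assume y': "y' \<in> torsY W" and u: "u \<in> hom c y'"
      note yC = torsY_C[OF y']
      note yc = yC chart_Hob[OF C_Obj[OF yC]] Hob_Obj[OF yC]
      note o = C_Obj[OF c] C_Obj[OF y(1)] C_Obj[OF yC]
      obtain g where g: "g \<in> arr H (Hob c) (Hob y')" "induces c (\<lambda>a x. {x}) y' (\<lambda>a x. {x}) g u"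
        by (rule hom_of[OF cc yc u])
      have "Hob y' \<in> U" using mem[OF yc] y' by blast
      then obtain \<epsilon> where \<epsilon>: "\<epsilon> \<in> arr H M (Hob y')" "g = Cmp H (Hob c) M (Hob y') \<epsilon> \<phi>" using univ g(1) by blast
      obtain e where e: "e \<in> hom y y'" "induces y \<theta> y' (\<lambda>a x. {x}) \<epsilon> e" by (rule hom_lift[OF y MO yc \<epsilon>(1)])
      \<comment> \<open>Transformations see only S-points: the factorization of \<open>g\<close>
        through \<open>\<phi>\<close> lifts to C up to a null morphism, which is the form
        \<open>approx_from_null\<close> starts from.\<close>
      have "null c y' (u \<ominus>[c,y'] (e \<cdot>[c,y,y'] f))"
        unfolding null_def
      proof (intro ballI)
        fix s x assume s: "s \<in> S" and x: "x \<in> hom s c"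
        have fx: "f \<cdot>[s,c,y] x \<in> hom s y" using f(1) x s o by simp
        have "{u \<cdot>[s,c,y'] x} = {e \<cdot>[s,y,y'] (f \<cdot>[s,c,y] x)}"
          using inducesD[OF g(2) s x] inducesD[OF f(2) s x] inducesD[OF e(2) s fx]
            fun_cong[OF fun_cong[OF \<epsilon>(2)], of s "{x}"] s x by simp
        then show "(u \<ominus>[c,y'] (e \<cdot>[c,y,y'] f)) \<cdot>[s,c,y'] x = \<zero>[s,y']"
          using u e(1) f(1) x s o by (simp add: Cmp_mns_left Cmp_assoc)
      qed
      then show "\<exists>e\<in>hom y y'. null c y' (u \<ominus>[c,y'] (e \<cdot>[c,y,y'] f))" using e(1) by blast
    qed
  qed
  ultimately show ?thesis using cotorsion_of_torsY[OF KS WC] by blast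
qed

text \<open>The class \<open>UY Q\<close> determines \<open>Q\<close> by \<open>UY_inj\<close>, and
  \<open>Q\<close> determines \<open>P\<close> as its left Ext-orthogonal. On the other side
  \<open>V\<close> is recovered from \<open>U\<close> as its right orthogonal.\<close>

lemma cotorsion_torsion_bij:
  assumes KS: "Krull_Schmidt T"
  shows "bij_betw (\<lambda>(P, Q). (UY Q, right_perp H (UY Q)))
    {(P, Q). complete_cotorsion_pair T C P Q} {(U, V). functorially_finite_torsion_pair H U V}"
  unfolding bij_betw_def
proof
  show "inj_on (\<lambda>(P, Q). (UY Q, right_perp H (UY Q))) {(P, Q). complete_cotorsion_pair T C P Q}"
  proof (rule inj_onI, clarify)
    fix P Q P' Q' assume c: "complete_cotorsion_pair T C P Q" "complete_cotorsion_pair T C P' Q'" and eq: "UY Q = UY Q'"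
    have "Q = Q'"
      using UY_inj[OF cotorsion_subset(1)[OF c(1)] cotorsion_subset(1)[OF c(2)]] eq
        cotorsion_perpR[OF c(1)] cotorsion_perpR[OF c(2)] by simp
    then show "P = P' \<and> Q = Q'" using cotorsion_perpL[OF c(1)] cotorsion_perpL[OF c(2)] by simp
  qed
  show "(\<lambda>(P, Q). (UY Q, right_perp H (UY Q))) ` {(P, Q). complete_cotorsion_pair T C P Q} =
      {(U, V). functorially_finite_torsion_pair H U V}" (is "?f ` ?A = ?B")
  proof
    show "?f ` ?A \<subseteq> ?B" using cotorsion_to_torsion by auto
    show "?B \<subseteq> ?f ` ?A"
    proof clarify
      fix U V assume ff: "functorially_finite_torsion_pair H U V"
      obtain P Q where "complete_cotorsion_pair T C P Q" "UY Q = U" using torsion_to_cotorsion[OF KS ff] by blast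
      moreover have "V = right_perp H U" using ff unfolding functorially_finite_torsion_pair_def torsion_pair_def by blast
      ultimately show "(U, V) \<in> ?f ` ?A" by (auto intro!: image_eqI[of _ _ "(P, Q)"])
    qed
  qed
qed

end

theorem theorem3p6:
  fixes k :: "'k ring" and T :: "('o, 'm, 'k) tricat" and S :: "'o set"
  assumes "cring k" and "noetherian_ring k"
    and "triangulated_category k T"
    and "Hom_finite k T"
    and "Krull_Schmidt T"
    and "presilting T S"
    and "noetherian_category k (mod_cat k (full_sub T S))"
  shows "\<exists>\<Phi>. bij_betw \<Phi>
    {(P, Q). complete_cotorsion_pair T (two_term T S) P Q}
    {(U, V). functorially_finite_torsion_pair (mod_cat k (full_sub T S)) U V}"
proof -
  interpret noetherian_presilting k T S
    using assms(3,6,7) by (simp add: noetherian_presilting_def noetherian_presilting_axioms_def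
      presilting_category_def presilting_category_axioms_def)
  show ?thesis using cotorsion_torsion_bij[OF assms(5)] by blast
qed

end
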